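(* Let the geometric assumption, the CutFEM stability assumption and the covering assumption (all defined in the context) hold, let local solves be exact, and prescribe $\gamma=\gamma(p)\in(0,1]$ and an admissible $\gamma_D=\gamma_D(p)$. With $q_\ell$, $q$, $\varrho_\ell$, $\varrho_\star$, $\tilde\eta$ as defined in the context, one has $q\le\tilde\eta<1$, and the W-cycle contraction numbers obey the recursion $$\varrho_\ell\le q+\varrho_{\ell-1}^2 .$$ Assume in addition that $q\le\tfrac14$. Then $$\varrho_\ell\le\varrho_\star\le 2q<1\qquad\text{for all }\ell,$$ a contraction independent of the number of levels, of the mesh size, and of the position of $\Gamma$.
   Context: Meshes and spaces. $d\in\{2,3\}$, $p\ge1$; $\Omega\subset\mathbb R^d$ is a bounded domain with boundary $\Gamma$ and outward unit normal $n$. $\mathcal M_0,\dots,\mathcal M_L$ are nested Cartesian background grids covering $\Omega$: the cells of $\mathcal M_\ell$ are closed axis-parallel cubes of edge $h_\ell$, and $\mathcal M_\ell$ is the uniform dyadic refinement of $\mathcal M_{\ell-1}$, so $h_\ell=h_{\ell-1}/2$. Active cells: $\mathcal M_{\ell,\Omega}=\{K\in\mathcal M_\ell:K\cap\Omega\ne\emptyset\}$; $\Omega_\ell$ is their union. Cut (intersected) cells are those meeting $\Gamma$. $\mathbb Q_p(K)$: polynomials of degree at most $p$ in each variable. $V_\ell$: continuous functions on $\Omega_\ell$ that are in $\mathbb Q_p(K)$ on each active cell $K$, with nodal (Lagrange) basis $\phi_{\ell,i}$ at the tensor-product Gauss–Lobatto nodes $x_{\ell,i}$. $\mathbb F_G=\mathbb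 F_G^\ell$: faces shared by two active cells at least one of which is cut. Forms. $A_\ell=a_\ell+g_\ell$ with $a_\ell(u,v)=(\nabla u,\nabla v)_\Omega-(\partial_n u,v)_\Gamma-(u,\partial_n v)_\Gamma+\gamma_D h_\ell^{-1}(u,v)_\Gamma$ and $g_\ell(u,v)=\gamma\sum_{F\in\mathbb F_G}\sum_{k=1}^p\frac{h_\ell^{2k-1}}{(k!)^2}(\llbracket\partial_n^k u\rrbracket,\llbracket\partial_n^k v\rrbracket)_F$, $\gamma\in(0,1]$ (on $F$, $n$ is a fixed unit normal and $\llbracket\cdot\rrbracket$ the jump). $\gamma,\gamma_D$ are the same on all levels. $\|v\|_{A_\ell}^2:=A_\ell(v,v)$, and $\|\cdot\|_{A_\ell}$ of an operator on $V_\ell$ is the induced operator norm. The prolongation $\mathcal I_\ell:V_{\ell-1}\to V_\ell$ is restriction of functions to $\Omega_\ell$ (identity on functions). Geometric assumption. $\Gamma$ is $C^2$ with positive reach $\delta_0>0$ (the closest-point projection onto $\Gamma$ is well defined and $C^1$ in the tube of radius $\delta_0$). On every level, if $\Gamma$ meets a cell $K$, then $\Gamma\cap K$ is a single curve (surface) intersecting $\partial K$ exactly twice (in a single closed curve if $d=3$), each closed face is intersected at most once, and $K\setminus\Gamma$ has exactly two connected components. $\Gamma$ contains no mesh vertex of any $\mathcal M_\ell$, $\Omega_\ell\subseteq\Omega_{\ell-1}$ for all $\ell$, and $c_R h_{\ell-1}\le\delta_0$ on every level used, with $c_R=24d+10\sqrt d$. CutFEM stability assumption. With $N_\ell(v)^2:=\|\nabla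 v\|_{0,\Omega}^2+h_\ell\|\partial_n v\|_{0,\Gamma}^2+h_\ell^{-1}\|v\|_{0,\Gamma}^2+g_\ell(v,v)$, one has for $u,v\in V_\ell$: $c_A N_\ell(v)^2\le A_\ell(v,v)$, $A_\ell(u,v)\le C_A N_\ell(u)N_\ell(v)$, and $|v|_{1,\Omega_\ell\setminus\Omega}^2\le C(|v|_{1,\Omega}^2+g_\ell(v,v))$, where $c_A,C_A,C>0$ are independent of $\ell$ and of the cut configuration. $\gamma_D$ is admissible if this assumption holds for it. Patches. Admissible vertices $\vartheta_1,\dots,\vartheta_J$ of $\mathcal M_\ell$ ($J=J(\ell)$): all grid vertices in $\Omega$ and all exterior vertices with at least one cut adjacent cell. $\widehat\omega_j$: union of the $2^d$ background cells sharing $\vartheta_j$; $\omega_j$: union of the active cells in $\widehat\omega_j$. For a basis function $\phi_{\ell,i}$, $\omega(i)$ is the union of all active cells containing $x_{\ell,i}$. Local spaces: $V^{\mathrm D}_{\ell,j}=\operatorname{span}\{\phi_{\ell,i}:x_{\ell,i}\in\operatorname{int}\widehat\omega_j\}$ or $V^{\mathrm{FR}}_{\ell,j}=\operatorname{span}\{\phi_{\ell,i}:\omega(i)\subseteq\omega_j\}$; $V_{\ell,j}$ denotes either. $V_{\ell,0}:=\mathcal I_\ell V_{\ell-1}$. $P_j$ ($j\ge1$) is the $A_\ell$-orthogonal projection onto $V_{\ell,j}$. Covering assumption. For each nodal basis function $\phi_{\ell,i}$ of $V_\ell$ there is $j\in\{1,\dots,J\}$ with $\phi_{\ell,i}\in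 V_{\ell,j}$. Constants. $C_{\mathrm{pr}}$: a constant, independent of $\ell$ and the cut configuration, with $\|\mathcal I_\ell v\|_{A_\ell}\le C_{\mathrm{pr}}\|v\|_{A_{\ell-1}}$ for all $v\in V_{\ell-1}$. $C_{\mathrm{sd}}(p)$: a constant, independent of $\ell$ and the cut configuration, such that every $v\in V_\ell$ can be written $v=\sum_{j=0}^Jv_j$, $v_j\in V_{\ell,j}$, $v_0=\mathcal I_\ell\widehat v_0$, $\widehat v_0\in V_{\ell-1}$, with $\sum_{j=0}^J\|v_j\|_{A_\ell}^2\le C_{\mathrm{sd}}(p)\|v\|_{A_\ell}^2$ and $\|\widehat v_0\|_{A_{\ell-1}}^2\le C_{\mathrm{sd}}(p)\|v\|_{A_\ell}^2$. Under the stated assumptions the paper proves that both exist. $N_O(d)=5^d$ and $\tilde\eta^2:=1-\bigl[(2N_O(d)^2+1)(1+C_{\mathrm{pr}}^2)C_{\mathrm{sd}}(p)\bigr]^{-1}$, $\tilde\eta\ge0$. Cycles. $S_\ell:=(I-P_J)\cdots(I-P_1)$ is one multiplicative smoothing sweep on level $\ell$. $\mathcal R_\ell u\in V_{\ell-1}$ is defined by $A_{\ell-1}(\mathcal R_\ell u,z)=A_\ell(u,\mathcal I_\ell z)$ for all $z\in V_{\ell-1}$. The two-level operator with damped rediscretized coarse solve is $\widetilde E_{\mathrm{TG},\ell}:=S_\ell(I-C_{\mathrm{pr}}^{-2}\mathcal I_\ell\mathcal R_\ell)$. The W-cycle approximates the coarse problem by two recursive applications of the level-$(\ell-1)$ cycle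 from zero initial guess: $E^{\mathrm W}_1:=0$ (exact solve on the coarsest level) and $E^{\mathrm W}_\ell:=S_\ell\bigl(I-C_{\mathrm{pr}}^{-2}\mathcal I_\ell(I-(E^{\mathrm W}_{\ell-1})^2)\mathcal R_\ell\bigr)$ for $\ell\ge2$. Contraction numbers: $q_\ell:=\|\widetilde E_{\mathrm{TG},\ell}\|_{A_\ell}$, $q:=\sup_{\ell\ge2}q_\ell$, $\varrho_\ell:=\|E^{\mathrm W}_\ell\|_{A_\ell}$, and, when $q\le\tfrac14$, $\varrho_\star:=\tfrac12(1-\sqrt{1-4q})$. *)

theory Defs
  imports "HOL-Analysis.Analysis" "HOL-Computational_Algebra.Polynomial"
begin

section \<open>Hausdorff measure\<close>

definition hausdorff_content :: "nat \<Rightarrow> real \<Rightarrow> 'a::metric_space set \<Rightarrow> ennreal" where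
  "hausdorff_content m \<delta> A =
     (INF C\<in>{C :: nat \<Rightarrow> 'a set. A \<subseteq> (\<Union>i. C i) \<and> (\<forall>i. bounded (C i) \<and> diameter (C i) \<le> \<delta>)}.
        \<Sum>i. ennreal (unit_ball_vol (real m) * (diameter (C i) / 2) ^ m))"

text \<open>The metric outer measure is countably additive on Borel sets, so \<open>measure_of\<close> below
  returns it there (not the zero measure). The factor \<open>unit_ball_vol\<close> makes it agree with
  surface measure on \<open>m\<close>-dimensional surfaces. It is only used with \<open>m \<ge> 1\<close>.\<close>

definition hausdorff :: "nat \<Rightarrow> 'a::metric_space measure" where
  "hausdorff m = measure_of UNIV (sets borel) (\<lambda>A. SUP \<delta>\<in>{0<..}. hausdorff_content m \<delta> A)"

section \<open>Smooth functions and smooth boundaries\<close>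

definition C1_on :: "'a::real_normed_vector set \<Rightarrow> ('a \<Rightarrow> 'b::real_normed_vector) \<Rightarrow> bool" where
  "C1_on S f \<longleftrightarrow> (\<exists>D. (\<forall>x\<in>S. (f has_derivative blinfun_apply (D x)) (at x)) \<and> continuous_on S D)"

definition C2_on :: "'a::real_normed_vector set \<Rightarrow> ('a \<Rightarrow> 'b::real_normed_vector) \<Rightarrow> bool" where
  "C2_on S f \<longleftrightarrow> (\<exists>D. (\<forall>x\<in>S. (f has_derivative blinfun_apply (D x)) (at x)) \<and> C1_on S D)"

definition gradient :: "(real^'d::finite \<Rightarrow> real) \<Rightarrow> real^'d \<Rightarrow> real^'d" where
  "gradient f x = (\<chi> i. frechet_derivative f (at x) (axis i 1))"

text \<open>In the ball around \<open>x\<close>, and with the \<open>i\<close>-th axis oriented by the sign \<open>s\<close>, the open set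
  \<open>U\<close> is the region below the graph of a \<open>C\<^sup>2\<close> function \<open>f\<close> of the remaining coordinates.\<close>

definition C2_chart :: "(real^'d::finite) set \<Rightarrow> real^'d \<Rightarrow> real \<Rightarrow> 'd \<Rightarrow> real \<Rightarrow> (real^'d \<Rightarrow> real) \<Rightarrow> bool" where
  "C2_chart U x r i s f \<longleftrightarrow>
     r > 0 \<and> s \<in> {-1, 1} \<and> C2_on UNIV f \<and> (\<forall>y t. f (y + t *\<^sub>R axis i 1) = f y) \<and>
     U \<inter> ball x r = {y \<in> ball x r. s * y $ i < f y}"

definition C2_boundary :: "(real^'d::finite) set \<Rightarrow> bool" where
  "C2_boundary U \<longleftrightarrow> (\<forall>x\<in>frontier U. \<exists>r i s f. C2_chart U x r i s f)"

definition outer_normal :: "(real^'d::finite) set \<Rightarrow> real^'d \<Rightarrow> real^'d" where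
  "outer_normal U x =
     (THE \<nu>. \<exists>r i s f. C2_chart U x r i s f \<and> \<nu> = sgn (axis i s - gradient f x))"

definition positive_reach :: "'a::euclidean_space set \<Rightarrow> real \<Rightarrow> bool" where
  "positive_reach S \<delta> \<longleftrightarrow>
     \<delta> > 0 \<and> (\<forall>x. infdist x S < \<delta> \<longrightarrow> (\<exists>!y. y \<in> S \<and> dist x y = infdist x S)) \<and>
     C1_on {x. infdist x S < \<delta>} (\<lambda>x. THE y. y \<in> S \<and> dist x y = infdist x S)"

section \<open>Polynomials and Gauss--Lobatto nodes\<close>

definition Qp :: "nat \<Rightarrow> (real^'d::finite \<Rightarrow> real) set" where
  "Qp p = {q. \<exists>c. \<forall>x. q x = (\<Sum>\<alpha> | \<forall>i. \<alpha> i \<le> p. c \<alpha> * (\<Prod>i\<in>UNIV. x $ i ^ \<alpha> i))}"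

text \<open>Rodrigues' formula.\<close>

definition legendre :: "nat \<Rightarrow> real poly" where
  "legendre p = smult (1 / (2 ^ p * fact p)) ((pderiv ^^ p) ([:-1, 0, 1:] ^ p))"

definition gauss_lobatto :: "nat \<Rightarrow> real set" where
  "gauss_lobatto p = {-1, 1} \<union> {t. poly (pderiv (legendre p)) t = 0}"

section \<open>Cut finite element configurations\<close>

datatype patch_type = Type_D | Type_FR

text \<open>The background grid of level \<open>l\<close> is the lattice of cubes of edge \<open>edge0 / 2 ^ l\<close> with one
  vertex at \<open>origin\<close>; its cells and its vertices are indexed by integer vectors. The list
  \<open>patch_order l\<close> is the enumeration of the patch vertices of level \<open>l\<close>, in the order
  in which the smoother visits them.\<close>

record ('d::finite) cutfem =
  dom :: "(real^'d) set"
  origin :: "real^'d"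
  edge0 :: real
  deg :: nat
  gam :: real
  gamD :: real
  ptype :: patch_type
  patch_order :: "nat \<Rightarrow> (int^'d) list"

definition bdry :: "('d::finite) cutfem \<Rightarrow> (real^'d) set" where
  "bdry c = frontier (dom c)"

definition mesh_size :: "('d::finite) cutfem \<Rightarrow> nat \<Rightarrow> real" where
  "mesh_size c l = edge0 c / 2 ^ l"

definition vertex :: "('d::finite) cutfem \<Rightarrow> nat \<Rightarrow> int^'d \<Rightarrow> real^'d" where
  "vertex c l z = origin c + (\<chi> i. mesh_size c l * of_int (z $ i))"

definition cell :: "('d::finite) cutfem \<Rightarrow> nat \<Rightarrow> int^'d \<Rightarrow> (real^'d) set" where
  "cell c l k = cbox (vertex c l k) (vertex c l (k + 1))"

definition cell_faces :: "('d::finite) cutfem \<Rightarrow> nat \<Rightarrow> int^'d \<Rightarrow> (real^'d) set set" where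
  "cell_faces c l k = {{x \<in> cell c l k. x $ i = w $ i} |i w. w = vertex c l k \<or> w = vertex c l (k + 1)}"

definition active :: "('d::finite) cutfem \<Rightarrow> nat \<Rightarrow> (int^'d) set" where
  "active c l = {k. cell c l k \<inter> dom c \<noteq> {}}"

definition cut :: "('d::finite) cutfem \<Rightarrow> nat \<Rightarrow> (int^'d) set" where
  "cut c l = {k. cell c l k \<inter> bdry c \<noteq> {}}"

definition active_dom :: "('d::finite) cutfem \<Rightarrow> nat \<Rightarrow> (real^'d) set" where
  "active_dom c l = (\<Union>k\<in>active c l. cell c l k)"

text \<open>A pair \<open>(k, i)\<close> stands for the face shared by the cells \<open>k\<close> and \<open>k + axis i 1\<close>.\<close>

definition ghost_faces :: "('d::finite) cutfem \<Rightarrow> nat \<Rightarrow> ((int^'d) \<times> 'd) set" where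
  "ghost_faces c l = {(k, i). k \<in> active c l \<and> k + axis i 1 \<in> active c l \<and>
                              (k \<in> cut c l \<or> k + axis i 1 \<in> cut c l)}"

section \<open>Finite element spaces\<close>

text \<open>Functions on the active domain are extended by \<open>0\<close> to the whole space.\<close>

definition V :: "('d::finite) cutfem \<Rightarrow> nat \<Rightarrow> (real^'d \<Rightarrow> real) set" where
  "V c l = {v. continuous_on (active_dom c l) v \<and>
               (\<forall>k\<in>active c l. \<exists>q\<in>Qp (deg c). \<forall>x\<in>cell c l k. v x = q x) \<and>
               (\<forall>x. x \<notin> active_dom c l \<longrightarrow> v x = 0)}"

definition prolong :: "('d::finite) cutfem \<Rightarrow> nat \<Rightarrow> (real^'d \<Rightarrow> real) \<Rightarrow> (real^'d \<Rightarrow> real)" where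
  "prolong c l v = (\<lambda>x. if x \<in> active_dom c l then v x else 0)"

definition nodes :: "('d::finite) cutfem \<Rightarrow> nat \<Rightarrow> (real^'d) set" where
  "nodes c l = {vertex c l k + (\<chi> i. mesh_size c l * (t i + 1) / 2) |k t.
                  k \<in> active c l \<and> (\<forall>i. t i \<in> gauss_lobatto (deg c))}"

definition nodal_basis :: "('d::finite) cutfem \<Rightarrow> nat \<Rightarrow> real^'d \<Rightarrow> (real^'d \<Rightarrow> real)" where
  "nodal_basis c l x = (THE v. v \<in> V c l \<and> (\<forall>y\<in>nodes c l. v y = (if y = x then 1 else 0)))"

definition cell_poly :: "('d::finite) cutfem \<Rightarrow> nat \<Rightarrow> int^'d \<Rightarrow> (real^'d \<Rightarrow> real) \<Rightarrow> (real^'d \<Rightarrow> real)" where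
  "cell_poly c l k v = (THE q. q \<in> Qp (deg c) \<and> (\<forall>x\<in>cell c l k. v x = q x))"

text \<open>The cellwise gradient. On cell faces, where it is two-valued, the half-open cell
  containing the point decides.\<close>

definition cell_index :: "('d::finite) cutfem \<Rightarrow> nat \<Rightarrow> real^'d \<Rightarrow> int^'d" where
  "cell_index c l x = (\<chi> i. \<lfloor>(x $ i - origin c $ i) / mesh_size c l\<rfloor>)"

definition grad :: "('d::finite) cutfem \<Rightarrow> nat \<Rightarrow> (real^'d \<Rightarrow> real) \<Rightarrow> real^'d \<Rightarrow> real^'d" where
  "grad c l v x = gradient (cell_poly c l (cell_index c l x) v) x"

definition normal_deriv :: "('d::finite) cutfem \<Rightarrow> nat \<Rightarrow> (real^'d \<Rightarrow> real) \<Rightarrow> real^'d \<Rightarrow> real" where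
  "normal_deriv c l v x = grad c l v x \<bullet> outer_normal (dom c) x"

text \<open>The jump of the \<open>m\<close>-th derivative in direction \<open>axis i 1\<close> across the face \<open>(k, i)\<close>.\<close>

definition jump :: "('d::finite) cutfem \<Rightarrow> nat \<Rightarrow> int^'d \<Rightarrow> 'd \<Rightarrow> nat \<Rightarrow> (real^'d \<Rightarrow> real) \<Rightarrow> real^'d \<Rightarrow> real" where
  "jump c l k i m v x =
     (deriv ^^ m) (\<lambda>t. cell_poly c l (k + axis i 1) v (x + t *\<^sub>R axis i 1)) 0
     - (deriv ^^ m) (\<lambda>t. cell_poly c l k v (x + t *\<^sub>R axis i 1)) 0"

section \<open>Bilinear forms and norms\<close>

definition int_surf :: "(real^'d::finite) set \<Rightarrow> (real^'d \<Rightarrow> real) \<Rightarrow> real" where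
  "int_surf S f = (LINT x:S|hausdorff (CARD('d) - 1). f x)"

definition form_a :: "('d::finite) cutfem \<Rightarrow> nat \<Rightarrow> (real^'d \<Rightarrow> real) \<Rightarrow> (real^'d \<Rightarrow> real) \<Rightarrow> real" where
  "form_a c l u v =
     (LINT x:dom c|lebesgue. grad c l u x \<bullet> grad c l v x)
     - int_surf (bdry c) (\<lambda>x. normal_deriv c l u x * v x)
     - int_surf (bdry c) (\<lambda>x. u x * normal_deriv c l v x)
     + gamD c / mesh_size c l * int_surf (bdry c) (\<lambda>x. u x * v x)"

definition form_g :: "('d::finite) cutfem \<Rightarrow> nat \<Rightarrow> (real^'d \<Rightarrow> real) \<Rightarrow> (real^'d \<Rightarrow> real) \<Rightarrow> real" where
  "form_g c l u v =
     gam c * (\<Sum>(k, i)\<in>ghost_faces c l. \<Sum>m=1..deg c.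
       mesh_size c l ^ (2 * m - 1) / (fact m)\<^sup>2 *
       int_surf (cell c l k \<inter> cell c l (k + axis i 1)) (\<lambda>x. jump c l k i m u x * jump c l k i m v x))"

definition form_A :: "('d::finite) cutfem \<Rightarrow> nat \<Rightarrow> (real^'d \<Rightarrow> real) \<Rightarrow> (real^'d \<Rightarrow> real) \<Rightarrow> real" where
  "form_A c l u v = form_a c l u v + form_g c l u v"

definition norm_A :: "('d::finite) cutfem \<Rightarrow> nat \<Rightarrow> (real^'d \<Rightarrow> real) \<Rightarrow> real" where
  "norm_A c l v = sqrt (form_A c l v v)"

definition opnorm_A :: "('d::finite) cutfem \<Rightarrow> nat \<Rightarrow> ((real^'d \<Rightarrow> real) \<Rightarrow> (real^'d \<Rightarrow> real)) \<Rightarrow> real" where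
  "opnorm_A c l E = (SUP v\<in>{v \<in> V c l. norm_A c l v \<le> 1}. norm_A c l (E v))"

text \<open>The square of the norm \<open>N\<close> of the stability assumption.\<close>

definition norm_N_sq :: "('d::finite) cutfem \<Rightarrow> nat \<Rightarrow> (real^'d \<Rightarrow> real) \<Rightarrow> real" where
  "norm_N_sq c l v =
     (LINT x:dom c|lebesgue. (norm (grad c l v x))\<^sup>2)
     + mesh_size c l * int_surf (bdry c) (\<lambda>x. (normal_deriv c l v x)\<^sup>2)
     + 1 / mesh_size c l * int_surf (bdry c) (\<lambda>x. (v x)\<^sup>2)
     + form_g c l v v"

section \<open>Assumptions\<close>

text \<open>The \<open>else\<close> branch is for dimension 3, where a single surface piece means a connected
  one, and a face is met at most once if the surface meets it in a connected (possibly empty) set.\<close>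

definition single_crossing :: "('d::finite) cutfem \<Rightarrow> nat \<Rightarrow> int^'d \<Rightarrow> bool" where
  "single_crossing c l k \<longleftrightarrow>
     card (components (cell c l k - bdry c)) = 2 \<and>
     (if CARD('d) = 2
      then (\<exists>g. arc g \<and> path_image g = bdry c \<inter> cell c l k) \<and>
           card (bdry c \<inter> frontier (cell c l k)) = 2 \<and>
           (\<forall>F\<in>cell_faces c l k. card (bdry c \<inter> F) \<le> 1)
      else connected (bdry c \<inter> cell c l k) \<and>
           (\<exists>g. simple_path g \<and> pathfinish g = pathstart g \<and>
                path_image g = bdry c \<inter> frontier (cell c l k)) \<and>
           (\<forall>F\<in>cell_faces c l k. connected (bdry c \<inter> F)))"

definition geometric_assumption :: "('d::finite) cutfem \<Rightarrow> nat \<Rightarrow> real \<Rightarrow> bool" where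
  "geometric_assumption c L \<delta>0 \<longleftrightarrow>
     C2_boundary (dom c) \<and> positive_reach (bdry c) \<delta>0 \<and>
     (\<forall>l\<le>L. \<forall>k. bdry c \<inter> cell c l k \<noteq> {} \<longrightarrow> single_crossing c l k) \<and>
     (\<forall>l\<le>L. \<forall>z. vertex c l z \<notin> bdry c) \<and>
     (\<forall>l\<in>{1..L}. active_dom c l \<subseteq> active_dom c (l - 1)) \<and>
     (\<forall>l\<in>{1..L}. (24 * real CARD('d) + 10 * sqrt (real CARD('d))) * mesh_size c (l - 1) \<le> \<delta>0)"

text \<open>That \<open>gamD c\<close> is an admissible parameter is expressed by this predicate as well: it
  enters through \<open>form_A\<close>.\<close>

definition cutfem_stability :: "('d::finite) cutfem \<Rightarrow> nat \<Rightarrow> real \<Rightarrow> real \<Rightarrow> real \<Rightarrow> bool" where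
  "cutfem_stability c L cA CA C \<longleftrightarrow>
     cA > 0 \<and> CA > 0 \<and> C > 0 \<and>
     (\<forall>l\<le>L. \<forall>v\<in>V c l.
        cA * norm_N_sq c l v \<le> form_A c l v v \<and>
        (\<forall>u\<in>V c l. form_A c l u v \<le> CA * sqrt (norm_N_sq c l u) * sqrt (norm_N_sq c l v)) \<and>
        (LINT x:active_dom c l - dom c|lebesgue. (norm (grad c l v x))\<^sup>2)
          \<le> C * ((LINT x:dom c|lebesgue. (norm (grad c l v x))\<^sup>2) + form_g c l v v))"

section \<open>Patches, smoother and cycles\<close>

definition admissible_vertices :: "('d::finite) cutfem \<Rightarrow> nat \<Rightarrow> (int^'d) set" where
  "admissible_vertices c l =
     {z. vertex c l z \<in> dom c \<or>
         (vertex c l z \<notin> closure (dom c) \<and> (\<exists>k\<in>cut c l. vertex c l z \<in> cell c l k))}"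

definition patch_hat :: "('d::finite) cutfem \<Rightarrow> nat \<Rightarrow> int^'d \<Rightarrow> (real^'d) set" where
  "patch_hat c l z = \<Union> {cell c l k |k. vertex c l z \<in> cell c l k}"

definition patch :: "('d::finite) cutfem \<Rightarrow> nat \<Rightarrow> int^'d \<Rightarrow> (real^'d) set" where
  "patch c l z = \<Union> {cell c l k |k. k \<in> active c l \<and> vertex c l z \<in> cell c l k}"

definition node_patch :: "('d::finite) cutfem \<Rightarrow> nat \<Rightarrow> real^'d \<Rightarrow> (real^'d) set" where
  "node_patch c l x = \<Union> {cell c l k |k. k \<in> active c l \<and> x \<in> cell c l k}"

definition patch_nodes :: "('d::finite) cutfem \<Rightarrow> nat \<Rightarrow> int^'d \<Rightarrow> (real^'d) set" where
  "patch_nodes c l z =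
     (case ptype c of
        Type_D \<Rightarrow> {x \<in> nodes c l. x \<in> interior (patch_hat c l z)}
      | Type_FR \<Rightarrow> {x \<in> nodes c l. node_patch c l x \<subseteq> patch c l z})"

definition V_loc :: "('d::finite) cutfem \<Rightarrow> nat \<Rightarrow> int^'d \<Rightarrow> (real^'d \<Rightarrow> real) set" where
  "V_loc c l z = {(\<lambda>x. \<Sum>y\<in>patch_nodes c l z. a y * nodal_basis c l y x) |a. True}"

definition patch_enumeration :: "('d::finite) cutfem \<Rightarrow> nat \<Rightarrow> bool" where
  "patch_enumeration c L \<longleftrightarrow>
     (\<forall>l\<le>L. distinct (patch_order c l) \<and> set (patch_order c l) = admissible_vertices c l)"

definition covering_assumption :: "('d::finite) cutfem \<Rightarrow> nat \<Rightarrow> bool" where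
  "covering_assumption c L \<longleftrightarrow>
     (\<forall>l\<le>L. \<forall>y\<in>nodes c l. \<exists>z\<in>admissible_vertices c l. nodal_basis c l y \<in> V_loc c l z)"

definition local_proj :: "('d::finite) cutfem \<Rightarrow> nat \<Rightarrow> int^'d \<Rightarrow> (real^'d \<Rightarrow> real) \<Rightarrow> (real^'d \<Rightarrow> real)" where
  "local_proj c l z u =
     (THE w. w \<in> V_loc c l z \<and> (\<forall>y\<in>V_loc c l z. form_A c l w y = form_A c l u y))"

text \<open>\<open>fold\<close> applies the correction of the first listed patch first, so this is
  \<open>(I - P\<^sub>J) \<circ> \<dots> \<circ> (I - P\<^sub>1)\<close>.\<close>

definition smoother :: "('d::finite) cutfem \<Rightarrow> nat \<Rightarrow> (real^'d \<Rightarrow> real) \<Rightarrow> (real^'d \<Rightarrow> real)" where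
  "smoother c l u = fold (\<lambda>z w x. w x - local_proj c l z w x) (patch_order c l) u"

definition restr :: "('d::finite) cutfem \<Rightarrow> nat \<Rightarrow> (real^'d \<Rightarrow> real) \<Rightarrow> (real^'d \<Rightarrow> real)" where
  "restr c l u =
     (THE w. w \<in> V c (l - 1) \<and> (\<forall>z\<in>V c (l - 1). form_A c (l - 1) w z = form_A c l u (prolong c l z)))"

definition prolongation_bound :: "('d::finite) cutfem \<Rightarrow> nat \<Rightarrow> real \<Rightarrow> bool" where
  "prolongation_bound c L Cpr \<longleftrightarrow>
     (\<forall>l\<in>{1..L}. \<forall>v\<in>V c (l - 1). norm_A c l (prolong c l v) \<le> Cpr * norm_A c (l - 1) v)"

text \<open>The function \<open>v0\<close> is the coarse component; the components \<open>w z\<close> of the patches are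
  indexed by the vertices themselves, since their order is irrelevant here.\<close>

definition stable_decomposition :: "('d::finite) cutfem \<Rightarrow> nat \<Rightarrow> real \<Rightarrow> bool" where
  "stable_decomposition c L Csd \<longleftrightarrow>
     (\<forall>l\<in>{1..L}. \<forall>v\<in>V c l. \<exists>v0\<in>V c (l - 1). \<exists>w.
        (\<forall>z\<in>admissible_vertices c l. w z \<in> V_loc c l z) \<and>
        v = (\<lambda>x. prolong c l v0 x + (\<Sum>z\<in>admissible_vertices c l. w z x)) \<and>
        (norm_A c l (prolong c l v0))\<^sup>2 + (\<Sum>z\<in>admissible_vertices c l. (norm_A c l (w z))\<^sup>2)
          \<le> Csd * (norm_A c l v)\<^sup>2 \<and>
        (norm_A c (l - 1) v0)\<^sup>2 \<le> Csd * (norm_A c l v)\<^sup>2)"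

text \<open>The number \<open>5 ^ d\<close> bounds how many patches interact with a given one.\<close>

definition eta :: "nat \<Rightarrow> real \<Rightarrow> real \<Rightarrow> real" where
  "eta d Cpr Csd = sqrt (1 - inverse ((2 * (5 ^ d)\<^sup>2 + 1) * (1 + Cpr\<^sup>2) * Csd))"

definition E_TG :: "('d::finite) cutfem \<Rightarrow> real \<Rightarrow> nat \<Rightarrow> (real^'d \<Rightarrow> real) \<Rightarrow> (real^'d \<Rightarrow> real)" where
  "E_TG c Cpr l u = smoother c l (\<lambda>x. u x - prolong c l (restr c l u) x / Cpr\<^sup>2)"

text \<open>The coarsest level of the cycle is \<open>1\<close>; the value at \<open>0\<close> plays no role.\<close>

fun E_W :: "('d::finite) cutfem \<Rightarrow> real \<Rightarrow> nat \<Rightarrow> (real^'d \<Rightarrow> real) \<Rightarrow> (real^'d \<Rightarrow> real)" where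
  "E_W c Cpr 0 = (\<lambda>u x. 0)"
| "E_W c Cpr (Suc 0) = (\<lambda>u x. 0)"
| "E_W c Cpr (Suc (Suc l)) = (\<lambda>u.
     let r = restr c (Suc (Suc l)) u;
         e = (\<lambda>x. r x - (E_W c Cpr (Suc l) ^^ 2) r x)
     in smoother c (Suc (Suc l)) (\<lambda>x. u x - prolong c (Suc (Suc l)) e x / Cpr\<^sup>2))"

definition q_lev :: "('d::finite) cutfem \<Rightarrow> real \<Rightarrow> nat \<Rightarrow> real" where
  "q_lev c Cpr l = opnorm_A c l (E_TG c Cpr l)"

definition q_sup :: "('d::finite) cutfem \<Rightarrow> nat \<Rightarrow> real \<Rightarrow> real" where
  "q_sup c L Cpr = (SUP l\<in>{2..L}. q_lev c Cpr l)"

definition rho :: "('d::finite) cutfem \<Rightarrow> real \<Rightarrow> nat \<Rightarrow> real" where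
  "rho c Cpr l = opnorm_A c l (E_W c Cpr l)"

definition rho_star :: "real \<Rightarrow> real" where
  "rho_star q = (1 - sqrt (1 - 4 * q)) / 2"

end

theory Submission
  imports Defs
begin

text \<open>
  Write \<open>T\<close> for the damped coarse correction and \<open>R\<close> for its restriction. The damping makes \<open>T\<close>
  a positive semidefinite operator of norm at most one in the energy inner product, so the
  coarse step removes at least \<open>(norm (R u) / Cpr)\<^sup>2\<close> from the squared energy norm of \<open>u\<close>, and each
  local projection removes exactly the squared norm of its correction. Testing \<open>u\<close> against its
  stable decomposition, and using that a patch interacts with at most \<open>5 ^ d\<close> patches, bounds the
  squared norm of \<open>u\<close> by a multiple of the energy removed in total; this is the two-level
  contraction. Replacing the exact coarse solve by two cycles adds at most the square of the
  coarse contraction number, and \<open>rho_star\<close> is the smaller fixed point of \<open>t \<mapsto> q + t\<^sup>2\<close>.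

  For this the forms have to be inner products on the finite element spaces. Bilinearity needs
  all integrands to be integrable, hence a boundary of finite Hausdorff measure with a
  continuous normal. By the stability assumption the only possible kernel consists of
  constants, which are excluded because the boundary has positive Hausdorff measure.
\<close>

section \<open>Hausdorff measure\<close>

text \<open>The coarse form is rediscretized: penalty and ghost terms carry the mesh size, so
  \<open>form_A\<close> on level \<open>l - 1\<close> is not the restriction of
  \<open>form_A\<close> on level \<open>l\<close>, and prolongation after restriction is no
  projection. Only \<open>Cpr\<close> compares the two energies. The mismatch between a coarse
  component and its damped correction is itself nonexpansive on the coarse space, so it brings no
  further factor. The constant in \<open>eta\<close> has to come out exactly. The estimate yields
  \<open>(1 + Cpr * e)^2 + (N * e)^2\<close> with \<open>e^2 = Csd\<close> and
  \<open>N = 5 ^ d\<close>, whose constant part is no multiple of \<open>Csd\<close>. Testing the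
  decomposition on a single nonzero function gives \<open>Csd \<ge> 1 / (2 * N)\<close>, and with
  \<open>N \<ge> 4\<close> this absorbs the constant. Restriction, local projections, nodal
  functions and cell polynomials are definite descriptions, the surface measure is a
  \<open>measure_of\<close>, operator norms are real suprema. They say nothing before existence and
  uniqueness, countable additivity or boundedness is proved, and much of the groundwork serves
  this.\<close>

definition hausdorff_gauge :: "nat \<Rightarrow> 'a::metric_space set \<Rightarrow> ennreal" where
  "hausdorff_gauge m C = ennreal (unit_ball_vol (real m) * (diameter C / 2) ^ m)"

definition covers :: "real \<Rightarrow> 'a::metric_space set \<Rightarrow> (nat \<Rightarrow> 'a set) set" where
  "covers \<delta> A = {C. A \<subseteq> (\<Union>i. C i) \<and> (\<forall>i. bounded (C i) \<and> diameter (C i) \<le> \<delta>)}"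

lemma hausdorff_content_alt: "hausdorff_content m \<delta> A = (INF C\<in>covers \<delta> A. \<Sum>i. hausdorff_gauge m (C i))"
  by (simp add: hausdorff_content_def covers_def hausdorff_gauge_def)

lemma hausdorff_content_le: "C \<in> covers \<delta> A \<Longrightarrow> hausdorff_content m \<delta> A \<le> (\<Sum>i. hausdorff_gauge m (C i))"
  unfolding hausdorff_content_alt by (rule INF_lower)

text \<open>For \<open>m = 0\<close> the factor \<open>0 ^ 0 = 1\<close> would charge empty sets,
  and covers could not be padded by empty members; hence \<open>m \<ge> 1\<close> from here
  on.\<close>

lemma hausdorff_gauge_empty: "m \<ge> 1 \<Longrightarrow> hausdorff_gauge m {} = 0"
  by (simp add: hausdorff_gauge_def diameter_def)

lemma hausdorff_content_mono: "A \<subseteq> B \<Longrightarrow> hausdorff_content m \<delta> A \<le> hausdorff_content m \<delta> B"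
  unfolding hausdorff_content_alt by (rule INF_superset_mono) (auto simp: covers_def)

lemma hausdorff_content_antimono:
  assumes "d \<le> e"
  shows "hausdorff_content m e A \<le> hausdorff_content m d A"
proof -
  have "covers d A \<subseteq> covers e A"
  proof
    fix C assume "C \<in> covers d A"
    then have "A \<subseteq> (\<Union>i. C i)" "bounded (C i)" "diameter (C i) \<le> d" for i by (auto simp: covers_def)
    moreover from this(3) have "diameter (C i) \<le> e" for i by (rule order_trans) (rule assms)
    ultimately show "C \<in> covers e A" by (simp add: covers_def)
  qed
  then show ?thesis unfolding hausdorff_content_alt by (rule INF_superset_mono) simp
qed

lemma hausdorff_content_UN:
  assumes "m \<ge> 1"
  shows "hausdorff_content m \<delta> (\<Union>i. A i) \<le> (\<Sum>i. hausdorff_content m \<delta> (A i :: 'a::metric_space set))"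
proof (rule ennreal_le_epsilon)
  fix e :: real assume e: "0 < e" and fin: "(\<Sum>i. hausdorff_content m \<delta> (A i)) < top"
  \<comment> \<open>Near-optimal covers of the pieces; the allowances
    \<open>e * (1/2) ^ Suc i\<close> add up to \<open>e\<close>.\<close>
  have "\<exists>C\<in>covers \<delta> (A i). (\<Sum>j. hausdorff_gauge m (C j)) \<le> hausdorff_content m \<delta> (A i) + ennreal (e * (1/2) ^ Suc i)" for i
  proof -
    have "hausdorff_content m \<delta> (A i) < top"
      using fin ennreal_suminf_lessD by blast
    then have "hausdorff_content m \<delta> (A i) < hausdorff_content m \<delta> (A i) + ennreal (e * (1/2) ^ Suc i)"
      using e by (cases "hausdorff_content m \<delta> (A i)") (auto simp: ennreal_less_iff simp flip: ennreal_plus)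
    then show ?thesis unfolding hausdorff_content_alt[of m \<delta> "A i"] INF_less_iff using less_imp_le by blast
  qed
  then obtain C where C: "\<And>i. C i \<in> covers \<delta> (A i)"
    and Cs: "\<And>i. (\<Sum>j. hausdorff_gauge m (C i j)) \<le> hausdorff_content m \<delta> (A i) + ennreal (e * (1/2) ^ Suc i)"
    by metis
  define D where "D = case_prod C \<circ> prod_decode"
  have "D \<in> covers \<delta> (\<Union>i. A i)"
  proof -
    have "x \<in> (\<Union>n. D n)" if xi: "x \<in> A i" for x i
    proof -
      have "A i \<subseteq> (\<Union>j. C i j)" using C[of i] by (simp add: covers_def)
      then obtain j where "x \<in> C i j" using xi by blast
      then show ?thesis by (auto simp: D_def intro!: exI[of _ "prod_encode (i, j)"])
    qed
    then show ?thesis using C by (auto simp: covers_def D_def split: prod.split)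
  qed
  then have "hausdorff_content m \<delta> (\<Union>i. A i) \<le> (\<Sum>n. hausdorff_gauge m (D n))" by (rule hausdorff_content_le)
  also have "\<dots> = (\<Sum>i. \<Sum>j. hausdorff_gauge m (C i j))"
    unfolding D_def using suminf_ennreal_2dimen[where f = "\<lambda>(i, j). hausdorff_gauge m (C i j)" and g = "\<lambda>i. \<Sum>j. hausdorff_gauge m (C i j)"]
    by (simp add: comp_def case_prod_beta')
  also have "\<dots> \<le> (\<Sum>i. hausdorff_content m \<delta> (A i) + ennreal (e * (1/2) ^ Suc i))"
    by (intro suminf_le Cs) auto
  also have "\<dots> = (\<Sum>i. hausdorff_content m \<delta> (A i)) + (\<Sum>i. ennreal (e * (1/2) ^ Suc i))"
    by (rule suminf_add[symmetric]) auto
  also have "(\<Sum>i. ennreal (e * (1/2) ^ Suc i)) = ennreal e"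
    using e sums_mult[OF power_half_series, of e]
    by (subst suminf_ennreal_eq[of _ e]) auto
  finally show "hausdorff_content m \<delta> (\<Union>i. A i) \<le> (\<Sum>i. hausdorff_content m \<delta> (A i)) + ennreal e" .
qed

definition hausdorff_outer :: "nat \<Rightarrow> 'a::metric_space set \<Rightarrow> ennreal" where
  "hausdorff_outer m A = (SUP \<delta>\<in>{0<..}. hausdorff_content m \<delta> A)"

lemma hausdorff_content_le_outer: "0 < \<delta> \<Longrightarrow> hausdorff_content m \<delta> A \<le> hausdorff_outer m A"
  unfolding hausdorff_outer_def by (rule SUP_upper) auto

lemma hausdorff_outer_mono: "A \<subseteq> B \<Longrightarrow> hausdorff_outer m A \<le> hausdorff_outer m B"
  unfolding hausdorff_outer_def by (intro SUP_mono' hausdorff_content_mono)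

lemma hausdorff_outer_empty:
  assumes "m \<ge> 1"
  shows "hausdorff_outer m {} = 0"
proof -
  have "hausdorff_content m \<delta> {} = 0" if "\<delta> > 0" for \<delta> :: real
    using hausdorff_content_le[of "\<lambda>_. {}" \<delta> "{}" m] that assms
    by (simp add: covers_def hausdorff_gauge_empty diameter_def)
  then have "hausdorff_outer m {} = (SUP \<delta>\<in>{0::real<..}. 0 :: ennreal)"
    unfolding hausdorff_outer_def by (intro SUP_cong) auto
  then show ?thesis by simp
qed

lemma hausdorff_outer_UN:
  assumes "m \<ge> 1"
  shows "hausdorff_outer m (\<Union>i. A i) \<le> (\<Sum>i. hausdorff_outer m (A i :: 'a::metric_space set))"
  unfolding hausdorff_outer_def[of m "\<Union>i. A i"]
proof (rule SUP_least)
  fix \<delta> :: real assume "\<delta> \<in> {0<..}"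
  then have d: "\<delta> > 0" by simp
  have "hausdorff_content m \<delta> (\<Union>i. A i) \<le> (\<Sum>i. hausdorff_content m \<delta> (A i))"
    by (rule hausdorff_content_UN[OF assms])
  also have "\<dots> \<le> (\<Sum>i. hausdorff_outer m (A i))"
    by (intro suminf_le hausdorff_content_le_outer d) auto
  finally show "hausdorff_content m \<delta> (\<Union>i. A i) \<le> (\<Sum>i. hausdorff_outer m (A i))" .
qed

lemma outer_measure_space_hausdorff:
  assumes "m \<ge> 1"
  shows "outer_measure_space (Pow UNIV) (hausdorff_outer m :: 'a::metric_space set \<Rightarrow> ennreal)"
  unfolding outer_measure_space_def positive_def increasing_def countably_subadditive_def
  by (intro conjI ballI allI impI hausdorff_outer_empty hausdorff_outer_mono hausdorff_outer_UN assms)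

lemma hausdorff_outer_Un:
  assumes "m \<ge> 1"
  shows "hausdorff_outer m (A \<union> B) \<le> hausdorff_outer m A + hausdorff_outer m (B :: 'a::metric_space set)"
proof -
  have "(\<Union>i. (\<lambda>i. if i = 0 then A else if i = Suc 0 then B else {}) i) = A \<union> B" by auto
  then have "hausdorff_outer m (A \<union> B) \<le> (\<Sum>i. hausdorff_outer m (if i = 0 then A else if i = Suc 0 then B else {}))"
    using hausdorff_outer_UN[OF assms, of "\<lambda>i. if i = 0 then A else if i = Suc 0 then B else {}"] by simp
  also have "\<dots> = hausdorff_outer m A + hausdorff_outer m B"
    by (subst suminf_finite[of "{0, Suc 0}"]) (auto simp: hausdorff_outer_empty[OF assms])
  finally show ?thesis .
qed

text \<open>No set of diameter at most \<open>\<delta>\<close> meets both \<open>A\<close> and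
  \<open>B\<close>, so every cover of the union splits into a cover of each.\<close>

lemma hausdorff_content_separated:
  assumes m: "m \<ge> 1" and sep: "\<And>x y. x \<in> A \<Longrightarrow> y \<in> B \<Longrightarrow> \<delta> < dist x y"
  shows "hausdorff_content m \<delta> A + hausdorff_content m \<delta> B \<le> hausdorff_content m \<delta> (A \<union> (B :: 'a::metric_space set))"
  unfolding hausdorff_content_alt[of m \<delta> "A \<union> B"]
proof (rule INF_greatest)
  fix C assume C: "C \<in> covers \<delta> (A \<union> B)"
  \<comment> \<open>Members that are dropped become empty sets, whose diameter 0 must not exceed
    \<open>\<delta>\<close>.\<close>
  have "\<delta> \<ge> 0" using C diameter_ge_0 unfolding covers_def by (smt (verit) mem_Collect_eq)
  define Ca where "Ca = (\<lambda>i. if C i \<inter> A = {} then {} else C i)"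
  define Cb where "Cb = (\<lambda>i. if C i \<inter> A = {} then C i else {})"
  have dis: "C i \<inter> B = {}" if ne: "C i \<inter> A \<noteq> {}" for i
  proof (rule ccontr)
    assume "C i \<inter> B \<noteq> {}"
    then obtain x y where xy: "x \<in> C i" "x \<in> A" "y \<in> C i" "y \<in> B" using ne by blast
    then have "dist x y \<le> diameter (C i)" using C by (intro diameter_bounded_bound) (auto simp: covers_def)
    moreover have "diameter (C i) \<le> \<delta>" using C by (auto simp: covers_def)
    ultimately show False using sep[of x y] xy by force
  qed
  have C': "A \<union> B \<subseteq> (\<Union>i. C i)" "\<And>i. bounded (C i)" "\<And>i. diameter (C i) \<le> \<delta>"
    using C by (auto simp: covers_def)
  have "A \<subseteq> (\<Union>i. Ca i)"
  proof
    fix x assume x: "x \<in> A"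
    then obtain i where "x \<in> C i" using C'(1) by blast
    then have "x \<in> Ca i" using x by (auto simp: Ca_def)
    then show "x \<in> (\<Union>i. Ca i)" by blast
  qed
  moreover have "B \<subseteq> (\<Union>i. Cb i)"
  proof
    fix x assume x: "x \<in> B"
    then obtain i where i: "x \<in> C i" using C'(1) by blast
    then have "x \<in> Cb i" using x dis[of i] by (auto simp: Cb_def)
    then show "x \<in> (\<Union>i. Cb i)" by blast
  qed
  ultimately have "Ca \<in> covers \<delta> A" "Cb \<in> covers \<delta> B"
    using C'(2,3) \<open>\<delta> \<ge> 0\<close> by (simp_all add: covers_def Ca_def Cb_def diameter_empty)
  then have "hausdorff_content m \<delta> A + hausdorff_content m \<delta> B \<le> (\<Sum>i. hausdorff_gauge m (Ca i)) + (\<Sum>i. hausdorff_gauge m (Cb i))"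
    by (intro add_mono hausdorff_content_le)
  also have "\<dots> = (\<Sum>i. hausdorff_gauge m (Ca i) + hausdorff_gauge m (Cb i))" by (rule suminf_add) auto
  also have "\<dots> = (\<Sum>i. hausdorff_gauge m (C i))"
    by (intro suminf_cong) (auto simp: Ca_def Cb_def hausdorff_gauge_empty[OF m])
  finally show "hausdorff_content m \<delta> A + hausdorff_content m \<delta> B \<le> (\<Sum>i. hausdorff_gauge m (C i))" .
qed

lemma hausdorff_outer_separated:
  assumes m: "m \<ge> 1" and e: "e > 0" and sep: "\<And>x y. x \<in> A \<Longrightarrow> y \<in> B \<Longrightarrow> e \<le> dist x y"
  shows "hausdorff_outer m A + hausdorff_outer m B \<le> hausdorff_outer m (A \<union> (B :: 'a::metric_space set))"
proof -
  have *: "hausdorff_content m a A + hausdorff_content m b B \<le> hausdorff_outer m (A \<union> B)"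
    if "a > 0" "b > 0" for a b
  proof -
    \<comment> \<open>At a scale below \<open>e\<close> the contents add up; at a scale below
      \<open>a\<close> and \<open>b\<close> they dominate the given ones.\<close>
    define d where "d = min (min a b) (e / 2)"
    have d: "d > 0" "d < e" "d \<le> a" "d \<le> b" using that e by (auto simp: d_def)
    have "hausdorff_content m a A + hausdorff_content m b B \<le> hausdorff_content m d A + hausdorff_content m d B"
      using d by (intro add_mono hausdorff_content_antimono)
    also have "\<dots> \<le> hausdorff_content m d (A \<union> B)"
      using d sep by (intro hausdorff_content_separated m) force
    also have "\<dots> \<le> hausdorff_outer m (A \<union> B)" using d by (intro hausdorff_content_le_outer)
    finally show ?thesis .
  qed
  have "hausdorff_outer m A + hausdorff_outer m B
      = (SUP a\<in>{0<..}. SUP b\<in>{0<..}. hausdorff_content m a A + hausdorff_content m b B)"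
    unfolding hausdorff_outer_def
    by (subst ennreal_SUP_add_left[symmetric], simp, subst ennreal_SUP_add_right) auto
  also have "\<dots> \<le> hausdorff_outer m (A \<union> B)"
    using * by (intro SUP_least) auto
  finally show ?thesis .
qed

text \<open>Between two shells of equal parity lies a whole shell of the other parity, hence a gap.
  Adding the shells one at a time towards \<open>F\<close> then needs only additivity for separated
  sets; the offset \<open>s\<close> selects the parity.\<close>

lemma hausdorff_outer_shells:
  fixes A F :: "'a::metric_space set" and s :: nat
  assumes m: "m \<ge> 1"
  defines "D \<equiv> \<lambda>k. {x \<in> A. 1 / real (k + 2) < infdist x F \<and> infdist x F \<le> 1 / real (k + 1)}"
  shows "(\<Sum>k<N. hausdorff_outer m (D (2 * k + s))) \<le> hausdorff_outer m A"
proof -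
  have "(\<Sum>k<N. hausdorff_outer m (D (2 * k + s))) \<le> hausdorff_outer m (\<Union>k<N. D (2 * k + s))"
  proof (induction N)
    case (Suc N)
    \<comment> \<open>Inner distance of shell \<open>2 * (N - 1) + s\<close> minus outer distance of
      shell \<open>2 * N + s\<close>. For \<open>N = 0\<close> there is no earlier shell, and
      \<open>1 / 0 = 0\<close> can make the value negative.\<close>
    let ?e = "1 / real (2 * N + s) - 1 / real (2 * N + s + 1)"
    have "(\<Sum>k<Suc N. hausdorff_outer m (D (2 * k + s)))
        \<le> hausdorff_outer m (\<Union>k<N. D (2 * k + s)) + hausdorff_outer m (D (2 * N + s))"
      using Suc by (simp add: add_mono)
    also have "\<dots> \<le> hausdorff_outer m ((\<Union>k<N. D (2 * k + s)) \<union> D (2 * N + s))"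
    proof (cases "N = 0")
      case True
      then show ?thesis by (simp add: hausdorff_outer_empty[OF m])
    next
      case False
      show ?thesis
      proof (rule hausdorff_outer_separated[OF m, of ?e])
        show "?e > 0" using False by (auto intro!: divide_strict_left_mono)
        fix x y assume "x \<in> (\<Union>k<N. D (2 * k + s))" "y \<in> D (2 * N + s)"
        then obtain k where k: "k < N" "1 / real (2 * k + s + 2) < infdist x F"
          and y: "infdist y F \<le> 1 / real (2 * N + s + 1)" by (auto simp: D_def)
        have "1 / real (2 * N + s) \<le> 1 / real (2 * k + s + 2)" using k(1) by (intro divide_left_mono) auto
        then have "?e \<le> infdist x F - infdist y F" using k y by linarith
        also have "\<dots> \<le> dist x y" using infdist_triangle[of x F y] by linarith
        finally show "?e \<le> dist x y" .
      qed
    qed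
    also have "(\<Union>k<N. D (2 * k + s)) \<union> D (2 * N + s) = (\<Union>k<Suc N. D (2 * k + s))"
      by (auto simp: lessThan_Suc)
    finally show ?case .
  qed simp
  also have "\<dots> \<le> hausdorff_outer m A" by (intro hausdorff_outer_mono) (auto simp: D_def)
  finally show ?thesis .
qed

text \<open>Caratheodory's criterion: shells of equal parity around \<open>F\<close> are separated from each other,
  so the measures of the shells are summable.\<close>

lemma hausdorff_closed_lambda_system:
  fixes F :: "'a::metric_space set"
  assumes m: "m \<ge> 1" and F: "closed F"
  shows "F \<in> lambda_system UNIV (Pow UNIV) (hausdorff_outer m)"
proof -
  let ?H = "hausdorff_outer m :: 'a set \<Rightarrow> ennreal"
  have "?H (F \<inter> X) + ?H (X - F) \<le> ?H X" for X
  \<comment> \<open>The distance to the empty set is 0 by convention, so the shells make sense only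
    for nonempty \<open>F\<close>.\<close>
  proof (cases "?H X = top \<or> F = {}")
    case True
    then show ?thesis by (auto simp: hausdorff_outer_empty[OF m])
  next
    case False
    then have fin: "?H X < top" and Fne: "F \<noteq> {}" by (auto simp: less_top)
    define D where "D = (\<lambda>k. {x \<in> X. 1 / real (k + 2) < infdist x F \<and> infdist x F \<le> 1 / real (k + 1)})"
    define B where "B = (\<lambda>n. {x \<in> X. 1 / real (n + 1) < infdist x F})"
    have cover: "X - F \<subseteq> B n \<union> (\<Union>k. D (k + n))" for n
    proof
      fix x assume x: "x \<in> X - F"
      then have p: "infdist x F > 0"
        using in_closed_iff_infdist_zero[OF F Fne, of x] infdist_nonneg[of x F] by force
      show "x \<in> B n \<union> (\<Union>k. D (k + n))"
      proof (cases "1 / real (n + 1) < infdist x F")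
        case True then show ?thesis using x by (auto simp: B_def)
      next
        case False
        obtain N where N: "1 / real (Suc N) < infdist x F" using p nat_approx_posE by blast
        \<comment> \<open>Minimality of \<open>k\<close> bounds the distance from above by
          \<open>1 / real k\<close>, so the point lies in the shell numbered
          \<open>k - 1\<close>.\<close>
        define k where "k = (LEAST k. 1 / real (k + 1) < infdist x F)"
        have k: "1 / real (k + 1) < infdist x F" unfolding k_def
          using LeastI[of "\<lambda>k. 1 / real (k + 1) < infdist x F" N] N by simp
        have kl: "\<not> 1 / real (j + 1) < infdist x F" if "j < k" for j
          using that not_less_Least[of j "\<lambda>k. 1 / real (k + 1) < infdist x F"] by (simp only: k_def not_False_eq_True)
        have "n < k"
        proof (rule ccontr)
          assume "\<not> n < k"
          then have "1 / real (n + 1) \<le> 1 / real (k + 1)" by (intro divide_left_mono) auto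
          then show False using k False by linarith
        qed
        then obtain j where j: "k = Suc (j + n)" by (metis add.commute less_iff_Suc_add)
        then have "x \<in> D (j + n)" using k kl[of "j + n"] x by (auto simp: D_def)
        then show ?thesis by blast
      qed
    qed
    have "(\<Sum>k<2 * N. f k) = (\<Sum>k<N. f (2 * k + 0)) + (\<Sum>k<N. f (2 * k + 1))" for f :: "nat \<Rightarrow> ennreal" and N
      by (induction N) (auto simp: algebra_simps)
    note even_odd = this
    have "(\<Sum>k<2 * N. ?H (D k)) \<le> 2 * ?H X" for N
    proof -
      have "(\<Sum>k<N. ?H (D (2 * k + s))) \<le> ?H X" for s
        unfolding D_def by (rule hausdorff_outer_shells[OF m])
      then have "(\<Sum>k<N. ?H (D (2 * k + 0))) + (\<Sum>k<N. ?H (D (2 * k + 1))) \<le> ?H X + ?H X"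
        by (intro add_mono)
      then show ?thesis unfolding even_odd[of "\<lambda>k. ?H (D k)" N] mult_2[of "?H X"] .
    qed
    then have "(\<Sum>k<N. ?H (D k)) \<le> 2 * ?H X" for N
      using sum_mono2[of "{..<2 * N}" "{..<N}" "\<lambda>k. ?H (D k)"] order_trans by fastforce
    then have "(\<Sum>k. ?H (D k)) \<le> 2 * ?H X" by (intro suminf_le_const) auto
    also have "\<dots> < top" using fin by (simp add: ennreal_mult_less_top)
    finally have sfin: "(\<Sum>k. ?H (D k)) \<noteq> top" by simp
    then have Dfin: "?H (D k) \<noteq> top" for k using ennreal_suminf_lessD less_top by blast
    define h where "h = (\<lambda>k. enn2real (?H (D k)))"
    have h: "?H (D k) = ennreal (h k)" "h k \<ge> 0" for k using Dfin by (auto simp: h_def less_top)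
    have sm: "summable h" using sfin h by (intro summable_suminf_not_top) auto
    show ?thesis
    proof (rule ennreal_le_epsilon)
      fix e :: real assume e: "0 < e"
      \<comment> \<open>The shells from \<open>n\<close> on carry less than \<open>e\<close>; what
        else there is of \<open>X - F\<close> is \<open>B n\<close>, which keeps distance
        \<open>1 / (n + 1)\<close> from \<open>F\<close>.\<close>
      obtain n where n: "norm (\<Sum>i. h (i + n)) < e" using suminf_exist_split[OF e sm] by blast
      have "?H (X - F) \<le> ?H (B n \<union> (\<Union>k. D (k + n)))" by (intro hausdorff_outer_mono cover)
      also have "\<dots> \<le> ?H (B n) + ?H (\<Union>k. D (k + n))" by (rule hausdorff_outer_Un[OF m])
      also have "\<dots> \<le> ?H (B n) + (\<Sum>k. ?H (D (k + n)))" by (intro add_left_mono hausdorff_outer_UN m)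
      also have "(\<Sum>k. ?H (D (k + n))) = ennreal (\<Sum>k. h (k + n))"
        unfolding h(1) using h(2) sm by (intro suminf_ennreal2) (auto simp: summable_iff_shift)
      also have "\<dots> \<le> ennreal e" using n by (intro ennreal_leI) auto
      finally have 1: "?H (X - F) \<le> ?H (B n) + ennreal e" by (simp add: add_left_mono)
      have "?H (F \<inter> X) + ?H (B n) \<le> ?H (F \<inter> X \<union> B n)"
      proof (rule hausdorff_outer_separated[OF m, of "1 / real (n + 1)"])
        fix x y assume "x \<in> F \<inter> X" "y \<in> B n"
        then show "1 / real (n + 1) \<le> dist x y" using infdist_le[of x F y] by (force simp: B_def dist_commute)
      qed auto
      also have "\<dots> \<le> ?H X" by (intro hausdorff_outer_mono) (auto simp: B_def)
      finally have "?H (F \<inter> X) + ?H (B n) \<le> ?H X" .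
      then have 2: "?H (F \<inter> X) + ?H (B n) + ennreal e \<le> ?H X + ennreal e" by (rule add_right_mono)
      have "?H (F \<inter> X) + ?H (X - F) \<le> ?H (F \<inter> X) + (?H (B n) + ennreal e)" by (rule add_left_mono[OF 1])
      also note add.assoc[symmetric]
      also note 2
      finally show "?H (F \<inter> X) + ?H (X - F) \<le> ?H X + ennreal e" .
    qed
  qed
  moreover have "?H X \<le> ?H (F \<inter> X) + ?H (X - F)" for X
  proof -
    have "F \<inter> X \<union> (X - F) = X" by blast
    then show ?thesis using hausdorff_outer_Un[OF m, of "F \<inter> X" "X - F"] by (simp only:)
  qed
  moreover have "(UNIV - F) \<inter> X = X - F" for X by auto
  ultimately show ?thesis by (auto simp: lambda_system_def intro: antisym)
qed

text \<open>The Caratheodory measurable sets form a sigma algebra; it contains the closed sets,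
  which generate the Borel sets.\<close>

lemma measure_space_hausdorff:
  assumes m: "m \<ge> 1"
  shows "measure_space UNIV (sets borel) (hausdorff_outer m :: 'a::metric_space set \<Rightarrow> ennreal)"
proof -
  let ?L = "lambda_system UNIV (Pow UNIV) (hausdorff_outer m :: 'a set \<Rightarrow> ennreal)"
  interpret P: sigma_algebra UNIV "Pow UNIV :: 'a set set" by (rule sigma_algebra_Pow)
  have L: "measure_space UNIV ?L (hausdorff_outer m)"
    by (rule P.caratheodory_lemma[OF outer_measure_space_hausdorff[OF m]])
  have "sets borel = sigma_sets UNIV (Collect closed :: 'a set set)"
    by (simp add: borel_eq_closed)
  also have "\<dots> \<subseteq> ?L"
    using L hausdorff_closed_lambda_system[OF m]
    by (intro sigma_algebra.sigma_sets_subset) (auto simp: measure_space_def)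
  finally show ?thesis
    using sets.sigma_algebra_axioms[of "borel :: 'a measure"] by (intro measure_down[OF L]) auto
qed

lemma sets_hausdorff [measurable_cong, simp]: "sets (hausdorff m) = sets borel"
  unfolding hausdorff_def using sets.sigma_sets_eq[of borel] by (simp add: sets_measure_of_conv)

lemma space_hausdorff [simp]: "space (hausdorff m) = UNIV"
  unfolding hausdorff_def by (simp add: space_measure_of_conv)

lemma emeasure_hausdorff:
  fixes A :: "'a::metric_space set"
  assumes "m \<ge> 1" "A \<in> sets borel"
  shows "emeasure (hausdorff m) A = hausdorff_outer m A"
proof -
  have "measure_space UNIV (sigma_sets UNIV (sets borel)) (hausdorff_outer m :: 'a set \<Rightarrow> ennreal)"
    using measure_space_hausdorff[OF assms(1)] sets.sigma_sets_eq[of "borel :: 'a measure"] by simp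
  then show ?thesis
    using assms emeasure_measure_of_sigma[of UNIV "sets borel" "hausdorff_outer m" A]
    unfolding hausdorff_def hausdorff_outer_def[abs_def] measure_space_def     using sets.sigma_sets_eq[of "borel :: 'a measure"] by simp
qed

section \<open>Surface measure of Lipschitz graphs and of frontiers\<close>

lemma hausdorff_content_finite_cover:
  assumes T: "finite T" and S: "S \<subseteq> (\<Union>f\<in>T. C f)" and m: "m \<ge> 1" and d: "\<delta> \<ge> 0"
    and C: "\<And>f. f \<in> T \<Longrightarrow> bounded (C f)" "\<And>f. f \<in> T \<Longrightarrow> diameter (C f) \<le> \<delta>"
  shows "hausdorff_content m \<delta> S \<le> (\<Sum>f\<in>T. hausdorff_gauge m (C f))"
proof -
  obtain h where h: "bij_betw h {0..<card T} T" using ex_bij_betw_nat_finite[OF T] by blast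
  define D where "D = (\<lambda>n. if n < card T then C (h n) else {})"
  have hT: "h n \<in> T" if "n < card T" for n using h that by (auto simp: bij_betw_def)
  have "S \<subseteq> (\<Union>n. D n)"
  proof
    fix x assume "x \<in> S"
    then obtain f where f: "f \<in> T" "x \<in> C f" using S by blast
    then have "f \<in> h ` {0..<card T}" using h by (simp add: bij_betw_def)
    then obtain n where "n < card T" "f = h n" by auto
    then have "x \<in> D n" using f by (simp add: D_def)
    then show "x \<in> (\<Union>n. D n)" by blast
  qed
  then have "D \<in> covers \<delta> S"
    using C hT d by (auto simp: covers_def D_def diameter_empty)
  then have "hausdorff_content m \<delta> S \<le> (\<Sum>n. hausdorff_gauge m (D n))" by (rule hausdorff_content_le)
  also have "\<dots> = (\<Sum>n\<in>{0..<card T}. hausdorff_gauge m (D n))"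
    by (intro suminf_finite) (auto simp: D_def hausdorff_gauge_empty[OF m])
  also have "\<dots> = (\<Sum>n\<in>{0..<card T}. hausdorff_gauge m (C (h n)))"
    by (intro sum.cong) (auto simp: D_def)
  also have "\<dots> = (\<Sum>f\<in>T. hausdorff_gauge m (C f))" by (rule sum.reindex_bij_betw[OF h])
  finally show ?thesis .
qed

lemma hausdorff_gauge_mono_diameter: "diameter C \<le> e \<Longrightarrow> bounded C \<Longrightarrow> hausdorff_gauge m C \<le> ennreal (unit_ball_vol (real m) * (e / 2) ^ m)"
  unfolding hausdorff_gauge_def by (intro ennreal_leI mult_left_mono power_mono) (auto simp: diameter_ge_0 unit_ball_vol_nonneg)

text \<open>Cutting all coordinates but the \<open>i\<close>-th into steps \<open>1 / N\<close>
  gives at most \<open>(2 * N * M + 1) ^ m\<close> pieces of diameter at most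
  \<open>K * m / N\<close>. The powers of \<open>N\<close> cancel, so the sum of the gauges stays
  bounded as the scale tends to 0.\<close>

lemma hausdorff_outer_Lipschitz_graph:
  fixes S :: "(real^'d::finite) set" and i :: 'd and M :: nat
  assumes d: "CARD('d) \<ge> 2" and K: "K \<ge> 0"
    and bnd: "\<And>x j. x \<in> S \<Longrightarrow> \<bar>x $ j\<bar> \<le> real M"
    and lip: "\<And>x y. x \<in> S \<Longrightarrow> y \<in> S \<Longrightarrow> dist x y \<le> K * (\<Sum>j\<in>UNIV - {i}. \<bar>x $ j - y $ j\<bar>)"
  shows "hausdorff_outer (CARD('d) - 1) S < top"
proof -
  define m where "m = CARD('d) - 1"
  have m: "m \<ge> 1" "card (UNIV - {i}) = m" using d by (auto simp: m_def)
  \<comment> \<open>What is left after the powers of \<open>N\<close> cancel, with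
    \<open>2 * N * M + 1\<close> enlarged to \<open>(2 * M + 1) * N\<close>.\<close>
  define c where "c = unit_ball_vol (real m) * ((2 * real M + 1) * (K * real m) / 2) ^ m"
  have bS: "bounded S"
  proof (rule boundedI)
    fix x assume "x \<in> S"
    then show "norm x \<le> (\<Sum>j\<in>(UNIV :: 'd set). real M)"
      using norm_le_l1_cart[of x] sum_mono[of UNIV "\<lambda>j. \<bar>x $ j\<bar>" "\<lambda>j. real M"] bnd by fastforce
  qed
  have "hausdorff_content m \<delta> S \<le> ennreal c" if \<delta>: "\<delta> > 0" for \<delta>
  proof -
    obtain N0 :: nat where N0: "K * real m / \<delta> < real N0" using reals_Archimedean2 by blast
    define N where "N = Suc N0"
    have N: "N \<ge> 1" "K * real m / real N \<le> \<delta>"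
      using N0 \<delta> by (auto simp: N_def field_simps)
    define e where "e = K * real m / real N"
    have e: "e \<ge> 0" "e \<le> \<delta>" using N K by (auto simp: e_def)
    \<comment> \<open>Coordinate \<open>i\<close> is not subdivided: the Lipschitz condition
      controls it through the others.\<close>
    define idx where "idx = (\<lambda>x :: real^'d. \<lambda>j. if j = i then 0 else \<lfloor>real N * x $ j\<rfloor>)"
    define T where "T = PiE UNIV (\<lambda>j :: 'd. if j = i then {0} else {- int (N * M)..int (N * M)})"
    define C where "C = (\<lambda>f. {x \<in> S. idx x = f})"
    have finT: "finite T" unfolding T_def by (intro finite_PiE) auto
    have "card T = (\<Prod>j\<in>UNIV. card (if j = i then {0} else {- int (N * M)..int (N * M)}))"
      unfolding T_def by (intro card_PiE) auto
    also have "\<dots> = (\<Prod>j\<in>UNIV - {i}. 2 * N * M + 1)"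
    proof -
      have "card {- int k..int k} = 2 * k + 1" for k by simp
      from this[of "N * M"] have "card {- int (N * M)..int (N * M)} = 2 * N * M + 1" by (simp only: mult.assoc)
      then show ?thesis by (subst prod.remove[of UNIV i]) (auto simp del: card_atLeastAtMost_int intro!: prod.cong)
    qed
    finally have cT: "card T = (2 * N * M + 1) ^ m" using m by simp
    have idxT: "idx x \<in> T" if "x \<in> S" for x
    proof -
      have "real N * x $ j \<le> real (N * M)" "- real (N * M) \<le> real N * x $ j" for j
        using bnd[OF that, of j] mult_left_mono[of "x $ j" "real M" "real N"]
          mult_left_mono[of "- real M" "x $ j" "real N"] by auto
      then have "\<lfloor>real N * x $ j\<rfloor> \<le> int (N * M)" "- int (N * M) \<le> \<lfloor>real N * x $ j\<rfloor>" for j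
        by (simp_all add: floor_le_iff le_floor_iff) (smt (verit) of_nat_mult)+
      then show ?thesis by (auto simp: T_def idx_def)
    qed
    have diam: "diameter (C f) \<le> e" for f
    proof (rule diameter_le)
      fix x y assume xy: "x \<in> C f" "y \<in> C f"
      have "\<bar>x $ j - y $ j\<bar> \<le> 1 / real N" if "j \<noteq> i" for j
      proof -
        have "\<lfloor>real N * x $ j\<rfloor> = \<lfloor>real N * y $ j\<rfloor>"
          using xy that by (auto simp: C_def idx_def fun_eq_iff) metis
        then have "\<bar>real N * x $ j - real N * y $ j\<bar> < 1" by linarith
        then have "real N * \<bar>x $ j - y $ j\<bar> < 1" by (simp add: abs_mult flip: right_diff_distrib)
        then show ?thesis using N by (simp add: field_simps)
      qed
      then have "(\<Sum>j\<in>UNIV - {i}. \<bar>x $ j - y $ j\<bar>) \<le> (\<Sum>j\<in>UNIV - {i}. 1 / real N)"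
        by (intro sum_mono) auto
      then have "K * (\<Sum>j\<in>UNIV - {i}. \<bar>x $ j - y $ j\<bar>) \<le> K * (real m * (1 / real N))"
        using m(2) K by (intro mult_left_mono) auto
      moreover have "norm (x - y) \<le> K * (\<Sum>j\<in>UNIV - {i}. \<bar>x $ j - y $ j\<bar>)"
        using lip[of x y] xy by (auto simp: C_def dist_norm)
      ultimately show "norm (x - y) \<le> e" by (simp add: e_def)
    qed (use e in auto)
    have bC: "bounded (C f)" for f using bS by (rule bounded_subset) (auto simp: C_def)
    have "hausdorff_content m \<delta> S \<le> (\<Sum>f\<in>T. hausdorff_gauge m (C f))"
      using idxT e \<delta> order_trans[OF diam e(2)] bC
      by (intro hausdorff_content_finite_cover finT m) (auto simp: C_def)
    also have "\<dots> \<le> (\<Sum>f\<in>T. ennreal (unit_ball_vol (real m) * (e / 2) ^ m))"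
      by (intro sum_mono hausdorff_gauge_mono_diameter diam bC)
    also have "\<dots> = ennreal (real (card T) * (unit_ball_vol (real m) * (e / 2) ^ m))"
      by (simp add: ennreal_mult' flip: ennreal_of_nat_eq_real_of_nat)
    also have "\<dots> \<le> ennreal c"
    proof (rule ennreal_leI)
      have "real (card T) * (unit_ball_vol (real m) * (e / 2) ^ m)
          = unit_ball_vol (real m) * ((2 * real N * real M + 1) * (e / 2)) ^ m"
        unfolding cT power_mult_distrib[of "2 * real N * real M + 1" "e / 2"]
        by (simp add: add.commute)
      also have "\<dots> \<le> c" unfolding c_def
      proof (intro mult_left_mono power_mono)
        have "(2 * real N * real M + 1) * (e / 2) \<le> ((2 * real M + 1) * real N) * (e / 2)"
          using N e by (intro mult_right_mono) (auto simp: algebra_simps)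
        also have "\<dots> = (2 * real M + 1) * (K * real m) / 2"
          using N by (simp add: e_def)
        finally show "(2 * real N * real M + 1) * (e / 2) \<le> (2 * real M + 1) * (K * real m) / 2" .
      qed (use e in \<open>auto simp: unit_ball_vol_nonneg intro!: mult_nonneg_nonneg add_nonneg_nonneg\<close>)
      finally show "real (card T) * (unit_ball_vol (real m) * (e / 2) ^ m) \<le> c" .
    qed
    finally show ?thesis .
  qed
  then have "hausdorff_outer m S \<le> ennreal c" unfolding hausdorff_outer_def by (intro SUP_least) auto
  then show ?thesis by (simp add: m_def order_le_less_trans)
qed

lemma emeasure_lborel_cbox_eq_content: "emeasure lborel (cbox l u) = ennreal (measure lborel (cbox l u))"
  using emeasure_lborel_cbox_finite[of l u] by (intro emeasure_eq_ennreal_measure) auto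

text \<open>A line in a coordinate direction through a point of \<open>U\<close> meets the frontier, so the
  cylinders over the members of a cover of the frontier cover \<open>U\<close>.\<close>

lemma hausdorff_outer_frontier_pos:
  fixes U :: "(real^'d::finite) set"
  assumes d: "CARD('d) \<ge> 2" and U: "open U" "bounded U" "U \<noteq> {}"
  shows "hausdorff_outer (CARD('d) - 1) (frontier U) > 0"
proof -
  define m where "m = CARD('d) - 1"
  obtain i :: 'd where True by simp
  have m: "m \<ge> 1" "card (UNIV - {i}) = m" using d by (auto simp: m_def)
  obtain a where "a \<in> U" using U by blast
  then obtain l u where lu: "a \<in> box l u" "cbox l u \<subseteq> U"
    using open_contains_cbox[of U a] U(1) by (metis)
  define V0 where "V0 = measure lborel (cbox l u)"
  have "V0 > 0" using lu by (auto simp: V0_def content_pos_lt_eq box_eq_empty mem_box inner_axis)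
  obtain R where R: "R > 0" "\<And>x. x \<in> U \<Longrightarrow> norm x \<le> R" using U(2) bounded_pos by blast
  \<comment> \<open>A box of length \<open>2 * R\<close> in direction \<open>i\<close> and
    half-widths \<open>diameter (C n)\<close> has volume
    \<open>2 * R * (2 * diameter (C n)) ^ m\<close>; the 4 converts this to the half diameters in
    the gauge.\<close>
  define c where "c = 2 * R * 4 ^ m / unit_ball_vol (real m)"
  have c: "c > 0" using R by (simp add: c_def unit_ball_vol_pos)
  \<comment> \<open>Any one scale bounds the measure from below; 1 is an arbitrary choice.\<close>
  have key: "ennreal (V0 / c) \<le> (\<Sum>n. hausdorff_gauge m (C n))" if C: "C \<in> covers 1 (frontier U)" for C
  proof -
    \<comment> \<open>For an empty \<open>C n\<close> this point is arbitrary, but the covering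
      argument uses only members that contain a frontier point.\<close>
    define p where "p = (\<lambda>n. SOME p. p \<in> C n)"
    define lo where "lo = (\<lambda>n. \<chi> j. if j = i then - R else p n $ j - diameter (C n))"
    define hi where "hi = (\<lambda>n. \<chi> j. if j = i then R else p n $ j + diameter (C n))"
    have bC: "bounded (C n)" for n using C by (auto simp: covers_def)
    have D0: "diameter (C n) \<ge> 0" for n using bC by (rule diameter_ge_0)
    have "cbox l u \<subseteq> (\<Union>n. cbox (lo n) (hi n))"
    proof
      fix x assume x: "x \<in> cbox l u"
      then have xU: "x \<in> U" using lu by blast
      define L where "L = (\<lambda>t. x + t *\<^sub>R axis i 1) ` {0..}"
      have "connected L" unfolding L_def
        by (intro connected_continuous_image continuous_intros connected_Ici)
      moreover have "x \<in> L" unfolding L_def by (intro image_eqI[of _ _ 0]) auto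
      moreover have "L - U \<noteq> {}"
      proof -
        \<comment> \<open>Two points of a ball of radius \<open>R\<close> around 0 cannot have
          distance \<open>2 * R + 1\<close>.\<close>
        let ?y = "x + (2 * R + 1) *\<^sub>R axis i 1"
        have "norm ((2 * R + 1) *\<^sub>R axis i (1::real)) \<le> norm ?y + norm x"
          using norm_triangle_ineq4[of ?y x] by simp
        then have "?y \<notin> U" using R(2)[OF xU] R(2)[of ?y] R(1) by (force simp: norm_axis_1)
        moreover have "?y \<in> L" unfolding L_def using R by auto
        ultimately show ?thesis by blast
      qed
      ultimately obtain y where y: "y \<in> L" "y \<in> frontier U"
        using connected_Int_frontier[of L U] xU by blast
      then obtain n where n: "y \<in> C n" using C by (auto simp: covers_def)
      then have "p n \<in> C n" unfolding p_def by (rule someI)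
      then have yp: "dist y (p n) \<le> diameter (C n)" using n bC by (intro diameter_bounded_bound)
      have "\<bar>x $ j - p n $ j\<bar> \<le> diameter (C n)" if "j \<noteq> i" for j
      proof -
        have "x $ j = y $ j" using y(1) that by (auto simp: L_def axis_def)
        then show ?thesis using yp component_le_norm_cart[of "y - p n" j] by (simp add: dist_norm)
      qed
      moreover have "\<bar>x $ i\<bar> \<le> R" using component_le_norm_cart[of x i] R(2)[OF xU] by linarith
      ultimately have "x \<in> cbox (lo n) (hi n)"
        by (auto simp: mem_box_cart lo_def hi_def abs_le_iff) (smt (verit))+
      then show "x \<in> (\<Union>n. cbox (lo n) (hi n))" by blast
    qed
    note boxes = this
    have meas: "emeasure lborel (cbox (lo n) (hi n)) = ennreal c * hausdorff_gauge m (C n)" for n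
    proof -
      have ne: "cbox (lo n) (hi n) \<noteq> {}" using D0[of n] R by (auto simp: lo_def hi_def interval_ne_empty_cart)
      have "emeasure lborel (cbox (lo n) (hi n)) = ennreal (measure lborel (cbox (lo n) (hi n)))"
        by (rule emeasure_lborel_cbox_eq_content)
      also have "measure lborel (cbox (lo n) (hi n)) = (\<Prod>j\<in>UNIV. hi n $ j - lo n $ j)"
        by (rule content_cbox_cart[OF ne])
      also have "\<dots> = (2 * R) * (\<Prod>j\<in>UNIV - {i}. 2 * diameter (C n))"
        by (subst prod.remove[of UNIV i]) (auto simp: lo_def hi_def intro!: prod.cong)
      also have "\<dots> = (2 * R) * (4 * (diameter (C n) / 2)) ^ m" using m by simp
      also have "\<dots> = c * (unit_ball_vol (real m) * (diameter (C n) / 2) ^ m)"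
        unfolding power_mult_distrib using unit_ball_vol_pos[of "real m"] by (simp add: c_def less_imp_neq[THEN not_sym])
      also have "ennreal \<dots> = ennreal c * hausdorff_gauge m (C n)" unfolding hausdorff_gauge_def using c by (simp add: ennreal_mult')
      finally show ?thesis .
    qed
    have "emeasure lborel (cbox l u) \<le> emeasure lborel (\<Union>n. cbox (lo n) (hi n))"
      by (intro emeasure_mono boxes) auto
    also have "\<dots> \<le> (\<Sum>n. emeasure lborel (cbox (lo n) (hi n)))"
      by (intro emeasure_subadditive_countably) auto
    also have "\<dots> = ennreal c * (\<Sum>n. hausdorff_gauge m (C n))" by (simp add: meas)
    finally have "ennreal V0 \<le> ennreal c * (\<Sum>n. hausdorff_gauge m (C n))"
      by (simp add: V0_def emeasure_lborel_cbox_eq_content)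
    then have "ennreal (1 / c) * ennreal V0 \<le> ennreal (1 / c) * (ennreal c * (\<Sum>n. hausdorff_gauge m (C n)))"
      by (intro mult_left_mono) auto
    also have "\<dots> = (\<Sum>n. hausdorff_gauge m (C n))"
      using c by (simp add: mult.assoc[symmetric] flip: ennreal_mult)
    finally show ?thesis using c \<open>V0 > 0\<close> by (simp flip: ennreal_mult)
  qed
  have "0 < ennreal (V0 / c)" using c \<open>V0 > 0\<close> by simp
  also have "\<dots> \<le> hausdorff_content m 1 (frontier U)"
    unfolding hausdorff_content_alt by (intro INF_greatest key)
  also have "\<dots> \<le> hausdorff_outer m (frontier U)" by (rule hausdorff_content_le_outer) simp
  finally show ?thesis by (simp add: m_def)
qed

section \<open>Outer normal and boundary measure\<close>

lemma gradient_inner: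
  fixes f :: "real^'d::finite \<Rightarrow> real"
  assumes "(f has_derivative D) (at x)"
  shows "D v = gradient f x \<bullet> v"
proof -
  have D: "frechet_derivative f (at x) = D" using frechet_derivative_at[OF assms] by simp
  interpret D: bounded_linear D using assms by (rule has_derivative_bounded_linear)
  have "v = (\<Sum>j\<in>UNIV. v $ j *\<^sub>R axis j 1)"
    by (simp add: basis_expansion[of v, unfolded scalar_mult_eq_scaleR])
  then have "D v = D (\<Sum>j\<in>UNIV. v $ j *\<^sub>R axis j 1)" by simp
  also have "\<dots> = (\<Sum>j\<in>UNIV. v $ j * D (axis j 1))" by (simp add: D.sum D.scaleR)
  also have "\<dots> = gradient f x \<bullet> v" by (simp add: gradient_def D inner_vec_def mult.commute)
  finally show ?thesis .
qed

lemma gradient_eqI: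
  fixes f :: "real^'d::finite \<Rightarrow> real"
  assumes "(f has_derivative (\<lambda>v. g \<bullet> v)) (at x)"
  shows "gradient f x = g"
proof -
  have "(gradient f x - g) \<bullet> (gradient f x - g) = 0"
    using gradient_inner[OF assms, of "gradient f x - g"] by (simp only: inner_diff_left)
  then show ?thesis by simp
qed

section \<open>Geometry of a single boundary chart\<close>

context
  fixes U :: "(real^'d::finite) set" and x r i s f
  assumes U: "open U" and x: "x \<in> frontier U" and chart: "C2_chart U x r i s f"
begin

lemma chart_deriv:
  "\<exists>D. (\<forall>y. (f has_derivative blinfun_apply (D y)) (at y)) \<and> continuous_on UNIV D"
proof -
  obtain D where D: "\<And>y. (f has_derivative blinfun_apply (D y)) (at y)" "C1_on UNIV D"
    using chart by (auto simp: C2_chart_def C2_on_def)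
  then obtain D' where "\<And>y. (D has_derivative blinfun_apply (D' y)) (at y)" by (auto simp: C1_on_def)
  then have "continuous_on UNIV D"
    by (intro has_derivative_continuous_on[of UNIV D "\<lambda>y. blinfun_apply (D' y)"]) auto
  then show ?thesis using D by blast
qed

abbreviation "chart_normal \<equiv> axis i s - gradient f x"

lemma chart_has_derivative:
  "((\<lambda>y. s * y $ i - f y) has_derivative (\<lambda>v. chart_normal \<bullet> v)) (at x)"
proof -
  obtain D where D: "\<And>y. (f has_derivative blinfun_apply (D y)) (at y)" "continuous_on UNIV D"
    using chart_deriv by blast
  note D = D(1)[of x]
  have "((\<lambda>y. s * y $ i - f y) has_derivative (\<lambda>v. s * v $ i - D x v)) (at x)"
    by (intro derivative_intros D) (auto intro!: derivative_eq_intros bounded_linear_imp_has_derivative bounded_linear_vec_nth)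
  moreover have "s * v $ i - D x v = chart_normal \<bullet> v" for v
    using gradient_inner[OF D, of v] by (simp add: inner_diff_left inner_axis' )
  ultimately show ?thesis by simp
qed

lemma chart_f_continuous: "continuous_on UNIV f"
proof -
  obtain D where D: "\<And>y. (f has_derivative blinfun_apply (D y)) (at y)" "continuous_on UNIV D"
    using chart_deriv by blast
  then show ?thesis by (intro has_derivative_continuous_on[of UNIV f "\<lambda>y. blinfun_apply (D y)"]) auto
qed

lemma chart_mem: "y \<in> ball x r \<Longrightarrow> y \<in> U \<longleftrightarrow> s * y $ i < f y"
proof -
  assume "y \<in> ball x r"
  moreover have "U \<inter> ball x r = {y \<in> ball x r. s * y $ i < f y}" using chart by (simp add: C2_chart_def)
  ultimately show ?thesis by blast
qed

text \<open>An open set misses its frontier, so \<open>x\<close> is not below the graph; if it were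
  strictly above, a whole neighbourhood would miss \<open>U\<close>.\<close>

lemma chart_zero: "s * x $ i = f x"
proof -
  have r: "r > 0" using chart by (simp add: C2_chart_def)
  have "x \<notin> U" using x U by (auto simp: frontier_def interior_open)
  then have "\<not> s * x $ i < f x" using r chart_mem[of x] by simp
  moreover have "\<not> s * x $ i > f x"
  proof
    assume gt: "s * x $ i > f x"
    have "open {y. f y < s * y $ i}"
      by (intro open_Collect_less chart_f_continuous continuous_intros)
    then have op: "open ({y. f y < s * y $ i} \<inter> ball x r)" by (intro open_Int open_ball)
    have "x \<in> ({y. f y < s * y $ i} \<inter> ball x r) \<inter> closure U"
      using gt r x by (simp add: frontier_def)
    then have "({y. f y < s * y $ i} \<inter> ball x r) \<inter> U \<noteq> {}"
      using open_Int_closure_eq_empty[OF op, of U] by blast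
    then obtain y where "f y < s * y $ i" "y \<in> ball x r" "y \<in> U" by blast
    then show False using chart_mem[of y] by linarith
  qed
  ultimately show ?thesis by simp
qed

text \<open>The function \<open>s * y $ i - f y\<close> vanishes at \<open>x\<close>, so the sign of
  its derivative along \<open>v\<close> decides on which side short steps land. This characterises
  the normal by \<open>U\<close> alone, as the comparison of two charts requires.\<close>

lemma chart_direction:
  assumes "v \<bullet> chart_normal \<noteq> 0"
  shows "eventually (\<lambda>t. x + t *\<^sub>R v \<in> U \<longleftrightarrow> v \<bullet> chart_normal < 0) (at_right 0)"
proof -
  have r: "r > 0" using chart by (simp add: C2_chart_def)
  define h where "h = (\<lambda>t. s * (x + t *\<^sub>R v) $ i - f (x + t *\<^sub>R v))"
  have x0: "((\<lambda>y. s * y $ i - f y) has_derivative (\<lambda>v. chart_normal \<bullet> v)) (at (x + 0 *\<^sub>R v))"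
    using chart_has_derivative by simp
  have "((\<lambda>t. (\<lambda>y. s * y $ i - f y) (x + t *\<^sub>R v)) has_derivative (\<lambda>t. chart_normal \<bullet> (t *\<^sub>R v))) (at 0)"
    by (rule has_derivative_compose[of "\<lambda>t. x + t *\<^sub>R v" "\<lambda>t. t *\<^sub>R v", OF _ x0])
       (auto intro!: derivative_eq_intros)
  moreover have "(\<lambda>t. chart_normal \<bullet> (t *\<^sub>R v)) = (*) (v \<bullet> chart_normal)"
    by (simp add: fun_eq_iff inner_commute[of v])
  ultimately have h': "(h has_real_derivative (v \<bullet> chart_normal)) (at 0)"
    unfolding h_def has_field_derivative_def by (simp only:)
  have h0: "h 0 = 0" using chart_zero by (simp add: h_def)
  have "eventually (\<lambda>t. x + t *\<^sub>R v \<in> ball x r) (at_right 0)"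
  proof -
    have "((\<lambda>t. x + t *\<^sub>R v) \<longlongrightarrow> x + 0 *\<^sub>R v) (at_right 0)" by (intro tendsto_intros)
    then show ?thesis using topological_tendstoD[of _ x _ "ball x r"] r by auto
  qed
  moreover have "eventually (\<lambda>t. h t < 0 \<longleftrightarrow> v \<bullet> chart_normal < 0) (at_right 0)"
  proof (cases "v \<bullet> chart_normal < 0")
    case True
    obtain d where "d > 0" "\<And>t. t > 0 \<Longrightarrow> t < d \<Longrightarrow> h (0 + t) < h 0"
      using DERIV_neg_dec_right[OF h' True] by blast
    then show ?thesis using True h0 unfolding eventually_at_right_field by auto
  next
    case False
    then have "v \<bullet> chart_normal > 0" using assms by simp
    then obtain d where "d > 0" "\<And>t. t > 0 \<Longrightarrow> t < d \<Longrightarrow> h 0 < h (0 + t)"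
      using DERIV_pos_inc_right[OF h'] by blast
    then have "\<forall>t>0. t < d \<longrightarrow> (h t < 0 \<longleftrightarrow> v \<bullet> chart_normal < 0)" using False h0 by force
    then show ?thesis using \<open>d > 0\<close> unfolding eventually_at_right_field by blast
  qed
  ultimately show ?thesis
  proof eventually_elim
    case (elim t)
    from chart_mem[OF elim(1)] have "x + t *\<^sub>R v \<in> U \<longleftrightarrow> h t < 0" by (simp add: h_def)
    then show ?case using elim(2) by blast
  qed
qed

text \<open>Since \<open>f\<close> ignores coordinate \<open>i\<close>, its gradient has no such
  component, and the normal keeps the nonzero entry \<open>s\<close> there.\<close>

lemma chart_normal_nonzero: "chart_normal \<noteq> 0"
proof -
  obtain D where D: "\<And>y. (f has_derivative blinfun_apply (D y)) (at y)" "continuous_on UNIV D"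
    using chart_deriv by blast
  note D = D(1)[of x]
  have ft: "f (x + t *\<^sub>R axis i 1) = f x" for t using chart by (auto simp: C2_chart_def)
  have x0: "(f has_derivative blinfun_apply (D x)) (at (x + 0 *\<^sub>R axis i 1))" using D by simp
  have "((\<lambda>t. f (x + t *\<^sub>R axis i 1)) has_derivative (\<lambda>t. D x (t *\<^sub>R axis i 1))) (at 0)"
    by (rule has_derivative_compose[of "\<lambda>t. x + t *\<^sub>R axis i 1" "\<lambda>t. t *\<^sub>R axis i 1", OF _ x0])
       (auto intro!: derivative_eq_intros)
  then have "((\<lambda>t. f x) has_derivative (\<lambda>t. D x (t *\<^sub>R axis i 1))) (at (0::real))" by (simp add: ft)
  moreover have "((\<lambda>t. f x) has_derivative (\<lambda>t. 0)) (at (0::real))" by simp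
  ultimately have "(\<lambda>t::real. D x (t *\<^sub>R axis i 1)) = (\<lambda>t. 0)" by (rule has_derivative_unique)
  then have "D x (axis i 1) = 0" by (metis scaleR_one)
  then have "chart_normal \<bullet> axis i 1 = s"
    using gradient_inner[OF D, of "axis i 1"] by (simp add: inner_diff_left inner_axis)
  moreover have "s \<noteq> 0" using chart by (auto simp: C2_chart_def)
  ultimately show ?thesis by auto
qed

end

text \<open>If two charts gave different unit normals \<open>n\<close> and \<open>n'\<close>, the direction \<open>n' - n\<close> would point
  into \<open>U\<close> according to the first and out of \<open>U\<close> according to the second.\<close>

lemma C2_chart_normal_unique:
  assumes "open U" "x \<in> frontier U" "C2_chart U x r i s f" "C2_chart U x r' i' s' f'"
  shows "sgn (axis i s - gradient f x) = sgn (axis i' s' - gradient f' x)"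
proof (rule ccontr)
  define n where "n = axis i s - gradient f x"
  define n' where "n' = axis i' s' - gradient f' x"
  have ne: "n \<noteq> 0" "n' \<noteq> 0"
    unfolding n_def n'_def using chart_normal_nonzero assms by blast+
  assume "sgn (axis i s - gradient f x) \<noteq> sgn (axis i' s' - gradient f' x)"
  then have diff: "sgn n \<noteq> sgn n'" by (simp add: n_def n'_def)
  define v where "v = sgn n' - sgn n"
  have nn: "sgn n \<bullet> sgn n = 1" "sgn n' \<bullet> sgn n' = 1"
    using ne by (simp_all add: dot_square_norm norm_sgn)
  have lt: "sgn n' \<bullet> sgn n < 1"
  proof -
    have "0 < (sgn n' - sgn n) \<bullet> (sgn n' - sgn n)" using diff by simp
    also have "\<dots> = 2 - 2 * (sgn n' \<bullet> sgn n)"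
      using nn by (simp add: inner_diff_left inner_diff_right inner_commute)
    finally show ?thesis by simp
  qed
  have sg: "w = norm w *\<^sub>R sgn w" for w :: "real^'a" by (cases "w = 0") (simp_all add: sgn_div_norm)
  have vn: "v \<bullet> sgn n = sgn n' \<bullet> sgn n - 1" and vn': "v \<bullet> sgn n' = 1 - sgn n' \<bullet> sgn n"
    unfolding v_def inner_diff_left nn by (simp_all add: inner_commute)
  have "v \<bullet> n = norm n * (v \<bullet> sgn n)" by (subst sg[of n]) simp
  also have "\<dots> < 0" unfolding vn using lt ne by (intro mult_pos_neg) auto
  finally have "v \<bullet> n < 0" .
  moreover have "v \<bullet> n' > 0"
  proof -
    have "v \<bullet> n' = norm n' * (v \<bullet> sgn n')" by (subst sg[of n']) simp
    also have "\<dots> > 0" unfolding vn' using lt ne by (intro mult_pos_pos) auto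
    finally show ?thesis .
  qed
  ultimately have
    "eventually (\<lambda>t. x + t *\<^sub>R v \<in> U) (at_right 0)" "eventually (\<lambda>t. x + t *\<^sub>R v \<notin> U) (at_right 0)"
    using chart_direction[OF assms(1-3), of v] chart_direction[OF assms(1,2,4), of v]
    by (auto simp: n_def n'_def)
  then have "eventually (\<lambda>t. False) (at_right (0::real))" by eventually_elim simp
  then show False by simp
qed

lemma outer_normal_eq:
  assumes "open U" "x \<in> frontier U" "C2_chart U x r i s f"
  shows "outer_normal U x = sgn (axis i s - gradient f x)"
  unfolding outer_normal_def
proof (rule the_equality)
  show "\<exists>r i' s' f'. C2_chart U x r i' s' f' \<and> sgn (axis i s - gradient f x) = sgn (axis i' s' - gradient f' x)"
    by (intro exI conjI) (rule assms(3), rule refl)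
next
  fix \<nu> assume "\<exists>r i s f. C2_chart U x r i s f \<and> \<nu> = sgn (axis i s - gradient f x)"
  then obtain r' i' s' f' where c: "C2_chart U x r' i' s' f'" and \<nu>: "\<nu> = sgn (axis i' s' - gradient f' x)"
    by (elim exE conjE)
  show "\<nu> = sgn (axis i s - gradient f x)"
    unfolding \<nu> by (rule C2_chart_normal_unique[OF assms(1,2) c assms(3)])
qed

text \<open>A chart gives the normal only at its centre. Recentring lets the same \<open>f\<close>
  give the normal and the graph equation at all nearby frontier points.\<close>

lemma C2_chart_shift:
  assumes "C2_chart U x r i s f" "y \<in> ball x r"
  shows "C2_chart U y (r - dist x y) i s f"
proof -
  have "ball y (r - dist x y) \<subseteq> ball x r"
  proof
    fix z assume "z \<in> ball y (r - dist x y)"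
    then show "z \<in> ball x r" using dist_triangle[of x z y] by simp
  qed
  moreover have "U \<inter> ball x r = {y \<in> ball x r. s * y $ i < f y}" using assms by (simp add: C2_chart_def)
  ultimately have "U \<inter> ball y (r - dist x y) = {z \<in> ball y (r - dist x y). s * z $ i < f z}" by blast
  then show ?thesis using assms by (simp add: C2_chart_def)
qed

text \<open>Near \<open>x\<close> a single chart describes the normal at all frontier points, and
  the gradient of its \<open>f\<close> is continuous.\<close>

lemma continuous_outer_normal:
  assumes U: "open U" "C2_boundary U"
  shows "continuous_on (frontier U) (outer_normal U)"
  unfolding continuous_on_eq_continuous_within
proof
  fix x assume x: "x \<in> frontier U"
  obtain r i s f where c: "C2_chart U x r i s f" using U(2) x unfolding C2_boundary_def by blast
  have r: "r > 0" using c by (simp add: C2_chart_def)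
  obtain D where D: "\<And>y. (f has_derivative blinfun_apply (D y)) (at y)" "continuous_on UNIV D"
    using chart_deriv[OF U(1) x c] by blast
  have "gradient f = (\<lambda>y. \<chi> j. D y (axis j 1))"
    unfolding gradient_def using frechet_derivative_at[OF D(1)] by (auto simp: fun_eq_iff)
  moreover have "continuous_on UNIV (\<lambda>y. \<chi> j. D y (axis j 1))"
    using D(2) by (intro continuous_intros)
  ultimately have "isCont (gradient f) x" by (simp add: continuous_on_eq_continuous_at)
  then have "isCont (\<lambda>y. sgn (axis i s - gradient f y)) x"
    using chart_normal_nonzero[OF U(1) x c]
    unfolding sgn_div_norm by (intro continuous_intros) auto
  then have "continuous (at x within frontier U) (\<lambda>y. sgn (axis i s - gradient f y))"
    by (rule continuous_at_imp_continuous_at_within)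
  then show "continuous (at x within frontier U) (outer_normal U)"
  proof (rule continuous_transform_within[OF _ r x])
    fix y assume y: "y \<in> frontier U" "dist y x < r"
    then have "C2_chart U y (r - dist x y) i s f"
      using c by (intro C2_chart_shift) (auto simp: dist_commute)
    then show "sgn (axis i s - gradient f y) = outer_normal U y"
      using outer_normal_eq[OF U(1) y(1)] by simp
  qed
qed

text \<open>The frontier near \<open>x\<close> lies on the graph of \<open>f\<close>, which is
  Lipschitz where its derivative is bounded; what has to be arranged is a bound free of the
  \<open>i\<close>-th coordinate.\<close>

lemma hausdorff_frontier_ball_finite:
  fixes U :: "(real^'d::finite) set"
  assumes d: "CARD('d) \<ge> 2" and U: "open U" and x: "x \<in> frontier U" and c: "C2_chart U x r i s f"
  shows "hausdorff_outer (CARD('d) - 1) (frontier U \<inter> ball x r) < top"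
proof -
  obtain D where D: "\<And>y. (f has_derivative blinfun_apply (D y)) (at y)" "continuous_on UNIV D"
    using chart_deriv[OF U(1) x c] by blast
  \<comment> \<open>Radius \<open>3 * r\<close> makes room for the auxiliary point \<open>z'\<close>
    below, which may leave the ball of the chart.\<close>
  have "compact (D ` cball x (3 * r))"
    using D(2) by (intro compact_continuous_image) (auto intro: continuous_on_subset)
  then have "bounded (D ` cball x (3 * r))" by (rule compact_imp_bounded)
  then obtain B where "B > 0" "\<forall>z\<in>D ` cball x (3 * r). norm z \<le> B" unfolding bounded_pos by blast
  then have B: "B > 0" "\<And>y. y \<in> cball x (3 * r) \<Longrightarrow> norm (D y) \<le> B" by blast+
  have fL: "norm (f y - f z) \<le> B * norm (y - z)" if "y \<in> cball x (3 * r)" "z \<in> cball x (3 * r)" for y z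
  proof (rule differentiable_bound[of "cball x (3 * r)" f "\<lambda>y. blinfun_apply (D y)"])
    show "onorm (blinfun_apply (D y)) \<le> B" if "y \<in> cball x (3 * r)" for y
      using B(2)[OF that] by (simp add: norm_blinfun.rep_eq)
    show "(f has_derivative blinfun_apply (D y)) (at y within cball x (3 * r))" for y
      by (rule has_derivative_at_withinI) (rule D(1))
  qed (use that in simp_all)
  have fr: "s * y $ i = f y" if "y \<in> frontier U \<inter> ball x r" for y
    using chart_zero[OF U(1) _ C2_chart_shift[OF c, of y]] that by simp
  have "s \<in> {-1, 1}" using c by (simp add: C2_chart_def)
  then have s: "\<bar>s\<bar> = 1" by auto
  have ft: "f (y + t *\<^sub>R axis i 1) = f y" for y t using c by (auto simp: C2_chart_def)
  have lip: "dist y z \<le> (1 + B) * (\<Sum>j\<in>UNIV - {i}. \<bar>y $ j - z $ j\<bar>)"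
    if y: "y \<in> frontier U \<inter> ball x r" and z: "z \<in> frontier U \<inter> ball x r" for y z
  proof -
    \<comment> \<open>Sliding \<open>z\<close> along axis \<open>i\<close> to the height of
      \<open>y\<close> does not change \<open>f\<close> and removes the \<open>i\<close>-th
      coordinate from the difference.\<close>
    define z' where "z' = z + (y $ i - z $ i) *\<^sub>R axis i 1"
    let ?S = "\<Sum>j\<in>UNIV - {i}. \<bar>y $ j - z $ j\<bar>"
    have yz: "dist y z < 2 * r" using y z dist_triangle3[of y z x] by simp
    have "dist x z' \<le> dist x z + dist z z'" by (rule dist_triangle)
    also have "dist z z' = \<bar>y $ i - z $ i\<bar>" by (simp add: z'_def dist_norm norm_axis_1)
    also have "\<dots> \<le> dist y z" using component_le_norm_cart[of "y - z" i] by (simp add: dist_norm)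
    finally have "dist x z' \<le> dist x z + dist y z" by simp
    moreover have "dist x y < r" "dist x z < r" "0 < r"
      using y z zero_le_dist[of x y] by (simp_all, linarith)
    ultimately have "z' \<in> cball x (3 * r)" "y \<in> cball x (3 * r)"
      unfolding mem_cball using yz by linarith+
    then have "\<bar>f y - f z'\<bar> \<le> B * norm (y - z')" using fL by (simp add: real_norm_def)
    also have "norm (y - z') \<le> (\<Sum>j\<in>UNIV. \<bar>(y - z') $ j\<bar>)" by (rule norm_le_l1_cart)
    also have "\<dots> = ?S" by (subst sum.remove[of UNIV i]) (auto simp: z'_def axis_def intro!: sum.cong)
    finally have fb: "\<bar>f y - f z\<bar> \<le> B * ?S" using B(1) by (simp add: z'_def ft)
    have "\<bar>y $ i - z $ i\<bar> = \<bar>s * y $ i - s * z $ i\<bar>"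
      unfolding right_diff_distrib[symmetric] abs_mult s by simp
    also have "\<dots> \<le> B * ?S" unfolding fr[OF y] fr[OF z] by (rule fb)
    finally have i: "\<bar>y $ i - z $ i\<bar> \<le> B * ?S" .
    have "dist y z \<le> (\<Sum>j\<in>UNIV. \<bar>(y - z) $ j\<bar>)" unfolding dist_norm by (rule norm_le_l1_cart)
    also have "\<dots> = \<bar>y $ i - z $ i\<bar> + ?S" by (subst sum.remove[of UNIV i]) auto
    finally show ?thesis using i by (simp add: algebra_simps)
  qed
  obtain M :: nat where M: "norm x + r \<le> real M" using real_arch_simple by blast
  have bnd: "\<bar>y $ j\<bar> \<le> real M" if "y \<in> frontier U \<inter> ball x r" for y j
  proof -
    have "norm y \<le> norm x + dist x y" using norm_triangle_sub[of y x] by (simp add: dist_norm norm_minus_commute)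
    moreover have "dist x y < r" using that by simp
    ultimately show ?thesis using component_le_norm_cart[of y j] M by linarith
  qed
  have "0 \<le> 1 + B" using B(1) by simp
  from hausdorff_outer_Lipschitz_graph[OF d this bnd lip] show ?thesis .
qed

lemma hausdorff_frontier_finite:
  fixes U :: "(real^'d::finite) set"
  assumes d: "CARD('d) \<ge> 2" and U: "open U" "bounded U" "C2_boundary U"
  shows "hausdorff_outer (CARD('d) - 1) (frontier U) < top"
proof -
  have m: "CARD('d) - 1 \<ge> 1" using d by simp
  have "\<exists>r. r > 0 \<and> hausdorff_outer (CARD('d) - 1) (frontier U \<inter> ball x r) < top" if "x \<in> frontier U" for x
  proof -
    obtain r i s f where c: "C2_chart U x r i s f" using U(3) \<open>x \<in> frontier U\<close> unfolding C2_boundary_def by blast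
    show ?thesis using hausdorff_frontier_ball_finite[OF d U(1) that c] c by (auto simp: C2_chart_def)
  qed
  then obtain r where r: "\<And>x. x \<in> frontier U \<Longrightarrow> r x > 0"
    "\<And>x. x \<in> frontier U \<Longrightarrow> hausdorff_outer (CARD('d) - 1) (frontier U \<inter> ball x (r x)) < top" by metis
  have "compact (frontier U)" using U by (simp add: compact_frontier_bounded)
  moreover have "frontier U \<subseteq> (\<Union>x\<in>frontier U. ball x (r x))" using r(1) by fastforce
  ultimately have "compact (frontier U)" "frontier U \<subseteq> (\<Union>x\<in>frontier U. ball x (r x))" .
  note compact_cover = this
  obtain T where T: "T \<subseteq> frontier U" "finite T" "frontier U \<subseteq> (\<Union>x\<in>T. ball x (r x))"
    by (rule compactE_image[OF compact_cover(1) _ compact_cover(2)]) auto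
  have "hausdorff_outer (CARD('d) - 1) (\<Union>x\<in>T. frontier U \<inter> ball x (r x)) < top"
    using T(2,1)
  proof (induction T)
    case empty
    show ?case using hausdorff_outer_empty[OF m, where 'a = "real^'d"] by simp
  next
    case (insert x T)
    have "hausdorff_outer (CARD('d) - 1) (\<Union>x\<in>insert x T. frontier U \<inter> ball x (r x))
      \<le> hausdorff_outer (CARD('d) - 1) (frontier U \<inter> ball x (r x))
        + hausdorff_outer (CARD('d) - 1) (\<Union>x\<in>T. frontier U \<inter> ball x (r x))"
      using hausdorff_outer_Un[OF m] by simp
    also have "\<dots> < top" using insert r(2)[of x] by simp
    finally show ?case .
  qed
  moreover have "frontier U \<subseteq> (\<Union>x\<in>T. frontier U \<inter> ball x (r x))" using T(3) by blast
  ultimately show ?thesis by (rule order_le_less_trans[OF hausdorff_outer_mono, rotated])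
qed

section \<open>Tensor product polynomials\<close>

definition multi_indices :: "nat \<Rightarrow> ('d::finite \<Rightarrow> nat) set" where
  "multi_indices p = {\<alpha>. \<forall>i. \<alpha> i \<le> p}"

lemma multi_indices_PiE: "multi_indices p = PiE UNIV (\<lambda>i. {..p})"
  by (auto simp: multi_indices_def PiE_def extensional_def)

lemma finite_multi_indices: "finite (multi_indices p)"
  unfolding multi_indices_PiE by (intro finite_PiE) auto

lemma Qp_alt: "q \<in> Qp p \<longleftrightarrow> (\<exists>c. q = (\<lambda>x. \<Sum>\<alpha>\<in>multi_indices p. c \<alpha> * (\<Prod>i\<in>UNIV. x $ i ^ \<alpha> i)))"
  by (simp add: Qp_def multi_indices_def fun_eq_iff)

lemma QpI: "(\<lambda>x. \<Sum>\<alpha>\<in>multi_indices p. c \<alpha> * (\<Prod>i\<in>UNIV. x $ i ^ \<alpha> i)) \<in> Qp p"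
  unfolding Qp_alt by (rule exI) (rule refl)

lemma Qp_comb:
  assumes "u \<in> Qp p" "v \<in> Qp p"
  shows "(\<lambda>x. a * u x + b * v x) \<in> Qp p"
proof -
  obtain c where u: "u = (\<lambda>x. \<Sum>\<alpha>\<in>multi_indices p. c \<alpha> * (\<Prod>i\<in>UNIV. x $ i ^ \<alpha> i))" using assms(1) unfolding Qp_alt by blast
  obtain d where v: "v = (\<lambda>x. \<Sum>\<alpha>\<in>multi_indices p. d \<alpha> * (\<Prod>i\<in>UNIV. x $ i ^ \<alpha> i))" using assms(2) unfolding Qp_alt by blast
  have "(\<lambda>x. a * u x + b * v x) = (\<lambda>x. \<Sum>\<alpha>\<in>multi_indices p. (a * c \<alpha> + b * d \<alpha>) * (\<Prod>i\<in>UNIV. x $ i ^ \<alpha> i))"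
    unfolding u v by (simp add: sum_distrib_left sum.distrib distrib_right mult.assoc)
  then show ?thesis by (simp only: QpI)
qed

lemma Qp_tensor:
  fixes f :: "'d::finite \<Rightarrow> real poly"
  assumes "\<And>i. degree (f i) \<le> p"
  shows "(\<lambda>x. \<Prod>i\<in>UNIV. poly (f i) (x $ i)) \<in> Qp p"
proof -
  have "poly (f i) t = (\<Sum>k\<le>p. coeff (f i) k * t ^ k)" for i t
    unfolding poly_altdef using assms[of i]
    by (intro sum.mono_neutral_left) (auto simp: coeff_eq_0)
  then have "(\<Prod>i\<in>UNIV. poly (f i) (x $ i)) = (\<Prod>i\<in>UNIV. \<Sum>k\<in>{..p}. coeff (f i) k * x $ i ^ k)" for x :: "real^'d"
    by simp
  also have "(\<Prod>i\<in>UNIV. \<Sum>k\<in>{..p}. coeff (f i) k * x $ i ^ k)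
      = (\<Sum>\<alpha>\<in>PiE UNIV (\<lambda>i. {..p}). \<Prod>i\<in>UNIV. coeff (f i) (\<alpha> i) * x $ i ^ \<alpha> i)" for x :: "real^'d"
    by (rule prod_sum_PiE) auto
  finally have "(\<lambda>x. \<Prod>i\<in>UNIV. poly (f i) (x $ i))
      = (\<lambda>x. \<Sum>\<alpha>\<in>multi_indices p. (\<Prod>i\<in>UNIV. coeff (f i) (\<alpha> i)) * (\<Prod>i\<in>UNIV. x $ i ^ \<alpha> i))"
    by (simp add: multi_indices_PiE prod.distrib)
  then show ?thesis by (simp only: QpI)
qed

lemma Qp_const: "(\<lambda>x. a) \<in> Qp p"
proof -
  have 1: "(\<lambda>x :: real^'a. 1) \<in> Qp p" using Qp_tensor[of "\<lambda>i. 1" p] by simp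
  show ?thesis using Qp_comb[OF 1 1, of a 0] by simp
qed

lemma Qp_slice:
  assumes "q \<in> Qp p"
  shows "\<exists>P. degree P \<le> p \<and> (\<forall>t. q (\<chi> j. if j = i then t else x $ j) = poly P t)"
proof -
  obtain c where q: "q = (\<lambda>x. \<Sum>\<alpha>\<in>multi_indices p. c \<alpha> * (\<Prod>i\<in>UNIV. x $ i ^ \<alpha> i))"
    using assms unfolding Qp_alt by blast
  define P where "P = (\<Sum>\<alpha>\<in>multi_indices p. monom (c \<alpha> * (\<Prod>j\<in>UNIV - {i}. x $ j ^ \<alpha> j)) (\<alpha> i))"
  have "degree P \<le> p" unfolding P_def
    by (intro degree_sum_le finite_multi_indices order_trans[OF degree_monom_le]) (simp add: multi_indices_def)
  moreover have "q (\<chi> j. if j = i then t else x $ j) = poly P t" for t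
  proof -
    have "(\<Prod>j\<in>UNIV. (\<chi> j. if j = i then t else x $ j) $ j ^ \<alpha> j) = t ^ \<alpha> i * (\<Prod>j\<in>UNIV - {i}. x $ j ^ \<alpha> j)" for \<alpha>
      by (subst prod.remove[of UNIV i]) simp_all
    then show ?thesis by (simp add: q P_def poly_sum poly_monom mult_ac)
  qed
  ultimately show ?thesis by blast
qed

lemma poly_eq_0_of_roots:
  fixes P :: "real poly"
  assumes "degree P \<le> p" "\<And>t. t \<in> G \<Longrightarrow> poly P t = 0" "infinite G \<or> card G > p"
  shows "P = 0"
proof (rule ccontr)
  assume "P \<noteq> 0"
  then have fin: "finite {t. poly P t = 0}" and "card {t. poly P t = 0} \<le> degree P"
    by (rule poly_roots_finite, rule card_poly_roots_bound)
  moreover have "G \<subseteq> {t. poly P t = 0}" using assms(2) by blast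
  ultimately have "finite G" "card G \<le> p"
    using assms(1) card_mono[OF fin, of G] finite_subset by (blast, linarith)
  then show False using assms(3) by simp
qed

text \<open>Coordinates are released from the grid one at a time: along each of them the slice is a
  polynomial of degree at most \<open>p\<close> with more than \<open>p\<close> roots. Infinite
  \<open>G i\<close> serve open boxes, finite ones serve the nodes.\<close>

lemma Qp_unisolvent:
  fixes q :: "real^'d::finite \<Rightarrow> real"
  assumes q: "q \<in> Qp p" and G: "\<And>i. infinite (G i) \<or> card (G i) > p"
    and van: "\<And>x. (\<And>i. x $ i \<in> G i) \<Longrightarrow> q x = 0"
  shows "q x = 0"
proof -
  have "\<forall>x. (\<forall>j. j \<notin> S \<longrightarrow> x $ j \<in> G j) \<longrightarrow> q x = 0" if "finite S" for S
    using that
  proof (induction S)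
    case empty
    then show ?case using van by simp
  next
    case (insert i S)
    show ?case
    proof (intro allI impI)
      fix x assume x: "\<forall>j. j \<notin> insert i S \<longrightarrow> x $ j \<in> G j"
      obtain P where P: "degree P \<le> p" "\<And>t. q (\<chi> j. if j = i then t else x $ j) = poly P t"
        using Qp_slice[OF q] by blast
      have "poly P t = 0" if t: "t \<in> G i" for t
      proof -
        have "q (\<chi> j. if j = i then t else x $ j) = 0"
          using insert.IH x t by (auto elim!: allE[of _ "\<chi> j. if j = i then t else x $ j"])
        then show ?thesis by (simp add: P)
      qed
      then have "P = 0" using P(1) G[of i] by (intro poly_eq_0_of_roots[of P p "G i"])
      moreover have "(\<chi> j. if j = i then x $ i else x $ j) = x" by (simp add: vec_eq_iff)
      ultimately show "q x = 0" using P(2)[of "x $ i"] by simp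
    qed
  qed
  from this[of UNIV] show ?thesis by simp
qed

lemma Qp_unisolvent_eq:
  fixes q q' :: "real^'d::finite \<Rightarrow> real"
  assumes "q \<in> Qp p" "q' \<in> Qp p" "\<And>i. infinite (G i) \<or> card (G i) > p"
    and "\<And>x. (\<And>i. x $ i \<in> G i) \<Longrightarrow> q x = q' x"
  shows "q = q'"
proof
  fix x
  have "(\<lambda>x. 1 * q x + (-1) * q' x) x = 0"
    by (rule Qp_unisolvent[where G = G, OF Qp_comb[OF assms(1,2)] assms(3)]) (simp add: assms(4))
  then show "q x = q' x" by simp
qed

lemma Qp_eq_on_box:
  fixes q q' :: "real^'d::finite \<Rightarrow> real"
  assumes "q \<in> Qp p" "q' \<in> Qp p" "box l u \<noteq> {}" "\<And>x. x \<in> box l u \<Longrightarrow> q x = q' x"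
  shows "q = q'"
proof (rule Qp_unisolvent_eq[OF assms(1,2), of "\<lambda>i. {l $ i<..<u $ i}"])
  have "l $ i < u $ i" for i using assms(3) by (simp add: interval_ne_empty_cart)
  then show "infinite {l $ i<..<u $ i} \<or> p < card {l $ i<..<u $ i}" for i by simp
  show "q x = q' x" if "\<And>i. x $ i \<in> {l $ i<..<u $ i}" for x
    using that by (intro assms(4)) (simp add: mem_box_cart)
qed

lemma Qp_real_polynomial_function:
  assumes "q \<in> Qp p"
  shows "real_polynomial_function q"
proof -
  have coord: "real_polynomial_function (\<lambda>x. x $ i)" for i :: 'a
    by (rule real_polynomial_function.intros(1)) (rule bounded_linear_vec_nth)
  have pow: "real_polynomial_function (\<lambda>x. x $ i ^ n)" for i :: 'a and n
  proof (induction n)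
    case (Suc n)
    then show ?case using real_polynomial_function.intros(4)[OF coord Suc] by simp
  qed (simp add: real_polynomial_function.intros(2))
  obtain c where q: "q = (\<lambda>x. \<Sum>\<alpha>\<in>multi_indices p. c \<alpha> * (\<Prod>i\<in>UNIV. x $ i ^ \<alpha> i))"
    using assms unfolding Qp_alt by blast
  show ?thesis unfolding q
    by (intro real_polynomial_function_sum finite_multi_indices real_polynomial_function.intros(4)
        real_polynomial_function.intros(2) real_polynomial_function_prod finite pow)
qed

section \<open>Directional derivatives of polynomials\<close>

definition dir_deriv :: "'a::real_normed_vector \<Rightarrow> ('a \<Rightarrow> real) \<Rightarrow> 'a \<Rightarrow> real" where
  "dir_deriv e q x = deriv (\<lambda>t. q (x + t *\<^sub>R e)) 0"

text \<open>The derivative is again a polynomial function of the point reached on the line; this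
  permits iteration and yields continuity.\<close>

lemma real_polynomial_function_line_derivative:
  fixes q :: "'a::euclidean_space \<Rightarrow> real"
  assumes "real_polynomial_function q"
  shows "\<exists>q'. real_polynomial_function q' \<and> (\<forall>x t. ((\<lambda>t. q (x + t *\<^sub>R e)) has_real_derivative q' (x + t *\<^sub>R e)) (at t))"
  using assms
proof (induction q rule: real_polynomial_function.induct)
  case (linear f)
  then interpret bounded_linear f .
  have "((\<lambda>t. f (x + t *\<^sub>R e)) has_real_derivative f e) (at t)" for x t
    unfolding add scaleR by (auto intro!: derivative_eq_intros)
  then show ?case by (intro exI[of _ "\<lambda>_. f e"]) (auto intro: real_polynomial_function.intros(2))
next
  case (const c)
  show ?case by (intro exI[of _ "\<lambda>_. 0"]) (auto intro: real_polynomial_function.intros(2))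
next
  case (add f g)
  then obtain f' g' where f: "real_polynomial_function f'" "\<And>x t. ((\<lambda>t. f (x + t *\<^sub>R e)) has_real_derivative f' (x + t *\<^sub>R e)) (at t)"
    and g: "real_polynomial_function g'" "\<And>x t. ((\<lambda>t. g (x + t *\<^sub>R e)) has_real_derivative g' (x + t *\<^sub>R e)) (at t)" by blast
  show ?case
    by (intro exI[of _ "\<lambda>x. f' x + g' x"] conjI allI real_polynomial_function.intros(3) DERIV_add f g)
next
  case (mult f g)
  then obtain f' g' where f: "real_polynomial_function f'" "\<And>x t. ((\<lambda>t. f (x + t *\<^sub>R e)) has_real_derivative f' (x + t *\<^sub>R e)) (at t)"
    and g: "real_polynomial_function g'" "\<And>x t. ((\<lambda>t. g (x + t *\<^sub>R e)) has_real_derivative g' (x + t *\<^sub>R e)) (at t)" by blast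
  show ?case
    by (intro exI[of _ "\<lambda>x. f' x * g x + g' x * f x"] conjI allI real_polynomial_function.intros(3,4) DERIV_mult f g mult.hyps)
qed

lemma
  fixes q :: "'a::euclidean_space \<Rightarrow> real"
  assumes "real_polynomial_function q"
  shows real_polynomial_function_dir_deriv: "real_polynomial_function (dir_deriv e q)"
    and has_derivative_dir_deriv: "((\<lambda>t. q (x + t *\<^sub>R e)) has_real_derivative dir_deriv e q (x + t *\<^sub>R e)) (at t)"
proof -
  obtain q' where q': "real_polynomial_function q'"
    "\<And>x t. ((\<lambda>t. q (x + t *\<^sub>R e)) has_real_derivative q' (x + t *\<^sub>R e)) (at t)"
    using real_polynomial_function_line_derivative[OF assms] by blast
  have "dir_deriv e q = q'"
    using DERIV_imp_deriv[OF q'(2), of _ 0] by (simp add: dir_deriv_def fun_eq_iff)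
  then show "real_polynomial_function (dir_deriv e q)"
    "((\<lambda>t. q (x + t *\<^sub>R e)) has_real_derivative dir_deriv e q (x + t *\<^sub>R e)) (at t)" using q' by simp_all
qed

lemma real_polynomial_function_dir_deriv_funpow:
  fixes q :: "'a::euclidean_space \<Rightarrow> real"
  shows "real_polynomial_function q \<Longrightarrow> real_polynomial_function ((dir_deriv e ^^ m) q)"
  by (induction m) (simp_all add: real_polynomial_function_dir_deriv)

text \<open>Turns the iterated one-variable derivatives in \<open>jump\<close> into an operator
  iterated on polynomials, for which linearity and continuity are available.\<close>

lemma deriv_funpow_dir_deriv:
  fixes q :: "'a::euclidean_space \<Rightarrow> real"
  assumes "real_polynomial_function q"
  shows "(deriv ^^ m) (\<lambda>t. q (x + t *\<^sub>R e)) = (\<lambda>t. (dir_deriv e ^^ m) q (x + t *\<^sub>R e))"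
proof (induction m)
  case (Suc m)
  have "deriv (\<lambda>t. (dir_deriv e ^^ m) q (x + t *\<^sub>R e)) t = dir_deriv e ((dir_deriv e ^^ m) q) (x + t *\<^sub>R e)" for t
    by (intro DERIV_imp_deriv has_derivative_dir_deriv real_polynomial_function_dir_deriv_funpow assms)
  then show ?case by (simp add: Suc.IH fun_eq_iff)
qed simp

lemma dir_deriv_comb:
  fixes u v :: "'a::euclidean_space \<Rightarrow> real"
  assumes "real_polynomial_function u" "real_polynomial_function v"
  shows "dir_deriv e (\<lambda>x. a * u x + b * v x) = (\<lambda>x. a * dir_deriv e u x + b * dir_deriv e v x)"
proof
  fix x
  have "((\<lambda>t. a * u (x + t *\<^sub>R e) + b * v (x + t *\<^sub>R e)) has_real_derivative
      a * dir_deriv e u (x + 0 *\<^sub>R e) + b * dir_deriv e v (x + 0 *\<^sub>R e)) (at 0)"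
    by (intro DERIV_add DERIV_cmult has_derivative_dir_deriv assms)
  then show "dir_deriv e (\<lambda>x. a * u x + b * v x) x = a * dir_deriv e u x + b * dir_deriv e v x"
    unfolding dir_deriv_def[of e "\<lambda>x. a * u x + b * v x"] by (simp add: DERIV_imp_deriv)
qed

lemma dir_deriv_funpow_comb:
  fixes u v :: "'a::euclidean_space \<Rightarrow> real"
  assumes "real_polynomial_function u" "real_polynomial_function v"
  shows "(dir_deriv e ^^ m) (\<lambda>x. a * u x + b * v x) = (\<lambda>x. a * (dir_deriv e ^^ m) u x + b * (dir_deriv e ^^ m) v x)"
  by (induction m) (simp_all add: dir_deriv_comb real_polynomial_function_dir_deriv_funpow assms)

lemma gradient_real_polynomial_function:
  fixes q :: "real^'d::finite \<Rightarrow> real"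
  assumes "real_polynomial_function q"
  shows "gradient q = (\<lambda>x. \<chi> i. dir_deriv (axis i 1) q x)"
proof
  fix x
  have "q differentiable at x" using differentiable_at_real_polynomial_function[OF assms] .
  then obtain D where D: "(q has_derivative D) (at x)" unfolding differentiable_def by blast
  have "D (axis i 1) = dir_deriv (axis i 1) q x" for i
  proof -
    have x0: "(q has_derivative D) (at (x + 0 *\<^sub>R axis i 1))" using D by simp
    have "((\<lambda>t. q (x + t *\<^sub>R axis i 1)) has_derivative (\<lambda>t. D (t *\<^sub>R axis i 1))) (at 0)"
      by (rule has_derivative_compose[of "\<lambda>t. x + t *\<^sub>R axis i 1" "\<lambda>t. t *\<^sub>R axis i 1", OF _ x0])
         (auto intro!: derivative_eq_intros)
    moreover have "(\<lambda>t. D (t *\<^sub>R axis i 1)) = (*) (D (axis i 1))"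
      using has_derivative_bounded_linear[OF D] by (auto simp: fun_eq_iff bounded_linear.linear linear_cmul mult.commute)
    ultimately have "((\<lambda>t. q (x + t *\<^sub>R axis i 1)) has_real_derivative D (axis i 1)) (at 0)"
      unfolding has_field_derivative_def by simp
    then show ?thesis unfolding dir_deriv_def by (rule DERIV_imp_deriv[symmetric])
  qed
  moreover have "frechet_derivative q (at x) = D" using frechet_derivative_at[OF D] by simp
  ultimately show "gradient q x = (\<chi> i. dir_deriv (axis i 1) q x)" by (simp add: gradient_def)
qed

lemma gradient_comb:
  fixes u v :: "real^'d::finite \<Rightarrow> real"
  assumes u: "real_polynomial_function u" and v: "real_polynomial_function v"
  shows "gradient (\<lambda>x. a * u x + b * v x) x = a *\<^sub>R gradient u x + b *\<^sub>R gradient v x"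
proof -
  have "real_polynomial_function (\<lambda>x. a * u x + b * v x)"
    by (intro real_polynomial_function.intros(2,3,4) u v)
  then show ?thesis
    unfolding gradient_real_polynomial_function[OF u] gradient_real_polynomial_function[OF v]
    by (subst gradient_real_polynomial_function) (simp_all add: vec_eq_iff dir_deriv_comb[OF u v])
qed

lemma real_polynomial_function_continuous_on:
  "real_polynomial_function (f :: 'a::euclidean_space \<Rightarrow> real) \<Longrightarrow> continuous_on S f"
  by (rule continuous_on_polymonial_function) (simp add: real_polynomial_function_eq)

lemma continuous_on_gradient:
  fixes q :: "real^'d::finite \<Rightarrow> real"
  assumes "real_polynomial_function q"
  shows "continuous_on S (gradient q)"
  unfolding gradient_real_polynomial_function[OF assms]
  by (intro continuous_on_vec_lambda real_polynomial_function_continuous_on real_polynomial_function_dir_deriv assms)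

section \<open>Gauss--Lobatto nodes\<close>

text \<open>With the roots added in increasing order, the mean value theorem gives a new root to the
  right of all those found before, so distinctness is automatic.\<close>

lemma Rolle_poly_roots:
  fixes P :: "real poly"
  assumes "finite Z" "Z \<noteq> {}" "\<And>z. z \<in> Z \<Longrightarrow> poly P z = 0"
  shows "\<exists>Z'. finite Z' \<and> card Z' = card Z - 1 \<and> Z' \<subseteq> {Min Z<..<Max Z} \<and> (\<forall>z\<in>Z'. poly (pderiv P) z = 0)"
  using assms
proof (induction Z rule: finite_linorder_max_induct)
  case (insert b A)
  show ?case
  proof (cases "A = {}")
    case True
    then show ?thesis by (intro exI[of _ "{}"]) simp
  next
    case False
    then obtain Z where Z: "finite Z" "card Z = card A - 1" "Z \<subseteq> {Min A<..<Max A}" "\<forall>z\<in>Z. poly (pderiv P) z = 0"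
      using insert by auto
    have MA: "Max A \<in> A" "Min A \<in> A" using False insert.hyps(1) by simp_all
    have lt: "Max A < b" using insert.hyps(2) MA by blast
    have "Min A \<le> Max A" using False insert.hyps(1) by (simp add: MA)
    obtain z where z: "Max A < z" "z < b" "poly P b - poly P (Max A) = (b - Max A) * poly (pderiv P) z"
      using poly_MVT[OF lt] by blast
    have "poly P b = 0" "poly P (Max A) = 0" using insert.prems MA by simp_all
    then have pz: "poly (pderiv P) z = 0" using z lt by simp
    have m: "Min (insert b A) = Min A" "Max (insert b A) = b"
      using Min_insert[OF insert.hyps(1) False, of b] Max_insert[OF insert.hyps(1) False, of b]
        lt \<open>Min A \<le> Max A\<close> by linarith+
    have zn: "z \<notin> Z" using Z(3) z(1) by force
    have "Z \<subseteq> {Min A<..<b}" using Z(3) lt by force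
    moreover have "z \<in> {Min A<..<b}" using z \<open>Min A \<le> Max A\<close> by simp
    moreover have "card (insert z Z) = card (insert b A) - 1"
    proof -
      have "b \<notin> A" using insert.hyps(2) by blast
      moreover have "card A > 0" using False insert.hyps(1) by (simp add: card_gt_0_iff)
      ultimately show ?thesis using Z zn insert.hyps(1) by simp
    qed
    ultimately show ?thesis unfolding m using Z pz
      by (intro exI[of _ "insert z Z"]) simp
  qed
qed simp

lemma pderiv_dvd_power:
  fixes P :: "real poly"
  assumes "[:-a, 1:] ^ Suc n dvd P"
  shows "[:-a, 1:] ^ n dvd pderiv P"
proof -
  obtain r where P: "P = [:-a, 1:] ^ Suc n * r" using assms by (auto elim: dvdE)
  have "pderiv P = [:-a, 1:] ^ n * ([:-a, 1:] * pderiv r + r * smult (of_nat (Suc n)) (pderiv [:-a, 1:]))"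
    unfolding P pderiv_mult pderiv_power_Suc by (simp add: algebra_simps)
  then show ?thesis by (rule dvdI)
qed

context
  fixes p :: nat
begin

abbreviation "rod \<equiv> [:-1, 0, 1:] ^ p :: real poly"

text \<open>Rolle's theorem applied \<open>p\<close> times to \<open>rod\<close>, whose derivatives of order below \<open>p\<close> vanish
  at both end points, shows that the Legendre polynomial has \<open>p\<close> roots inside the interval.\<close>

lemma rod_dvd: "a \<in> {-1, 1} \<Longrightarrow> k \<le> p \<Longrightarrow> [:-a, 1:] ^ (p - k) dvd (pderiv ^^ k) rod"
proof (induction k)
  case 0
  \<comment> \<open>As \<open>a^2 = 1\<close>, the same factorisation serves both end
    points.\<close>
  have "[:-1, 0, 1:] = [:-a, 1:] * [:a, 1 :: real:]" using 0 by auto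
  then have "rod = [:-a, 1:] ^ p * [:a, 1:] ^ p" by (simp only: power_mult_distrib)
  then have "[:-a, 1:] ^ p dvd rod" by (rule dvdI)
  then show ?case by (simp only: funpow_0 minus_nat.diff_0)
next
  case (Suc k)
  then have "[:-a, 1:] ^ Suc (p - Suc k) dvd (pderiv ^^ k) rod" by (simp add: Suc_diff_Suc)
  then show ?case using pderiv_dvd_power by simp
qed

text \<open>As long as \<open>k < p\<close>, the end points are also roots of the
  \<open>k\<close>-th derivative; with \<open>k\<close> inner roots this makes \<open>k + 2\<close>,
  and Rolle leaves \<open>k + 1\<close> inner roots of the next derivative.\<close>

lemma rod_roots: "k \<le> p \<Longrightarrow> \<exists>Z. finite Z \<and> card Z = k \<and> Z \<subseteq> {-1<..<1} \<and> (\<forall>z\<in>Z. poly ((pderiv ^^ k) rod) z = 0)"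
proof (induction k)
  case (Suc k)
  then obtain Z where Z: "finite Z" "card Z = k" "Z \<subseteq> {-1<..<1}" "\<forall>z\<in>Z. poly ((pderiv ^^ k) rod) z = 0" by auto
  have ends: "poly ((pderiv ^^ k) rod) a = 0" if "a \<in> {-1, 1}" for a
  proof -
    have "[:-a, 1:] dvd [:-a, 1:] ^ (p - k)" using Suc.prems by (intro dvd_power) simp
    also have "\<dots> dvd (pderiv ^^ k) rod" using rod_dvd[OF that, of k] Suc.prems by simp
    finally show ?thesis by (simp add: poly_eq_0_iff_dvd)
  qed
  let ?Z = "insert (-1) (insert 1 Z)"
  have "\<exists>Z'. finite Z' \<and> card Z' = card ?Z - 1 \<and> Z' \<subseteq> {Min ?Z<..<Max ?Z} \<and> (\<forall>z\<in>Z'. poly (pderiv ((pderiv ^^ k) rod)) z = 0)"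
    by (rule Rolle_poly_roots) (use Z ends in auto)
  then obtain Z' where Z': "finite Z'" "card Z' = card ?Z - 1" "Z' \<subseteq> {Min ?Z<..<Max ?Z}"
    "\<forall>z\<in>Z'. poly (pderiv ((pderiv ^^ k) rod)) z = 0" by blast
  have "-1 \<notin> Z" "1 \<notin> Z" using Z(3) by auto
  then have "card ?Z = k + 2" using Z by simp
  moreover have "Min ?Z = -1" using Z(1,3) by (intro Min_eqI) force+
  moreover have "Max ?Z = 1" using Z(1,3) by (intro Max_eqI) force+
  ultimately show ?case using Z' by (intro exI[of _ Z']) simp
qed (intro exI[of _ "{}"], simp)

lemma degree_rod: "degree ((pderiv ^^ k) rod) = 2 * p - k"
proof (induction k)
  case 0
  then show ?case by (simp add: degree_power_eq)
next
  case (Suc k)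
  then show ?case by (simp add: degree_pderiv)
qed

text \<open>Rolle once more gives \<open>p - 1\<close> roots of the derivative between the
  \<open>p\<close> roots of the Legendre polynomial, and its degree allows no others. Unisolvence
  rests on this exact count.\<close>

lemma gauss_lobatto_interior:
  assumes p: "p \<ge> 1"
  shows "finite {t. poly (pderiv (legendre p)) t = 0}" "card {t. poly (pderiv (legendre p)) t = 0} = p - 1"
    "{t. poly (pderiv (legendre p)) t = 0} \<subseteq> {-1<..<1}"
proof -
  let ?R = "{t. poly (pderiv (legendre p)) t = 0}"
  define c :: real where "c = 1 / (2 ^ p * fact p)"
  have c: "c \<noteq> 0" by (simp add: c_def)
  have leg: "legendre p = smult c ((pderiv ^^ p) rod)" by (simp add: legendre_def c_def)
  have deg: "degree (legendre p) = p" using c degree_rod[of p] by (simp add: leg)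
  then have ne: "pderiv (legendre p) \<noteq> 0" using p by (auto simp: pderiv_eq_0_iff)
  have fin: "finite ?R" by (rule poly_roots_finite[OF ne])
  have "card ?R \<le> p - 1" using card_poly_roots_bound[OF ne] deg by (simp add: degree_pderiv)
  obtain Z where Z: "finite Z" "card Z = p" "Z \<subseteq> {-1<..<1}" "\<forall>z\<in>Z. poly ((pderiv ^^ p) rod) z = 0"
    using rod_roots[of p] by blast
  have Zne: "Z \<noteq> {}" using Z(2) p by (intro notI) simp
  have "\<And>z. z \<in> Z \<Longrightarrow> poly (legendre p) z = 0" unfolding leg using Z(4) by simp
  note leg_roots = this
  obtain Z' where Z': "finite Z'" "card Z' = p - 1" "Z' \<subseteq> {Min Z<..<Max Z}" "\<forall>z\<in>Z'. poly (pderiv (legendre p)) z = 0"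
    using Rolle_poly_roots[OF Z(1) Zne leg_roots] unfolding Z(2) by blast
  have "Z' \<subseteq> ?R" using Z'(4) by blast
  then have ZR: "Z' = ?R" by (rule card_seteq[OF fin]) (simp only: Z'(2) \<open>card ?R \<le> p - 1\<close>)
  have "Min Z \<in> Z" "Max Z \<in> Z" using Z(1) Zne by (rule Min_in, rule Max_in)
  then have "Min Z \<in> {-1<..<1}" "Max Z \<in> {-1<..<1}" using Z(3) by blast+
  then have "{Min Z<..<Max Z} \<subseteq> {-1<..<1}" by force
  then show "?R \<subseteq> {-1<..<1}" using Z'(3) unfolding ZR by (rule order_trans[rotated])
  show "finite ?R" by (rule fin)
  show "card ?R = p - 1" using Z'(2) unfolding ZR .
qed

lemma gauss_lobatto_card:
  assumes p: "p \<ge> 1"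
  shows "finite (gauss_lobatto p)" "card (gauss_lobatto p) = p + 1"
proof -
  show "finite (gauss_lobatto p)" unfolding gauss_lobatto_def using gauss_lobatto_interior(1)[OF p] by simp
  have "-1 \<notin> {t. poly (pderiv (legendre p)) t = 0}" "1 \<notin> {t. poly (pderiv (legendre p)) t = 0}"
    using gauss_lobatto_interior(3)[OF p] by force+
  then have "card (insert (-1) (insert 1 {t. poly (pderiv (legendre p)) t = 0})) = p - 1 + 2"
    using gauss_lobatto_interior(1,2)[OF p] by simp
  then show "card (gauss_lobatto p) = p + 1" using p by (simp add: gauss_lobatto_def)
qed

lemma gauss_lobatto_bounds: "p \<ge> 1 \<Longrightarrow> gauss_lobatto p \<subseteq> {-1..1}"
  using gauss_lobatto_interior(3) by (force simp: gauss_lobatto_def)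

end

section \<open>Univariate Lagrange polynomials\<close>

definition lagrange_basis :: "real set \<Rightarrow> real \<Rightarrow> real poly" where
  "lagrange_basis G x = (\<Prod>y\<in>G - {x}. smult (1 / (x - y)) [:-y, 1:])"

lemma poly_lagrange_basis:
  assumes "finite G" "x \<in> G" "y \<in> G"
  shows "poly (lagrange_basis G x) y = (if x = y then 1 else 0)"
proof (cases "x = y")
  case True
  have "poly (lagrange_basis G x) x = (\<Prod>y\<in>G - {x}. 1)"
    unfolding lagrange_basis_def poly_prod by (intro prod.cong refl) (auto simp: divide_simps)
  then show ?thesis using True by simp
next
  case False
  then have "poly (lagrange_basis G x) y = 0"
    unfolding lagrange_basis_def poly_prod using assms by (intro prod_zero) (auto intro!: bexI[of _ y])
  then show ?thesis using False by simp
qed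

lemma degree_lagrange_basis:
  assumes "finite G" "x \<in> G"
  shows "degree (lagrange_basis G x) \<le> card G - 1"
proof -
  have "degree (lagrange_basis G x) \<le> (\<Sum>y\<in>G - {x}. (degree \<circ> (\<lambda>y. smult (1 / (x - y)) [:-y, 1:])) y)"
    unfolding lagrange_basis_def using assms by (intro degree_prod_sum_le) auto
  also have "\<dots> \<le> (\<Sum>y\<in>G - {x}. 1)" by (intro sum_mono) (auto intro: order_trans[OF degree_smult_le])
  finally show ?thesis using assms by simp
qed

section \<open>Abstract subspace correction\<close>

text \<open>Finite element functions are plain functions, so the space is a set \<open>W\<close> and
  \<open>A\<close> is an inner product only there. Linearity in the second argument follows from
  symmetry. Finite dimension enters through spanning families.\<close>

locale spd_space =
  fixes W :: "('a \<Rightarrow> real) set" and A :: "('a \<Rightarrow> real) \<Rightarrow> ('a \<Rightarrow> real) \<Rightarrow> real"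
  assumes zero_in: "(\<lambda>x. 0) \<in> W"
    and comb_in: "\<And>u v a b. u \<in> W \<Longrightarrow> v \<in> W \<Longrightarrow> (\<lambda>x. a * u x + b * v x) \<in> W"
    and comb_left: "\<And>u v w a b. u \<in> W \<Longrightarrow> v \<in> W \<Longrightarrow> w \<in> W \<Longrightarrow>
          A (\<lambda>x. a * u x + b * v x) w = a * A u w + b * A v w"
    and sym: "\<And>u v. u \<in> W \<Longrightarrow> v \<in> W \<Longrightarrow> A u v = A v u"
    and pos: "\<And>u. u \<in> W \<Longrightarrow> u \<noteq> (\<lambda>x. 0) \<Longrightarrow> A u u > 0"
begin

definition nrm :: "('a \<Rightarrow> real) \<Rightarrow> real" where "nrm u = sqrt (A u u)"

lemma add_in: "u \<in> W \<Longrightarrow> v \<in> W \<Longrightarrow> (\<lambda>x. u x + v x) \<in> W"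
  using comb_in[of u v 1 1] by simp

lemma diff_in: "u \<in> W \<Longrightarrow> v \<in> W \<Longrightarrow> (\<lambda>x. u x - v x) \<in> W"
  using comb_in[of u v 1 "-1"] by simp

lemma scale_in: "u \<in> W \<Longrightarrow> (\<lambda>x. a * u x) \<in> W"
  using comb_in[of u u a 0] by simp

lemma sum_in:
  assumes "\<And>i. i \<in> I \<Longrightarrow> f i \<in> W"
  shows "(\<lambda>x. \<Sum>i\<in>I. f i x) \<in> W"
proof (cases "finite I")
  case True
  then show ?thesis using assms
    by (induction I) (auto simp: zero_in intro!: add_in)
qed (simp add: zero_in)

lemma add_left: "u \<in> W \<Longrightarrow> v \<in> W \<Longrightarrow> w \<in> W \<Longrightarrow> A (\<lambda>x. u x + v x) w = A u w + A v w"
  using comb_left[of u v w 1 1] by simp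

lemma diff_left: "u \<in> W \<Longrightarrow> v \<in> W \<Longrightarrow> w \<in> W \<Longrightarrow> A (\<lambda>x. u x - v x) w = A u w - A v w"
  using comb_left[of u v w 1 "-1"] by simp

lemma scale_left: "u \<in> W \<Longrightarrow> w \<in> W \<Longrightarrow> A (\<lambda>x. a * u x) w = a * A u w"
  using comb_left[of u u w a 0] by simp

lemma zero_left: "w \<in> W \<Longrightarrow> A (\<lambda>x. 0) w = 0"
  using scale_left[of w w 0] by simp

lemma sum_left:
  assumes "\<And>i. i \<in> I \<Longrightarrow> f i \<in> W" "w \<in> W"
  shows "A (\<lambda>x. \<Sum>i\<in>I. f i x) w = (\<Sum>i\<in>I. A (f i) w)"
proof (cases "finite I")
  case True
  then show ?thesis using assms
    by (induction I) (auto simp: zero_left add_left sum_in)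
qed (simp add: zero_left assms)

lemma add_right: "u \<in> W \<Longrightarrow> v \<in> W \<Longrightarrow> w \<in> W \<Longrightarrow> A w (\<lambda>x. u x + v x) = A w u + A w v"
  by (simp add: sym[of w] add_left add_in)

lemma diff_right: "u \<in> W \<Longrightarrow> v \<in> W \<Longrightarrow> w \<in> W \<Longrightarrow> A w (\<lambda>x. u x - v x) = A w u - A w v"
  by (simp add: sym[of w] diff_left diff_in)

lemma scale_right: "u \<in> W \<Longrightarrow> w \<in> W \<Longrightarrow> A w (\<lambda>x. a * u x) = a * A w u"
  by (simp add: sym[of w] scale_left scale_in)

lemma zero_right: "w \<in> W \<Longrightarrow> A w (\<lambda>x. 0) = 0"
  by (simp add: sym[of w] zero_left zero_in)

lemma sum_right:
  assumes "\<And>i. i \<in> I \<Longrightarrow> f i \<in> W" "w \<in> W"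
  shows "A w (\<lambda>x. \<Sum>i\<in>I. f i x) = (\<Sum>i\<in>I. A w (f i))"
  using assms by (simp add: sym[of w] sum_left sum_in)

lemma nonneg: "u \<in> W \<Longrightarrow> 0 \<le> A u u"
  using pos[of u] zero_left[of "\<lambda>x. 0"] zero_in by (cases "u = (\<lambda>x. 0)") auto

lemma nrm_ge_0: "u \<in> W \<Longrightarrow> 0 \<le> nrm u"
  by (simp add: nrm_def nonneg)

lemma nrm_sq: "u \<in> W \<Longrightarrow> (nrm u)\<^sup>2 = A u u"
  by (simp add: nrm_def nonneg)

lemma nrm_zero: "nrm (\<lambda>x. 0) = 0"
  by (simp add: nrm_def zero_left zero_in)

lemma nrm_pos: "u \<in> W \<Longrightarrow> u \<noteq> (\<lambda>x. 0) \<Longrightarrow> 0 < nrm u"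
  by (simp add: nrm_def pos)

lemma nrm_scale: "u \<in> W \<Longrightarrow> nrm (\<lambda>x. a * u x) = \<bar>a\<bar> * nrm u"
  by (simp add: nrm_def scale_left scale_right scale_in real_sqrt_mult flip: power2_eq_square mult.assoc)

text \<open>The difference is tested with itself. The subspace \<open>S\<close> is there because a
  projection is known only through test functions of its own local space.\<close>

lemma eq_of_form_eq:
  assumes "S \<subseteq> W" "u \<in> S" "v \<in> S" "\<And>u v. u \<in> S \<Longrightarrow> v \<in> S \<Longrightarrow> (\<lambda>x. u x - v x) \<in> S"
    and "\<And>y. y \<in> S \<Longrightarrow> A u y = A v y"
  shows "u = v"
proof (rule ccontr)
  assume "u \<noteq> v"
  let ?d = "\<lambda>x. u x - v x"
  have "?d \<in> S" using assms by blast
  then have d: "?d \<in> S" "?d \<in> W" "u \<in> W" "v \<in> W" using assms by auto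
  have "?d \<noteq> (\<lambda>x. 0)" using \<open>u \<noteq> v\<close> by (auto simp: fun_eq_iff)
  then have "A ?d ?d > 0" using pos d by blast
  moreover have "A ?d ?d = 0" using d assms(5)[OF d(1)] by (simp add: diff_left)
  ultimately show False by simp
qed

lemma nrm_diff_sq:
  assumes "u \<in> W" "v \<in> W"
  shows "(nrm (\<lambda>x. u x - v x))\<^sup>2 = (nrm u)\<^sup>2 - 2 * A u v + (nrm v)\<^sup>2"
  using assms by (simp add: nrm_sq diff_in diff_left diff_right sym[of v u])

lemma Cauchy_Schwarz:
  assumes "u \<in> W" "v \<in> W"
  shows "\<bar>A u v\<bar> \<le> nrm u * nrm v"
proof (cases "v = (\<lambda>x. 0)")
  case True
  then show ?thesis using assms by (simp add: zero_right nrm_zero)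
next
  case False
  then have p: "A v v > 0" using pos assms by blast
  define t where "t = A u v / A v v"
  have "0 \<le> (nrm (\<lambda>x. u x - t * v x))\<^sup>2" by simp
  also have "\<dots> = A u u - 2 * (t * A u v) + t * (t * A v v)"
    using assms scale_in[OF assms(2), of t]
    by (simp add: nrm_diff_sq nrm_sq scale_left scale_right)
  also have "\<dots> = A u u - (A u v)\<^sup>2 / A v v"
    using p by (simp add: t_def power2_eq_square)
  finally have "(A u v)\<^sup>2 \<le> A u u * A v v" using p by (simp add: field_simps)
  then have "sqrt ((A u v)\<^sup>2) \<le> sqrt (A u u * A v v)" by (rule real_sqrt_le_mono)
  then show ?thesis by (simp add: nrm_def real_sqrt_mult)
qed

lemma Cauchy_Schwarz': "u \<in> W \<Longrightarrow> v \<in> W \<Longrightarrow> A u v \<le> nrm u * nrm v"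
  using Cauchy_Schwarz[of u v] by linarith

lemma triangle:
  assumes "u \<in> W" "v \<in> W"
  shows "nrm (\<lambda>x. u x + v x) \<le> nrm u + nrm v"
proof (rule power2_le_imp_le)
  have "(nrm (\<lambda>x. u x + v x))\<^sup>2 = (nrm u)\<^sup>2 + 2 * A u v + (nrm v)\<^sup>2"
    using assms by (simp add: nrm_sq add_in add_left add_right sym[of v u])
  also have "\<dots> \<le> (nrm u + nrm v)\<^sup>2"
    using Cauchy_Schwarz'[OF assms] by (simp add: power2_sum)
  finally show "(nrm (\<lambda>x. u x + v x))\<^sup>2 \<le> (nrm u + nrm v)\<^sup>2" .
qed (use assms nrm_ge_0 in auto)

end

section \<open>Finite spans and Riesz representation\<close>

definition lin_span :: "'i set \<Rightarrow> ('i \<Rightarrow> 'a \<Rightarrow> real) \<Rightarrow> ('a \<Rightarrow> real) set" where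
  "lin_span B \<phi> = {(\<lambda>x. \<Sum>b\<in>B. a b * \<phi> b x) |a. True}"

lemma lin_spanI: "(\<lambda>x. \<Sum>b\<in>B. a b * \<phi> b x) \<in> lin_span B \<phi>"
  by (auto simp: lin_span_def)

lemma lin_span_comb:
  assumes "u \<in> lin_span B \<phi>" "v \<in> lin_span B \<phi>"
  shows "(\<lambda>x. a * u x + b * v x) \<in> lin_span B \<phi>"
proof -
  obtain f g where fg: "u = (\<lambda>x. \<Sum>b\<in>B. f b * \<phi> b x)" "v = (\<lambda>x. \<Sum>b\<in>B. g b * \<phi> b x)"
    using assms by (auto simp: lin_span_def)
  show ?thesis unfolding lin_span_def fg
    by (intro CollectI exI[of _ "\<lambda>i. a * f i + b * g i"])
       (simp add: fun_eq_iff sum_distrib_left sum.distrib algebra_simps)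
qed

lemma lin_span_diff: "u \<in> lin_span B \<phi> \<Longrightarrow> v \<in> lin_span B \<phi> \<Longrightarrow> (\<lambda>x. u x - v x) \<in> lin_span B \<phi>"
  using lin_span_comb[of u B \<phi> v 1 "-1"] by simp

lemma lin_span_insert:
  assumes "finite B" "b \<notin> B"
  shows "lin_span (insert b B) \<phi> = {(\<lambda>x. y x + s * \<phi> b x) |y s. y \<in> lin_span B \<phi>}"
proof (intro equalityI subsetI)
  fix u assume "u \<in> lin_span (insert b B) \<phi>"
  then obtain f where "u = (\<lambda>x. \<Sum>i\<in>insert b B. f i * \<phi> i x)" by (auto simp: lin_span_def)
  then have "u = (\<lambda>x. (\<Sum>i\<in>B. f i * \<phi> i x) + f b * \<phi> b x)" using assms by (simp add: algebra_simps)
  then show "u \<in> {(\<lambda>x. y x + s * \<phi> b x) |y s. y \<in> lin_span B \<phi>}"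
    by (intro CollectI exI[of _ "\<lambda>x. \<Sum>i\<in>B. f i * \<phi> i x"] exI[of _ "f b"]) (simp add: lin_spanI)
next
  fix u assume "u \<in> {(\<lambda>x. y x + s * \<phi> b x) |y s. y \<in> lin_span B \<phi>}"
  then obtain f s where u: "u = (\<lambda>x. (\<Sum>i\<in>B. f i * \<phi> i x) + s * \<phi> b x)"
    by (auto simp: lin_span_def)
  have "(\<Sum>i\<in>B. (f(b := s)) i * \<phi> i x) = (\<Sum>i\<in>B. f i * \<phi> i x)" for x
    using assms by (intro sum.cong) auto
  then have "u = (\<lambda>x. \<Sum>i\<in>insert b B. (f(b := s)) i * \<phi> i x)" using assms u by (simp add: algebra_simps)
  then show "u \<in> lin_span (insert b B) \<phi>" unfolding lin_span_def by blast
qed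

context spd_space
begin

lemma lin_span_subset: "(\<And>b. b \<in> B \<Longrightarrow> \<phi> b \<in> W) \<Longrightarrow> lin_span B \<phi> \<subseteq> W"
  by (auto simp: lin_span_def intro!: sum_in scale_in)

text \<open>Gram-Schmidt by induction on \<open>B\<close>: the representer for \<open>B\<close> is
  corrected by a multiple of the part of \<open>\<phi> b\<close> that is orthogonal to the old span.
  The family may be linearly dependent.\<close>

lemma Riesz_ex:
  assumes "finite B" "\<And>b. b \<in> B \<Longrightarrow> \<phi> b \<in> W"
    and "\<And>u v a b. u \<in> W \<Longrightarrow> v \<in> W \<Longrightarrow> F (\<lambda>x. a * u x + b * v x) = a * F u + b * F v"
  shows "\<exists>w\<in>lin_span B \<phi>. \<forall>y\<in>lin_span B \<phi>. A w y = F y"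
  using assms
proof (induction B arbitrary: F)
  case empty
  have "F (\<lambda>x. 0) = 0" using empty(2)[of "\<lambda>x. 0" "\<lambda>x. 0" 0 0] zero_in by simp
  then show ?case by (auto simp: lin_span_def zero_left zero_in)
next
  case (insert b B)
  note F = insert.prems(2)
  have sub: "lin_span B \<phi> \<subseteq> W" using insert by (intro lin_span_subset) auto
  have bW: "\<phi> b \<in> W" using insert by auto
  obtain w where w: "w \<in> lin_span B \<phi>" "\<And>y. y \<in> lin_span B \<phi> \<Longrightarrow> A w y = F y"
    using insert.IH[of F] insert.prems by auto
  \<comment> \<open>The induction hypothesis for the functional given by \<open>\<phi> b\<close>
    provides its orthogonal projection \<open>p\<close> onto the old span.\<close>
  have "\<exists>w\<in>lin_span B \<phi>. \<forall>y\<in>lin_span B \<phi>. A w y = (\<lambda>y. A y (\<phi> b)) y"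
    using insert.prems bW by (intro insert.IH) (auto simp: comb_left)
  then obtain p where p: "p \<in> lin_span B \<phi>" "\<And>y. y \<in> lin_span B \<phi> \<Longrightarrow> A p y = A (\<phi> b) y"
    using sub bW by (metis subsetD sym)
  define e where "e = (\<lambda>x. \<phi> b x - p x)"
  have eW: "e \<in> W" using p sub bW by (auto simp: e_def intro: diff_in)
  have wW: "w \<in> W" using w sub by blast
  have e0: "A e y = 0" if "y \<in> lin_span B \<phi>" for y
    unfolding e_def using that sub p(1) p(2)[OF that] bW by (subst diff_left) auto
  \<comment> \<open>If \<open>\<phi> b\<close> adds nothing to the span, \<open>e\<close> is 0 and
    division by zero gives \<open>t = 0\<close>; this is right because then
    \<open>F e = 0\<close>.\<close>
  define t where "t = F e / A e e"
  define w' where "w' = (\<lambda>x. w x + t * e x)"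
  have sp: "lin_span (insert b B) \<phi> = {(\<lambda>x. y x + s * \<phi> b x) |y s. y \<in> lin_span B \<phi>}"
    using insert by (intro lin_span_insert)
  have w'eq: "w' = (\<lambda>x. (1 * w x + (- t) * p x) + t * \<phi> b x)" by (auto simp: w'_def e_def algebra_simps)
  have "w' \<in> lin_span (insert b B) \<phi>" unfolding sp
    unfolding w'eq by (intro CollectI exI conjI) (rule refl, rule lin_span_comb[OF w(1) p(1)])
  moreover have "A w' y = F y" if y: "y \<in> lin_span (insert b B) \<phi>" for y
  proof -
    obtain y0 s where y0: "y0 \<in> lin_span B \<phi>" "y = (\<lambda>x. y0 x + s * \<phi> b x)" using y sp by auto
    define z where "z = (\<lambda>x. 1 * y0 x + s * p x)"
    have z: "z \<in> lin_span B \<phi>" unfolding z_def by (rule lin_span_comb[OF y0(1) p(1)])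
    have zW: "z \<in> W" using z sub by blast
    have yz: "y = (\<lambda>x. 1 * z x + s * e x)" by (auto simp: y0 z_def e_def algebra_simps)
    have "F e = t * A e e"
    proof (cases "e = (\<lambda>x. 0)")
      case True
      then show ?thesis using F[OF zero_in zero_in, of 0 0] zero_left[OF zero_in] by simp
    qed (use pos eW in \<open>force simp: t_def\<close>)
    then have "A w' y = A w z + s * t * A e e"
      unfolding w'_def yz using eW zW wW e0[OF z] e0[OF w(1)] sym[OF eW wW]
      by (simp add: add_left add_right scale_left scale_right add_in scale_in)
    also have "\<dots> = F y" unfolding yz using F[OF zW eW, of 1 s] w(2)[OF z] \<open>F e = t * A e e\<close> by simp
    finally show ?thesis .
  qed
  ultimately show ?case by blast
qed

text \<open>Existence with uniqueness is what gives the definite descriptions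
  \<open>local_proj\<close> and \<open>restr\<close> their meaning.\<close>

lemma Riesz:
  assumes "finite B" "\<And>b. b \<in> B \<Longrightarrow> \<phi> b \<in> W"
    and "\<And>u v a b. u \<in> W \<Longrightarrow> v \<in> W \<Longrightarrow> F (\<lambda>x. a * u x + b * v x) = a * F u + b * F v"
  shows "\<exists>!w. w \<in> lin_span B \<phi> \<and> (\<forall>y\<in>lin_span B \<phi>. A w y = F y)"
proof -
  obtain w where w: "w \<in> lin_span B \<phi>" "\<forall>y\<in>lin_span B \<phi>. A w y = F y"
    using Riesz_ex[of B \<phi> F] assms by blast
  show ?thesis
  proof (rule ex1I[of _ w], use w in blast)
    fix v assume "v \<in> lin_span B \<phi> \<and> (\<forall>y\<in>lin_span B \<phi>. A v y = F y)"
    moreover have "lin_span B \<phi> \<subseteq> W" using assms(2) by (rule lin_span_subset)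
    ultimately show "v = w" using w
      by (intro eq_of_form_eq[of "lin_span B \<phi>" v w]) (auto intro: lin_span_diff)
  qed
qed

end

text \<open>Cauchy-Schwarz over the related pairs: every index occurs in at most \<open>N\<close> of
  them on either side, which gives the factor \<open>sqrt N\<close> twice.\<close>

lemma sum_relation_Cauchy_Schwarz:
  fixes f g :: "nat \<Rightarrow> real" and N :: nat
  assumes rows: "\<And>i. i < n \<Longrightarrow> card {j. j < n \<and> r i j} \<le> N"
    and cols: "\<And>j. j < n \<Longrightarrow> card {i. i < n \<and> r i j} \<le> N"
  shows "(\<Sum>j<n. \<Sum>i | i < n \<and> r i j. f i * g j) \<le> real N * (sqrt (\<Sum>i<n. (f i)\<^sup>2) * sqrt (\<Sum>j<n. (g j)\<^sup>2))"
proof -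
  define R where "R = (SIGMA j:{..<n}. {i. i < n \<and> r i j})"
  have [simp]: "finite R" by (auto simp: R_def)
  let ?F = "\<Sum>i<n. (f i)\<^sup>2" and ?G = "\<Sum>j<n. (g j)\<^sup>2"
  have "(\<Sum>j<n. \<Sum>i | i < n \<and> r i j. f i * g j) = (\<Sum>p\<in>R. f (snd p) * g (fst p))"
    unfolding R_def by (subst sum.Sigma) (auto simp: case_prod_beta)
  also have "\<dots> \<le> sqrt ((\<Sum>p\<in>R. f (snd p) * g (fst p))\<^sup>2)" by simp
  also have "\<dots> \<le> sqrt ((\<Sum>p\<in>R. (f (snd p))\<^sup>2) * (\<Sum>p\<in>R. (g (fst p))\<^sup>2))"
    by (intro real_sqrt_le_mono Cauchy_Schwarz_ineq_sum)
  also have "\<dots> \<le> sqrt ((real N * ?F) * (real N * ?G))"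
  proof (intro real_sqrt_le_mono mult_mono)
    have "(\<Sum>p\<in>R. (g (fst p))\<^sup>2) = (\<Sum>j<n. \<Sum>i | i < n \<and> r i j. (g j)\<^sup>2)"
      unfolding R_def by (subst sum.Sigma) (auto simp: case_prod_beta)
    also have "\<dots> = (\<Sum>j<n. real (card {i. i < n \<and> r i j}) * (g j)\<^sup>2)" by simp
    also have "\<dots> \<le> (\<Sum>j<n. real N * (g j)\<^sup>2)"
      by (intro sum_mono mult_right_mono) (use cols in auto)
    finally show "(\<Sum>p\<in>R. (g (fst p))\<^sup>2) \<le> real N * ?G" by (simp add: sum_distrib_left)
    have "(\<Sum>p\<in>R. (f (snd p))\<^sup>2) = (\<Sum>j<n. \<Sum>i<n. if r i j then (f i)\<^sup>2 else 0)"
    proof -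
      have "(\<Sum>p\<in>R. (f (snd p))\<^sup>2) = (\<Sum>j<n. \<Sum>i | i < n \<and> r i j. (f i)\<^sup>2)"
        unfolding R_def by (subst sum.Sigma) (auto simp: case_prod_beta)
      also have "\<dots> = (\<Sum>j<n. \<Sum>i<n. if r i j then (f i)\<^sup>2 else 0)"
        by (auto simp: sum.If_cases intro!: sum.cong)
      finally show ?thesis .
    qed
    \<comment> \<open>Swapping the sums counts the pairs by \<open>i\<close>, where
      \<open>rows\<close> applies.\<close>
    also have "\<dots> = (\<Sum>i<n. \<Sum>j<n. if r i j then (f i)\<^sup>2 else 0)" by (rule sum.swap)
    also have "\<dots> = (\<Sum>i<n. real (card {j. j < n \<and> r i j}) * (f i)\<^sup>2)"
      by (intro sum.cong refl, subst sum.inter_filter[symmetric]) auto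
    also have "\<dots> \<le> (\<Sum>i<n. real N * (f i)\<^sup>2)"
      by (intro sum_mono mult_right_mono) (use rows in auto)
    finally show "(\<Sum>p\<in>R. (f (snd p))\<^sup>2) \<le> real N * ?F" by (simp add: sum_distrib_left)
  qed (auto intro!: sum_nonneg mult_nonneg_nonneg)
  also have "\<dots> = real N * (sqrt ?F * sqrt ?G)"
    by (simp add: real_sqrt_mult)
  finally show ?thesis .
qed

text \<open>Here \<open>U\<close> is the energy norm of \<open>u\<close>, \<open>a\<close> and
  \<open>b\<close> measure what the coarse step and the sweep remove, \<open>s1\<close> and
  \<open>s2\<close> are the coarse and the patch part of a stable decomposition. Bounding
  \<open>s1\<close> and \<open>s2\<close> by \<open>U\<close> permits division by \<open>U\<close>;
  Cauchy-Schwarz in the plane then separates \<open>a\<close> and \<open>b\<close>.\<close>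

lemma contraction_arith:
  fixes U a b s1 s2 C N D :: real
  assumes "U\<^sup>2 \<le> a * (C * s1) + a\<^sup>2 + N * (b * s2)" and "0 \<le> a" "0 \<le> b" "0 \<le> s1" "0 \<le> s2" "C > 0"
    and "s1\<^sup>2 \<le> D * U\<^sup>2" "s2\<^sup>2 \<le> D * U\<^sup>2" "a \<le> U" "N \<ge> 4" "D \<ge> 1 / (2 * N)"
  shows "U\<^sup>2 \<le> ((2 * N\<^sup>2 + 1) * (1 + C\<^sup>2) * D) * (a\<^sup>2 + b\<^sup>2)"
proof -
  define d where "d = sqrt D"
  have "D > 0" using assms(10,11) by (smt (verit) divide_pos_pos)
  then have d: "d > 0" "d\<^sup>2 = D" by (auto simp: d_def)
  have U: "U \<ge> 0" using assms by linarith
  have s1: "s1 \<le> d * U" and s2: "s2 \<le> d * U"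
    using assms(7,8) d U power2_le_imp_le[of s1 "d * U"] power2_le_imp_le[of s2 "d * U"]
    by (simp_all add: power_mult_distrib)
  have "U\<^sup>2 \<le> a * (C * (d * U)) + a * U + N * (b * (d * U))"
  proof -
    \<comment> \<open>In \<open>a * a\<close> one factor is traded for \<open>U\<close>, so that
      every term carries a factor \<open>U\<close>.\<close>
    have "a * (C * s1) \<le> a * (C * (d * U))" "N * (b * s2) \<le> N * (b * (d * U))" "a * a \<le> a * U"
      using s1 s2 assms(2,3,6,9,10) by (simp_all add: mult_left_mono)
    then show ?thesis using assms(1) by (simp add: power2_eq_square)
  qed
  also have "\<dots> = U * (a * (1 + C * d) + b * (N * d))" by (simp add: algebra_simps)
  finally have *: "U * U \<le> U * (a * (1 + C * d) + b * (N * d))" by (simp add: power2_eq_square)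
  have "U \<le> a * (1 + C * d) + b * (N * d)"
  proof (cases "U = 0")
    case True then show ?thesis using assms d by simp
  next
    case False then show ?thesis using * U by simp
  qed
  then have "U\<^sup>2 \<le> (a * (1 + C * d) + b * (N * d))\<^sup>2" using U by (rule power_mono)
  also have "\<dots> \<le> (a\<^sup>2 + b\<^sup>2) * ((1 + C * d)\<^sup>2 + (N * d)\<^sup>2)"
  proof -
    have "(a\<^sup>2 + b\<^sup>2) * (x\<^sup>2 + y\<^sup>2) - (a * x + b * y)\<^sup>2 = (a * y - b * x)\<^sup>2" for x y
      by (simp add: power2_eq_square algebra_simps)
    then show ?thesis by (metis diff_ge_0_iff_ge zero_le_power2)
  qed
  also have "\<dots> \<le> (a\<^sup>2 + b\<^sup>2) * ((2 * N\<^sup>2 + 1) * (1 + C\<^sup>2) * D)"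
  proof (rule mult_left_mono)
    have "2 * (C * d) \<le> 1 + (C * d)\<^sup>2" using sum_squares_ge_zero[of "C * d - 1" 0]
      by (simp add: power2_eq_square algebra_simps)
    then have "(1 + C * d)\<^sup>2 + (N * d)\<^sup>2 \<le> 2 + 2 * C\<^sup>2 * D + N\<^sup>2 * D"
      by (simp add: power2_sum power_mult_distrib d mult.commute[of D])
    \<comment> \<open>The constant left from \<open>(1 + C * d)^2\<close> is absorbed here: the
      lower bound on \<open>D\<close> makes the right side at least \<open>N / 2\<close>, and
      \<open>N \<ge> 4\<close> makes that at least 2.\<close>
    moreover have "2 \<le> N\<^sup>2 * D"
    proof -
      have "2 \<le> N / 2" using assms by simp
      also have "\<dots> = N\<^sup>2 * (1 / (2 * N))" using assms by (simp add: power2_eq_square)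
      also have "\<dots> \<le> N\<^sup>2 * D" using assms by (intro mult_left_mono) auto
      finally show ?thesis .
    qed
    moreover have "2 * C\<^sup>2 * D \<le> 2 * N\<^sup>2 * (C\<^sup>2 * D)"
    proof -
      have "1 * (C\<^sup>2 * D) \<le> N\<^sup>2 * (C\<^sup>2 * D)"
        using assms(10) \<open>D > 0\<close> by (intro mult_right_mono one_le_power) auto
      then show ?thesis by simp
    qed
    moreover have "0 \<le> C\<^sup>2 * D" using \<open>D > 0\<close> by simp
    moreover have "(2 * N\<^sup>2 + 1) * (1 + C\<^sup>2) * D = 2 * (N\<^sup>2 * D) + D + 2 * N\<^sup>2 * (C\<^sup>2 * D) + C\<^sup>2 * D"
      by (simp add: algebra_simps)
    ultimately show "(1 + C * d)\<^sup>2 + (N * d)\<^sup>2 \<le> (2 * N\<^sup>2 + 1) * (1 + C\<^sup>2) * D"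
      using \<open>D > 0\<close> by linarith
  qed auto
  finally show ?thesis by (simp add: mult.commute)
qed

text \<open>\<open>Ac\<close> is a form of its own, not \<open>A\<close> restricted to the range of
  \<open>I\<close>; \<open>I_bound\<close> relates the energies and \<open>R_adj\<close> the
  operators. So the coarse correction is no projection, while every \<open>P z\<close> is an
  orthogonal one.\<close>

locale two_level = fine: spd_space W A + coarse: spd_space Wc Ac
  for W :: "('a \<Rightarrow> real) set" and A and Wc :: "('b \<Rightarrow> real) set" and Ac +
  fixes I :: "('b \<Rightarrow> real) \<Rightarrow> 'a \<Rightarrow> real" and R :: "('a \<Rightarrow> real) \<Rightarrow> 'b \<Rightarrow> real"
    and P :: "'z \<Rightarrow> ('a \<Rightarrow> real) \<Rightarrow> 'a \<Rightarrow> real" and Wz :: "'z \<Rightarrow> ('a \<Rightarrow> real) set"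
    and zs :: "'z list" and C :: real
  assumes C_pos: "C > 0"
    and I_in: "\<And>v. v \<in> Wc \<Longrightarrow> I v \<in> W"
    and I_comb: "\<And>u v a b. u \<in> Wc \<Longrightarrow> v \<in> Wc \<Longrightarrow> I (\<lambda>x. a * u x + b * v x) = (\<lambda>x. a * I u x + b * I v x)"
    and I_bound: "\<And>v. v \<in> Wc \<Longrightarrow> fine.nrm (I v) \<le> C * coarse.nrm v"
    and R_in: "\<And>u. u \<in> W \<Longrightarrow> R u \<in> Wc"
    and R_adj: "\<And>u z. u \<in> W \<Longrightarrow> z \<in> Wc \<Longrightarrow> Ac (R u) z = A u (I z)"
    and distinct_zs: "distinct zs"
    and Wz_sub: "\<And>z. z \<in> set zs \<Longrightarrow> Wz z \<subseteq> W"
    and Wz_comb: "\<And>z u v a b. z \<in> set zs \<Longrightarrow> u \<in> Wz z \<Longrightarrow> v \<in> Wz z \<Longrightarrow> (\<lambda>x. a * u x + b * v x) \<in> Wz z"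
    and P_in: "\<And>z u. z \<in> set zs \<Longrightarrow> u \<in> W \<Longrightarrow> P z u \<in> Wz z"
    and P_orth: "\<And>z u y. z \<in> set zs \<Longrightarrow> u \<in> W \<Longrightarrow> y \<in> Wz z \<Longrightarrow> A (P z u) y = A u y"
begin

abbreviation "step \<equiv> \<lambda>z w x. w x - P z w x"

definition S :: "('a \<Rightarrow> real) \<Rightarrow> 'a \<Rightarrow> real" where "S u = fold step zs u"

definition partial_sweep :: "nat \<Rightarrow> ('a \<Rightarrow> real) \<Rightarrow> 'a \<Rightarrow> real" where "partial_sweep j u = fold step (take j zs) u"

abbreviation "g u j \<equiv> P (zs ! j) (partial_sweep j u)"

lemma P_inW: "z \<in> set zs \<Longrightarrow> u \<in> W \<Longrightarrow> P z u \<in> W"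
  using P_in Wz_sub by blast

text \<open>Linearity is inherited from the functional that \<open>R u\<close> represents, by
  uniqueness of the representer.\<close>

lemma R_comb:
  assumes "u \<in> W" "v \<in> W"
  shows "R (\<lambda>x. a * u x + b * v x) = (\<lambda>x. a * R u x + b * R v x)"
proof (rule coarse.eq_of_form_eq[of Wc])
  show "R (\<lambda>x. a * u x + b * v x) \<in> Wc" "(\<lambda>x. a * R u x + b * R v x) \<in> Wc"
    by (intro R_in fine.comb_in coarse.comb_in assms)+
  show "Ac (R (\<lambda>x. a * u x + b * v x)) y = Ac (\<lambda>x. a * R u x + b * R v x) y" if "y \<in> Wc" for y
    using that assms R_adj[OF fine.comb_in[OF assms] that]
    by (simp add: R_adj coarse.comb_left R_in fine.comb_left I_in)
qed (auto intro: coarse.diff_in)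

lemma P_comb:
  assumes z: "z \<in> set zs" and "u \<in> W" "v \<in> W"
  shows "P z (\<lambda>x. a * u x + b * v x) = (\<lambda>x. a * P z u x + b * P z v x)"
proof (rule fine.eq_of_form_eq[of "Wz z"])
  show "P z (\<lambda>x. a * u x + b * v x) \<in> Wz z" "(\<lambda>x. a * P z u x + b * P z v x) \<in> Wz z"
    by (intro P_in z fine.comb_in Wz_comb assms)+
  show "A (P z (\<lambda>x. a * u x + b * v x)) y = A (\<lambda>x. a * P z u x + b * P z v x) y" if "y \<in> Wz z" for y
    using that assms Wz_sub[OF z] P_orth[OF z fine.comb_in[OF assms(2,3)] that]
    by (subst fine.comb_left) (auto simp: P_orth fine.comb_left P_inW)
  show "(\<lambda>x. u x - v x) \<in> Wz z" if "u \<in> Wz z" "v \<in> Wz z" for u v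
    using Wz_comb[OF z that, of 1 "-1"] by simp
qed (use Wz_sub z in auto)

lemma fold_in: "set ys \<subseteq> set zs \<Longrightarrow> u \<in> W \<Longrightarrow> fold step ys u \<in> W"
proof (induction ys arbitrary: u)
  case (Cons y ys)
  then show ?case by (auto intro!: Cons.IH fine.diff_in P_inW)
qed simp

lemma S_in: "u \<in> W \<Longrightarrow> S u \<in> W"
  unfolding S_def by (rule fold_in) auto

lemma fold_comb:
  "set ys \<subseteq> set zs \<Longrightarrow> u \<in> W \<Longrightarrow> v \<in> W \<Longrightarrow>
    fold step ys (\<lambda>x. a * u x + b * v x) = (\<lambda>x. a * fold step ys u x + b * fold step ys v x)"
proof (induction ys arbitrary: u v)
  case (Cons y ys)
  have "step y (\<lambda>x. a * u x + b * v x) = (\<lambda>x. a * step y u x + b * step y v x)"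
    using Cons.prems by (simp add: P_comb algebra_simps)
  then show ?case
    using Cons.prems Cons.IH[of "step y u" "step y v"]
    by (simp add: fine.diff_in P_inW)
qed simp

lemma S_comb: "u \<in> W \<Longrightarrow> v \<in> W \<Longrightarrow> S (\<lambda>x. a * u x + b * v x) = (\<lambda>x. a * S u x + b * S v x)"
  unfolding S_def by (rule fold_comb) auto

lemma partial_sweep_in: "u \<in> W \<Longrightarrow> partial_sweep j u \<in> W"
  unfolding partial_sweep_def by (rule fold_in) (auto dest: in_set_takeD)

lemma partial_sweep_0: "partial_sweep 0 u = u" by (simp add: partial_sweep_def)

lemma partial_sweep_Suc: "j < length zs \<Longrightarrow> partial_sweep (Suc j) u = (\<lambda>x. partial_sweep j u x - g u j x)"
  by (simp add: partial_sweep_def take_Suc_conv_app_nth)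

lemma g_in: "u \<in> W \<Longrightarrow> j < length zs \<Longrightarrow> g u j \<in> W"
  by (simp add: P_inW partial_sweep_in)

lemma partial_sweep_sum: "j \<le> length zs \<Longrightarrow> partial_sweep j u = (\<lambda>x. u x - (\<Sum>i<j. g u i x))"
proof (induction j)
  case (Suc j)
  then have "partial_sweep j u = (\<lambda>x. u x - (\<Sum>i<j. g u i x))" by simp
  then have "partial_sweep j u x = u x - (\<Sum>i<j. g u i x)" for x by (rule fun_cong)
  then show ?case using Suc by (auto simp: partial_sweep_Suc)
qed (simp add: partial_sweep_0)

text \<open>Pythagoras: each correction is orthogonal to the error that it leaves behind.\<close>

lemma partial_sweep_energy:
  assumes "u \<in> W"
  shows "j \<le> length zs \<Longrightarrow> (fine.nrm (partial_sweep j u))\<^sup>2 = (fine.nrm u)\<^sup>2 - (\<Sum>i<j. (fine.nrm (g u i))\<^sup>2)"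
proof (induction j)
  case (Suc j)
  then have j: "j < length zs" by simp
  have "A (partial_sweep j u) (g u j) = A (g u j) (g u j)"
    using fine.sym[OF partial_sweep_in[OF assms] g_in[OF assms j], of j]
      P_orth[OF nth_mem[OF j] partial_sweep_in[OF assms] P_in[OF nth_mem[OF j] partial_sweep_in[OF assms]], of j j] by simp
  then show ?case using Suc j assms
    by (simp add: partial_sweep_Suc fine.nrm_diff_sq partial_sweep_in g_in fine.nrm_sq)
qed (simp add: partial_sweep_0)

lemma S_energy:
  "u \<in> W \<Longrightarrow> (fine.nrm (S u))\<^sup>2 = (fine.nrm u)\<^sup>2 - (\<Sum>i<length zs. (fine.nrm (g u i))\<^sup>2)"
  using partial_sweep_energy[of u "length zs"] by (simp add: partial_sweep_def S_def)

lemma S_nonexpansive: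
  assumes "u \<in> W"
  shows "fine.nrm (S u) \<le> fine.nrm u"
proof (rule power2_le_imp_le)
  show "(fine.nrm (S u))\<^sup>2 \<le> (fine.nrm u)\<^sup>2"
    using S_energy[OF assms] by (simp add: sum_nonneg)
qed (simp add: fine.nrm_ge_0 assms)

text \<open>The adjoint of \<open>I\<close> inherits its bound; test \<open>R u\<close> with
  itself.\<close>

lemma R_bound:
  assumes "u \<in> W"
  shows "coarse.nrm (R u) \<le> C * fine.nrm u"
proof -
  have "coarse.nrm (R u) * coarse.nrm (R u) = Ac (R u) (R u)"
    using coarse.nrm_sq[OF R_in[OF assms]] by (simp add: power2_eq_square)
  also have "\<dots> = A u (I (R u))" by (simp add: R_adj assms R_in)
  also have "\<dots> \<le> fine.nrm u * fine.nrm (I (R u))" by (intro fine.Cauchy_Schwarz' assms I_in R_in)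
  also have "\<dots> \<le> fine.nrm u * (C * coarse.nrm (R u))"
    by (intro mult_left_mono I_bound R_in assms fine.nrm_ge_0)
  finally have "coarse.nrm (R u) * coarse.nrm (R u) \<le> coarse.nrm (R u) * (C * fine.nrm u)"
    by (simp add: mult_ac)
  then show ?thesis
    using coarse.nrm_ge_0[OF R_in[OF assms]] fine.nrm_ge_0[OF assms] C_pos
    by (cases "coarse.nrm (R u) = 0") auto
qed

definition T0 :: "('a \<Rightarrow> real) \<Rightarrow> 'a \<Rightarrow> real" where "T0 u = (\<lambda>x. I (R u) x / C\<^sup>2)"

lemma T0_alt: "T0 u = (\<lambda>x. inverse (C\<^sup>2) * I (R u) x)"
  by (simp add: T0_def divide_inverse mult.commute)

lemma T0_in: "u \<in> W \<Longrightarrow> T0 u \<in> W"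
  unfolding T0_alt by (intro fine.scale_in I_in R_in)

text \<open>In this form symmetry and semidefiniteness of \<open>T0\<close> can be read off.\<close>

lemma T0_form:
  assumes "u \<in> W" "v \<in> W"
  shows "A (T0 u) v = Ac (R u) (R v) / C\<^sup>2"
proof -
  have "A (I (R u)) v = Ac (R v) (R u)" using assms
    by (subst fine.sym) (auto simp: R_adj I_in R_in)
  also have "\<dots> = Ac (R u) (R v)" using assms by (simp add: coarse.sym R_in)
  finally show ?thesis unfolding T0_alt using assms
    by (simp add: fine.scale_left I_in R_in divide_inverse)
qed

definition E :: "('a \<Rightarrow> real) \<Rightarrow> 'a \<Rightarrow> real" where "E u = S (\<lambda>x. u x - T0 u x)"

text \<open>With \<open>a = coarse.nrm (R u) / C\<close>, the mixed term \<open>A u (T0 u)\<close>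
  is exactly \<open>a^2\<close> and the square of the norm of \<open>T0 u\<close> at most
  \<open>a^2\<close>; expanding the square leaves at most \<open>- 2 * a^2 + a^2\<close>.\<close>

lemma T0_energy:
  assumes "u \<in> W"
  shows "(fine.nrm (\<lambda>x. u x - T0 u x))\<^sup>2 \<le> (fine.nrm u)\<^sup>2 - (coarse.nrm (R u) / C)\<^sup>2"
proof -
  have Ru: "R u \<in> Wc" using assms by (rule R_in)
  have "A u (T0 u) = (coarse.nrm (R u) / C)\<^sup>2"
    using assms Ru by (simp add: fine.sym[of u] T0_in T0_form power_divide coarse.nrm_sq)
  moreover have "(fine.nrm (T0 u))\<^sup>2 \<le> (coarse.nrm (R u) / C)\<^sup>2"
  proof (rule power_mono)
    have "fine.nrm (T0 u) = inverse (C\<^sup>2) * fine.nrm (I (R u))"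
      unfolding T0_alt using Ru by (simp add: fine.nrm_scale I_in)
    also have "\<dots> \<le> inverse (C\<^sup>2) * (C * coarse.nrm (R u))"
      using Ru by (intro mult_left_mono I_bound) auto
    also have "\<dots> = coarse.nrm (R u) / C" using C_pos by (simp add: power2_eq_square field_simps)
    finally show "fine.nrm (T0 u) \<le> coarse.nrm (R u) / C" .
  qed (use assms T0_in fine.nrm_ge_0 in blast)
  ultimately show ?thesis using assms by (simp add: fine.nrm_diff_sq T0_in)
qed

lemma E_in: "u \<in> W \<Longrightarrow> E u \<in> W"
  unfolding E_def by (intro S_in fine.diff_in T0_in)

text \<open>\<open>R\<close> after \<open>I\<close> is symmetric, semidefinite and bounded by
  \<open>C^2\<close>, so this is the identity minus an operator between 0 and 1. It keeps the
  mismatch of the two forms out of the contraction constant.\<close>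

lemma coarse_damping:
  assumes "v \<in> Wc"
  shows "coarse.nrm (\<lambda>x. v x - inverse (C\<^sup>2) * R (I v) x) \<le> coarse.nrm v"
proof (rule power2_le_imp_le)
  have RI: "R (I v) \<in> Wc" using assms by (intro R_in I_in)
  define t where "t = inverse (C\<^sup>2)"
  have t: "t > 0" "t * C\<^sup>2 = 1" using C_pos by (auto simp: t_def)
  have a: "Ac v (R (I v)) = (fine.nrm (I v))\<^sup>2"
    using assms RI by (simp add: coarse.sym[of v] R_adj I_in fine.nrm_sq)
  have "(coarse.nrm (R (I v)))\<^sup>2 \<le> (C * fine.nrm (I v))\<^sup>2"
    using assms RI by (intro power_mono R_bound I_in coarse.nrm_ge_0)
  then have "t * (t * (coarse.nrm (R (I v)))\<^sup>2) \<le> t * (t * (C * fine.nrm (I v))\<^sup>2)"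
    using t by (intro mult_left_mono) auto
  also have "\<dots> = t * ((t * C\<^sup>2) * (fine.nrm (I v))\<^sup>2)" by (simp add: power_mult_distrib mult_ac)
  also have "\<dots> = t * (fine.nrm (I v))\<^sup>2" using t by simp
  finally have b: "t * (t * (coarse.nrm (R (I v)))\<^sup>2) \<le> t * (fine.nrm (I v))\<^sup>2" .
  have "(coarse.nrm (\<lambda>x. v x - t * R (I v) x))\<^sup>2
      = (coarse.nrm v)\<^sup>2 - 2 * (t * (fine.nrm (I v))\<^sup>2) + t * (t * (coarse.nrm (R (I v)))\<^sup>2)"
    using assms RI coarse.scale_in[OF RI, of t] t
    by (simp add: coarse.nrm_diff_sq coarse.scale_right a coarse.nrm_scale power_mult_distrib)
      (simp add: power2_eq_square)
  also have "\<dots> \<le> (coarse.nrm v)\<^sup>2"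
    using b mult_nonneg_nonneg[OF less_imp_le[OF t(1)] zero_le_power2[of "fine.nrm (I v)"]] by linarith
  finally show "(coarse.nrm (\<lambda>x. v x - inverse (C\<^sup>2) * R (I v) x))\<^sup>2 \<le> (coarse.nrm v)\<^sup>2"
    by (simp add: t_def)
qed (simp add: coarse.nrm_ge_0 assms)

text \<open>The defect against the exact solve is \<open>S (I (F (R u)))\<close> divided by
  \<open>C^2\<close>. Prolongation and restriction cost a factor \<open>C\<close> each, which the
  damping cancels, and the sweep costs nothing.\<close>

lemma inexact_coarse_solve:
  assumes u: "u \<in> W" and F: "F (R u) \<in> Wc" and Fn: "coarse.nrm (F (R u)) \<le> t * coarse.nrm (R u)" and "t \<ge> 0"
  shows "fine.nrm (S (\<lambda>x. u x - I (\<lambda>x. R u x - F (R u) x) x / C\<^sup>2)) \<le> fine.nrm (E u) + t * fine.nrm u"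
proof -
  have Ru: "R u \<in> Wc" using u by (rule R_in)
  let ?f = "I (F (R u))"
  have f: "?f \<in> W" using F by (rule I_in)
  have "I (\<lambda>x. R u x - F (R u) x) = (\<lambda>x. I (R u) x - ?f x)"
    using I_comb[OF Ru F, of 1 "-1"] by simp
  then have Ieq: "I (\<lambda>x. R u x - F (R u) x) x = I (R u) x - ?f x" for x by simp
  have "(\<lambda>x. u x - I (\<lambda>x. R u x - F (R u) x) x / C\<^sup>2) = (\<lambda>x. 1 * (u x - T0 u x) + inverse (C\<^sup>2) * ?f x)"
    by (simp add: T0_def Ieq fun_eq_iff divide_inverse algebra_simps)
  then have "S (\<lambda>x. u x - I (\<lambda>x. R u x - F (R u) x) x / C\<^sup>2) = (\<lambda>x. E u x + inverse (C\<^sup>2) * S ?f x)"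
    using S_comb[OF fine.diff_in[OF u T0_in[OF u]] f, of 1 "inverse (C\<^sup>2)"] by (simp add: E_def)
  then have "fine.nrm (S (\<lambda>x. u x - I (\<lambda>x. R u x - F (R u) x) x / C\<^sup>2))
      \<le> fine.nrm (E u) + fine.nrm (\<lambda>x. inverse (C\<^sup>2) * S ?f x)"
    using u f by (simp add: fine.triangle E_in S_in fine.scale_in)
  also have "fine.nrm (\<lambda>x. inverse (C\<^sup>2) * S ?f x) = inverse (C\<^sup>2) * fine.nrm (S ?f)"
    using f by (simp add: fine.nrm_scale S_in)
  also have "\<dots> \<le> inverse (C\<^sup>2) * (C * (t * (C * fine.nrm u)))"
  proof (rule mult_left_mono)
    have "fine.nrm (S ?f) \<le> fine.nrm ?f" using f by (rule S_nonexpansive)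
    also have "\<dots> \<le> C * coarse.nrm (F (R u))" using F by (rule I_bound)
    also have "\<dots> \<le> C * (t * (C * fine.nrm u))"
      using Fn mult_left_mono[OF R_bound[OF u] \<open>t \<ge> 0\<close>] C_pos by (intro mult_left_mono) auto
    finally show "fine.nrm (S ?f) \<le> C * (t * (C * fine.nrm u))" .
  qed auto
  also have "\<dots> = t * fine.nrm u" using C_pos by (simp add: power2_eq_square field_simps)
  finally show ?thesis by simp
qed

end

text \<open>\<open>interact\<close> counts the patches that are not orthogonal to a given one.
  \<open>nontrivial\<close> is there because on the zero space \<open>decomp\<close> says nothing
  about the size of \<open>D\<close>.\<close>

locale stable_two_level = two_level W A Wc Ac I R P Wz zs C
  for W :: "('a \<Rightarrow> real) set" and A and Wc :: "('b \<Rightarrow> real) set" and Ac I R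
    and P :: "'z \<Rightarrow> ('a \<Rightarrow> real) \<Rightarrow> 'a \<Rightarrow> real" and Wz zs C +
  fixes N :: nat and D :: real
  assumes interact: "\<And>z. z \<in> set zs \<Longrightarrow> card {z'\<in>set zs. \<exists>u\<in>Wz z. \<exists>v\<in>Wz z'. A u v \<noteq> 0} \<le> N"
    and N_ge: "N \<ge> 4" and D_pos: "D > 0"
    and decomp: "\<And>u. u \<in> W \<Longrightarrow> \<exists>v0\<in>Wc. \<exists>w. (\<forall>z\<in>set zs. w z \<in> Wz z) \<and>
        u = (\<lambda>x. I v0 x + (\<Sum>z\<in>set zs. w z x)) \<and>
        (fine.nrm (I v0))\<^sup>2 + (\<Sum>z\<in>set zs. (fine.nrm (w z))\<^sup>2) \<le> D * (fine.nrm u)\<^sup>2 \<and>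
        (coarse.nrm v0)\<^sup>2 \<le> D * (fine.nrm u)\<^sup>2"
    and nontrivial: "\<exists>u\<in>W. u \<noteq> (\<lambda>x. 0)"
begin

definition rel :: "nat \<Rightarrow> nat \<Rightarrow> bool" where
  "rel i j \<longleftrightarrow> (\<exists>u\<in>Wz (zs ! i). \<exists>v\<in>Wz (zs ! j). A u v \<noteq> 0)"

lemma rel_sym: "i < length zs \<Longrightarrow> j < length zs \<Longrightarrow> rel i j = rel j i"
proof -
  have "rel j i" if "rel i j" "i < length zs" "j < length zs" for i j
    using that Wz_sub[of "zs ! i"] Wz_sub[of "zs ! j"] fine.sym unfolding rel_def
    by (metis nth_mem subsetD)
  then show "i < length zs \<Longrightarrow> j < length zs \<Longrightarrow> rel i j = rel j i" by blast
qed

lemma rel_card: "i < length zs \<Longrightarrow> card {j. j < length zs \<and> rel i j} \<le> N"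
proof -
  assume i: "i < length zs"
  have "card {j. j < length zs \<and> rel i j} = card ((!) zs ` {j. j < length zs \<and> rel i j})"
    by (intro card_image[symmetric]) (auto simp: inj_on_def nth_eq_iff_index_eq distinct_zs)
  also have "\<dots> \<le> card {z'\<in>set zs. \<exists>u\<in>Wz (zs ! i). \<exists>v\<in>Wz z'. A u v \<noteq> 0}"
    by (intro card_mono) (auto simp: rel_def)
  also have "\<dots> \<le> N" using i by (intro interact) auto
  finally show ?thesis .
qed

lemma rel_card': "j < length zs \<Longrightarrow> card {i. i < length zs \<and> rel i j} \<le> N"
  using rel_card[of j] rel_sym[of j] by (metis (mono_tags, lifting) Collect_cong)

text \<open>Unrelated pairs contribute nothing, and related pairs missing from \<open>J j\<close>
  may be added once Cauchy-Schwarz has made the terms nonnegative. The freedom in \<open>J\<close>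
  covers full double sums as well as the triangular ones of a sweep.\<close>

lemma sum_form_bound:
  assumes "\<And>i. i < length zs \<Longrightarrow> f i \<in> Wz (zs ! i)" "\<And>i. i < length zs \<Longrightarrow> h i \<in> Wz (zs ! i)"
    and J: "\<And>j. j < length zs \<Longrightarrow> J j \<subseteq> {..<length zs}"
  shows "(\<Sum>j<length zs. \<Sum>i\<in>J j. A (f i) (h j))
    \<le> real N * (sqrt (\<Sum>i<length zs. (fine.nrm (f i))\<^sup>2) * sqrt (\<Sum>i<length zs. (fine.nrm (h i))\<^sup>2))"
proof -
  let ?n = "length zs"
  have fW: "f i \<in> W" "h i \<in> W" if "i < ?n" for i using assms that Wz_sub nth_mem by blast+
  have "(\<Sum>j<?n. \<Sum>i\<in>J j. A (f i) (h j)) \<le> (\<Sum>j<?n. \<Sum>i | i < ?n \<and> rel i j. fine.nrm (f i) * fine.nrm (h j))"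
  proof (rule sum_mono)
    fix j assume "j \<in> {..<?n}"
    then have j: "j < ?n" by simp
    have fJ: "finite (J j)" using J[OF j] finite_subset by blast
    have "(\<Sum>i\<in>J j. A (f i) (h j)) = (\<Sum>i\<in>{i\<in>J j. rel i j}. A (f i) (h j))"
    proof (rule sum.mono_neutral_right[OF fJ])
      show "\<forall>i\<in>J j - {i \<in> J j. rel i j}. A (f i) (h j) = 0"
        using J[OF j] assms(1,2) j by (force simp: rel_def)
    qed auto
    also have "\<dots> \<le> (\<Sum>i\<in>{i\<in>J j. rel i j}. fine.nrm (f i) * fine.nrm (h j))"
      using J[OF j] j by (intro sum_mono fine.Cauchy_Schwarz' fW) auto
    also have "\<dots> \<le> (\<Sum>i | i < ?n \<and> rel i j. fine.nrm (f i) * fine.nrm (h j))"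
      using J[OF j] j by (intro sum_mono2 mult_nonneg_nonneg fine.nrm_ge_0 fW) auto
    finally show "(\<Sum>i\<in>J j. A (f i) (h j)) \<le> (\<Sum>i | i < ?n \<and> rel i j. fine.nrm (f i) * fine.nrm (h j))" .
  qed
  also have "\<dots> \<le> real N * (sqrt (\<Sum>i<?n. (fine.nrm (f i))\<^sup>2) * sqrt (\<Sum>i<?n. (fine.nrm (h i))\<^sup>2))"
    by (intro sum_relation_Cauchy_Schwarz rel_card rel_card')
  finally show ?thesis .
qed

text \<open>Indexed by the position in the sweep, so that components can be matched with partial
  sweeps.\<close>

definition decomposes :: "('a \<Rightarrow> real) \<Rightarrow> ('b \<Rightarrow> real) \<Rightarrow> (nat \<Rightarrow> 'a \<Rightarrow> real) \<Rightarrow> bool" where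
  "decomposes u v0 w \<longleftrightarrow> v0 \<in> Wc \<and> (\<forall>j<length zs. w j \<in> Wz (zs ! j)) \<and>
    u = (\<lambda>x. I v0 x + (\<Sum>j<length zs. w j x)) \<and>
    (fine.nrm (I v0))\<^sup>2 + (\<Sum>j<length zs. (fine.nrm (w j))\<^sup>2) \<le> D * (fine.nrm u)\<^sup>2 \<and>
    (coarse.nrm v0)\<^sup>2 \<le> D * (fine.nrm u)\<^sup>2"

lemma ex_decomposes:
  assumes "u \<in> W"
  shows "\<exists>v0 w. decomposes u v0 w"
proof -
  have bij: "bij_betw ((!) zs) {..<length zs} (set zs)" by (intro bij_betw_nth distinct_zs) auto
  have re: "(\<Sum>z\<in>set zs. f z) = (\<Sum>j<length zs. f (zs ! j))" for f :: "'z \<Rightarrow> real"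
    using sum.reindex_bij_betw[OF bij, of f] by simp
  show ?thesis using decomp[OF assms] unfolding re decomposes_def
  proof (elim bexE exE, goal_cases)
    case (1 v0 w)
    have "\<forall>j<length zs. w (zs ! j) \<in> Wz (zs ! j)" using conjunct1[OF 1(2)] by simp
    then show ?case
      by (intro exI[of _ v0] exI[of _ "\<lambda>j. w (zs ! j)"]) (rule conjI[OF 1(1) conjI[OF _ conjunct2[OF 1(2)]]])
  qed
qed

text \<open>The contraction estimate loses an additive constant, which is absorbed because a constant
  of a stable decomposition cannot be arbitrarily small.\<close>

lemma D_ge: "D \<ge> 1 / (2 * real N)"
proof -
  obtain u where u: "u \<in> W" "u \<noteq> (\<lambda>x. 0)" using nontrivial by blast
  obtain v0 w where D: "decomposes u v0 w" using ex_decomposes[OF u(1)] by blast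
  have d: "v0 \<in> Wc" "\<And>j. j < length zs \<Longrightarrow> w j \<in> Wz (zs ! j)"
    "u = (\<lambda>x. I v0 x + (\<Sum>j<length zs. w j x))"
    "(fine.nrm (I v0))\<^sup>2 + (\<Sum>j<length zs. (fine.nrm (w j))\<^sup>2) \<le> D * (fine.nrm u)\<^sup>2"
    "(coarse.nrm v0)\<^sup>2 \<le> D * (fine.nrm u)\<^sup>2"
    using D unfolding decomposes_def by blast+
  have wW: "w j \<in> W" if "j < length zs" for j using d(2) that Wz_sub nth_mem by blast
  let ?v = "I v0" and ?s = "\<lambda>x. \<Sum>j<length zs. w j x"
  let ?n = "\<Sum>j<length zs. (fine.nrm (w j))\<^sup>2"
  have vW: "?v \<in> W" and sW: "?s \<in> W" using d wW by (auto intro!: I_in fine.sum_in)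
  have n0: "?n \<ge> 0" by (simp add: sum_nonneg)
  have "(fine.nrm ?s)\<^sup>2 = (\<Sum>j<length zs. \<Sum>i<length zs. A (w i) (w j))"
    using wW fine.sum_right[of "{..<length zs}" w ?s] fine.sum_left[of "{..<length zs}" w]
    by (simp add: fine.nrm_sq sW)
  also have "\<dots> \<le> real N * (sqrt ?n * sqrt ?n)"
    using d(2) by (intro sum_form_bound) auto
  finally have s: "(fine.nrm ?s)\<^sup>2 \<le> real N * ?n" using n0 by simp
  have "(fine.nrm u)\<^sup>2 \<le> (fine.nrm ?v + fine.nrm ?s)\<^sup>2"
    unfolding d(3) using vW sW by (intro power_mono fine.triangle) (auto intro: fine.nrm_ge_0 fine.add_in)
  also have "\<dots> \<le> 2 * (fine.nrm ?v)\<^sup>2 + 2 * (fine.nrm ?s)\<^sup>2"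
    using sum_squares_ge_zero[of "fine.nrm ?v - fine.nrm ?s" 0] by (simp add: power2_eq_square algebra_simps)
  also have "\<dots> \<le> 2 * real N * ((fine.nrm ?v)\<^sup>2 + ?n)"
  proof -
    have "(fine.nrm ?v)\<^sup>2 \<le> real N * (fine.nrm ?v)\<^sup>2" using N_ge by (simp add: mult_le_cancel_right1)
    then show ?thesis using s by (simp add: algebra_simps)
  qed
  also have "\<dots> \<le> 2 * real N * (D * (fine.nrm u)\<^sup>2)" using d(4) by (intro mult_left_mono) auto
  finally have "1 * (fine.nrm u)\<^sup>2 \<le> (2 * real N * D) * (fine.nrm u)\<^sup>2" by (simp add: mult_ac)
  moreover have "(fine.nrm u)\<^sup>2 > 0" using fine.nrm_pos[OF u] by simp
  ultimately have "1 \<le> 2 * real N * D" by (meson mult_le_cancel_right_pos)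
  then show ?thesis using N_ge by (simp add: field_simps)
qed

text \<open>Pair \<open>u\<close> with its decomposition. A local component cannot distinguish the
  current error from its local projection, so every pairing can be expressed by corrections, that
  is, by what the two steps remove.\<close>

lemma energy_bound:
  assumes u: "u \<in> W"
  defines "w0 \<equiv> (\<lambda>x. u x - T0 u x)"
  shows "(fine.nrm u)\<^sup>2 \<le> ((2 * (real N)\<^sup>2 + 1) * (1 + C\<^sup>2) * D) *
    ((coarse.nrm (R u) / C)\<^sup>2 + (\<Sum>i<length zs. (fine.nrm (g w0 i))\<^sup>2))"
proof -
  let ?n = "length zs"
  obtain v0 w where D: "decomposes u v0 w" using ex_decomposes[OF u] by blast
  have d: "v0 \<in> Wc" "\<And>j. j < length zs \<Longrightarrow> w j \<in> Wz (zs ! j)"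
    "u = (\<lambda>x. I v0 x + (\<Sum>j<length zs. w j x))"
    "(fine.nrm (I v0))\<^sup>2 + (\<Sum>j<length zs. (fine.nrm (w j))\<^sup>2) \<le> D * (fine.nrm u)\<^sup>2"
    "(coarse.nrm v0)\<^sup>2 \<le> D * (fine.nrm u)\<^sup>2"
    using D unfolding decomposes_def by blast+
  have wW: "w j \<in> W" if "j < ?n" for j using d(2) that Wz_sub nth_mem by blast
  have w0: "w0 \<in> W" unfolding w0_def by (intro fine.diff_in u T0_in)
  have Ru: "R u \<in> Wc" by (intro R_in u)
  have TW: "T0 u \<in> W" by (intro T0_in u)
  have IW: "I v0 \<in> W" by (intro I_in d)
  let ?a = "coarse.nrm (R u) / C" and ?b = "sqrt (\<Sum>i<?n. (fine.nrm (g w0 i))\<^sup>2)"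
    and ?s = "sqrt (\<Sum>j<?n. (fine.nrm (w j))\<^sup>2)"
  have sW: "(\<lambda>x. \<Sum>j<?n. w j x) \<in> W" using wW by (intro fine.sum_in) auto
  have split: "A y u = A y (I v0) + (\<Sum>j<?n. A y (w j))" if "y \<in> W" for y
    using that IW sW wW fine.sum_right[of "{..<?n}" w y]
    by (subst d(3)) (simp add: fine.add_right)
  \<comment> \<open>\<open>u\<close> is split into \<open>T0 u\<close> and \<open>w0\<close>, and
    \<open>w0\<close> into the error before step \<open>j\<close> and the corrections made so far.
    The summand \<open>i = j\<close> stems from the projection of that error.\<close>
  have wj: "A u (w j) = A (T0 u) (w j) + (\<Sum>i\<in>{..j}. A (g w0 i) (w j))" if j: "j < ?n" for j
  proof -
    have gW: "g w0 i \<in> W" if "i < j" for i using g_in[OF w0] that j by simp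
    have w0eq: "w0 = (\<lambda>x. partial_sweep j w0 x + (\<Sum>i<j. g w0 i x))" using partial_sweep_sum[of j w0] j by (simp add: fun_eq_iff)
    have 1: "A u (w j) = A (T0 u) (w j) + A w0 (w j)" using u TW wW j
      unfolding w0_def by (simp add: fine.diff_left)
    have 2: "A w0 (w j) = A (partial_sweep j w0) (w j) + A (\<lambda>x. \<Sum>i<j. g w0 i x) (w j)"
      using gW fine.sum_in[of "{..<j}" "g w0"]
      by (subst w0eq, subst fine.add_left) (simp_all add: wW[OF j] partial_sweep_in[OF w0])
    have 3: "A (\<lambda>x. \<Sum>i<j. g w0 i x) (w j) = (\<Sum>i<j. A (g w0 i) (w j))"
      by (rule fine.sum_left) (use gW wW[OF j] in auto)
    have 4: "A (partial_sweep j w0) (w j) = A (g w0 j) (w j)"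
      using P_orth[OF nth_mem[OF j] partial_sweep_in[OF w0] d(2)[OF j], of j] by (rule HOL.sym)
    have 5: "{..j} = insert j {..<j}" by auto
    show ?thesis unfolding 5 by (subst sum.insert) (simp_all add: 1 2 3 4)
  qed
  have "(fine.nrm u)\<^sup>2 = A u (I v0) + (\<Sum>j<?n. A (T0 u) (w j)) + (\<Sum>j<?n. \<Sum>i\<in>{..j}. A (g w0 i) (w j))"
    using split[OF u] u by (simp add: fine.nrm_sq wj sum.distrib)
  \<comment> \<open>The coarse correction meets all patch components at once, so their sum is
    exchanged for \<open>u\<close> minus the coarse component.\<close>
  also have "(\<Sum>j<?n. A (T0 u) (w j)) = A (T0 u) u - A (T0 u) (I v0)"
    using split[OF TW] by simp
  also have "A (T0 u) u = ?a\<^sup>2"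
    using u Ru by (simp add: T0_form coarse.nrm_sq power_divide)
  \<comment> \<open>The terms with \<open>I v0\<close> merge into one pairing of \<open>R u\<close>
    with the damped image of \<open>v0\<close>, to which \<open>coarse_damping\<close>
    applies.\<close>
  also have "A u (I v0) + (?a\<^sup>2 - A (T0 u) (I v0)) = ?a\<^sup>2 + Ac (R u) (\<lambda>x. v0 x - inverse (C\<^sup>2) * R (I v0) x)"
    using u d(1) Ru IW by (simp add: T0_form R_adj[symmetric] coarse.diff_right coarse.scale_right coarse.scale_in R_in divide_inverse)
  also have "Ac (R u) (\<lambda>x. v0 x - inverse (C\<^sup>2) * R (I v0) x) \<le> coarse.nrm (R u) * coarse.nrm v0"
  proof -
    have "Ac (R u) (\<lambda>x. v0 x - inverse (C\<^sup>2) * R (I v0) x)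
        \<le> coarse.nrm (R u) * coarse.nrm (\<lambda>x. v0 x - inverse (C\<^sup>2) * R (I v0) x)"
      by (intro coarse.Cauchy_Schwarz' Ru coarse.diff_in coarse.scale_in R_in IW d)
    also have "\<dots> \<le> coarse.nrm (R u) * coarse.nrm v0"
      by (intro mult_left_mono coarse_damping d coarse.nrm_ge_0 Ru)
    finally show ?thesis .
  qed
  also have "coarse.nrm (R u) * coarse.nrm v0 = ?a * (C * coarse.nrm v0)" using C_pos by simp
  also have "(\<Sum>j<?n. \<Sum>i\<in>{..j}. A (g w0 i) (w j)) \<le> real N * (?b * ?s)"
    using d(2) partial_sweep_in[OF w0] by (intro sum_form_bound P_in) auto
  finally have main: "(fine.nrm u)\<^sup>2 \<le> ?a * (C * coarse.nrm v0) + ?a\<^sup>2 + real N * (?b * ?s)" by simp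
  have b: "?b\<^sup>2 = (\<Sum>i<?n. (fine.nrm (g w0 i))\<^sup>2)" by (simp add: sum_nonneg)
  have "(fine.nrm u)\<^sup>2 \<le> ((2 * (real N)\<^sup>2 + 1) * (1 + C\<^sup>2) * D) * (?a\<^sup>2 + ?b\<^sup>2)"
  proof (rule contraction_arith[OF main])
    show "?a \<le> fine.nrm u" using R_bound[OF u] C_pos by (simp add: field_simps)
    show "?s\<^sup>2 \<le> D * (fine.nrm u)\<^sup>2" 
    proof -
      have "?s\<^sup>2 = (\<Sum>j<?n. (fine.nrm (w j))\<^sup>2)" by (simp add: sum_nonneg)
      then show ?thesis using d(4) zero_le_power2[of "fine.nrm (I v0)"] by linarith
    qed
  qed (use C_pos N_ge D_ge d(5) coarse.nrm_ge_0[OF Ru] coarse.nrm_ge_0[OF d(1)] in \<open>simp_all add: sum_nonneg\<close>)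
  then show ?thesis unfolding b .
qed

theorem E_contraction:
  assumes u: "u \<in> W"
  shows "fine.nrm (E u) \<le> sqrt (1 - inverse ((2 * (real N)\<^sup>2 + 1) * (1 + C\<^sup>2) * D)) * fine.nrm u"
proof -
  define K where "K = (2 * (real N)\<^sup>2 + 1) * (1 + C\<^sup>2) * D"
  define w0 where "w0 = (\<lambda>x. u x - T0 u x)"
  have "K > 0" unfolding K_def using D_pos
    by (intro mult_pos_pos) (auto intro: add_nonneg_pos add_pos_nonneg)
  let ?t = "(coarse.nrm (R u) / C)\<^sup>2 + (\<Sum>i<length zs. (fine.nrm (g w0 i))\<^sup>2)"
  have w0: "w0 \<in> W" unfolding w0_def by (intro fine.diff_in u T0_in)
  have "(fine.nrm u)\<^sup>2 \<le> K * ?t" using energy_bound[OF u] by (simp add: K_def w0_def)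
  then have t: "inverse K * (fine.nrm u)\<^sup>2 \<le> ?t" using \<open>K > 0\<close> by (simp add: field_simps)
  have "(fine.nrm (E u))\<^sup>2 = (fine.nrm w0)\<^sup>2 - (\<Sum>i<length zs. (fine.nrm (g w0 i))\<^sup>2)"
    using S_energy[OF w0] by (simp add: E_def w0_def)
  also have "\<dots> \<le> (fine.nrm u)\<^sup>2 - ?t" using T0_energy[OF u] by (simp add: w0_def)
  also have "\<dots> \<le> (1 - inverse K) * (fine.nrm u)\<^sup>2" using t by (simp add: algebra_simps)
  finally have "sqrt ((fine.nrm (E u))\<^sup>2) \<le> sqrt ((1 - inverse K) * (fine.nrm u)\<^sup>2)"
    by (rule real_sqrt_le_mono)
  then show ?thesis
    using fine.nrm_ge_0[OF u] fine.nrm_ge_0[OF E_in[OF u]] by (simp add: real_sqrt_mult K_def)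
qed

end

section \<open>Finite element spaces and nodal bases\<close>

text \<open>The assumptions do not involve \<open>l\<close>, so the predicate takes only
  \<open>c\<close> and can be interpreted on two levels at once.\<close>

locale cutfem_grid =
  fixes c :: "('d::finite) cutfem" and l :: nat
  assumes open_dom: "open (dom c)" and bounded_dom: "bounded (dom c)" and edge0_pos: "edge0 c > 0"
    and deg_ge: "deg c \<ge> 1"
begin

abbreviation "h \<equiv> mesh_size c l"
abbreviation "GL \<equiv> gauss_lobatto (deg c)"

lemma h_pos: "h > 0"
  using edge0_pos by (simp add: mesh_size_def)

lemma vertex_nth: "vertex c l k $ i = origin c $ i + h * of_int (k $ i)"
  by (simp add: vertex_def)

lemma mem_cell: "x \<in> cell c l k \<longleftrightarrow>
    (\<forall>i. origin c $ i + h * of_int (k $ i) \<le> x $ i \<and> x $ i \<le> origin c $ i + h * (of_int (k $ i) + 1))"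
  by (simp add: cell_def mem_box_cart vertex_nth)

lemma mem_cell_scaled: "x \<in> cell c l k \<longleftrightarrow>
    (\<forall>i. of_int (k $ i) \<le> (x $ i - origin c $ i) / h \<and> (x $ i - origin c $ i) / h \<le> of_int (k $ i) + 1)"
  unfolding mem_cell using h_pos by (simp add: field_simps)

lemma cell_index_nth: "cell_index c l x $ i = \<lfloor>(x $ i - origin c $ i) / h\<rfloor>"
  by (simp add: cell_index_def)

lemma cell_index_mem: "x \<in> cell c l (cell_index c l x)"
  unfolding mem_cell_scaled cell_index_nth by (simp add: real_of_int_floor_add_one_ge)

lemma cell_index_active: "x \<in> dom c \<Longrightarrow> cell_index c l x \<in> active c l"
  using cell_index_mem by (auto simp: active_def)

lemma cell_index_cut: "x \<in> bdry c \<Longrightarrow> cell_index c l x \<in> cut c l"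
  using cell_index_mem by (auto simp: cut_def)

definition open_cell :: "int^'d \<Rightarrow> (real^'d) set" where
  "open_cell k = box (vertex c l k) (vertex c l (k + 1))"

lemma mem_open_cell: "x \<in> open_cell k \<longleftrightarrow>
    (\<forall>i. of_int (k $ i) < (x $ i - origin c $ i) / h \<and> (x $ i - origin c $ i) / h < of_int (k $ i) + 1)"
  unfolding open_cell_def mem_box_cart vertex_nth using h_pos by (simp add: field_simps)

lemma cell_index_open_cell: "x \<in> open_cell k \<Longrightarrow> cell_index c l x = k"
  unfolding mem_open_cell vec_eq_iff cell_index_nth by (intro allI impI floor_unique) (auto intro: less_imp_le)

lemma open_cell_nonempty: "open_cell k \<noteq> {}"
  unfolding open_cell_def interval_ne_empty_cart vertex_nth using h_pos by simp

lemma open_cell_subset: "open_cell k \<subseteq> cell c l k"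
  unfolding open_cell_def cell_def by (rule box_subset_cbox)

lemma open_open_cell: "open (open_cell k)"
  unfolding open_cell_def by (rule open_box)

lemma closure_open_cell: "closure (open_cell k) = cell c l k"
  using open_cell_nonempty[of k] unfolding open_cell_def cell_def by (rule closure_box)

text \<open>\<open>dom c\<close> is open and the cell is the closure of its open cell. So every
  active cell has a part of positive volume in the domain, however unfavourable the cut.\<close>

lemma active_open_cell: "k \<in> active c l \<Longrightarrow> open_cell k \<inter> dom c \<noteq> {}"
  using open_Int_closure_eq_empty[OF open_dom, of "open_cell k"] closure_open_cell[of k]
  by (auto simp: active_def)

lemma closed_cell: "closed (cell c l k)" and compact_cell: "compact (cell c l k)"
  unfolding cell_def by (rule closed_cbox, rule compact_cbox)

lemma finite_int_box: "finite {k :: int^'d. \<forall>i. \<bar>k $ i\<bar> \<le> B}"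
proof (rule finite_subset)
  show "{k :: int^'d. \<forall>i. \<bar>k $ i\<bar> \<le> B} \<subseteq> (\<lambda>f. \<chi> i. f i) ` PiE UNIV (\<lambda>_. {-B..B})"
  proof
    fix k :: "int^'d" assume "k \<in> {k. \<forall>i. \<bar>k $ i\<bar> \<le> B}"
    then have "(\<lambda>i. k $ i) \<in> PiE UNIV (\<lambda>_. {-B..B})" by (auto simp: abs_le_iff minus_le_iff)
    moreover have "k = (\<chi> i. k $ i)" by simp
    ultimately show "k \<in> (\<lambda>f. \<chi> i. f i) ` PiE UNIV (\<lambda>_. {-B..B})" by blast
  qed
qed (intro finite_imageI finite_PiE, auto)

lemma finite_active: "finite (active c l)"
proof -
  obtain R where R: "\<And>x. x \<in> dom c \<Longrightarrow> norm x \<le> R" using bounded_dom unfolding bounded_iff by blast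
  define B where "B = \<lceil>(R + norm (origin c)) / h\<rceil> + 1"
  have "active c l \<subseteq> {k. \<forall>i. \<bar>k $ i\<bar> \<le> B}"
  proof (clarsimp simp: active_def)
    fix k i assume "cell c l k \<inter> dom c \<noteq> {}"
    then obtain x where x: "x \<in> cell c l k" "x \<in> dom c" by blast
    have "\<bar>x $ i - origin c $ i\<bar> \<le> R + norm (origin c)"
      using component_le_norm_cart[of x i] component_le_norm_cart[of "origin c" i] R[OF x(2)] by linarith
    then have "\<bar>(x $ i - origin c $ i) / h\<bar> \<le> (R + norm (origin c)) / h"
      using h_pos by (simp add: abs_divide divide_right_mono)
    moreover have "of_int (k $ i) \<le> (x $ i - origin c $ i) / h" "(x $ i - origin c $ i) / h \<le> of_int (k $ i) + 1"
      using x(1) unfolding mem_cell_scaled by blast+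
    ultimately show "\<bar>k $ i\<bar> \<le> B" unfolding B_def by linarith
  qed
  then show ?thesis using finite_int_box finite_subset by blast
qed

lemma cell_subset_active_dom: "k \<in> active c l \<Longrightarrow> cell c l k \<subseteq> active_dom c l"
  by (auto simp: active_dom_def)

lemma closed_active_dom: "closed (active_dom c l)"
  unfolding active_dom_def using finite_active closed_cell by (intro closed_UN) auto

lemma dom_subset_active_dom: "dom c \<subseteq> active_dom c l"
  using cell_index_active cell_index_mem cell_subset_active_dom by blast

lemma closure_dom_subset: "closure (dom c) \<subseteq> active_dom c l"
  using dom_subset_active_dom closed_active_dom by (rule closure_minimal)

lemma V_continuous: "v \<in> V c l \<Longrightarrow> continuous_on (active_dom c l) v"
  by (simp add: V_def)

lemma V_outside: "v \<in> V c l \<Longrightarrow> x \<notin> active_dom c l \<Longrightarrow> v x = 0"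
  by (simp add: V_def)

lemma V_zero: "(\<lambda>x. 0) \<in> V c l"
  unfolding V_def using Qp_const[of 0 "deg c"] by force

lemma V_comb:
  assumes u: "u \<in> V c l" and v: "v \<in> V c l"
  shows "(\<lambda>x. a * u x + b * v x) \<in> V c l"
proof -
  have "\<exists>q\<in>Qp (deg c). \<forall>x\<in>cell c l k. a * u x + b * v x = q x" if k: "k \<in> active c l" for k
  proof -
    obtain q where q: "q \<in> Qp (deg c)" "\<And>x. x \<in> cell c l k \<Longrightarrow> u x = q x" using u k by (auto simp: V_def)
    obtain r where r: "r \<in> Qp (deg c)" "\<And>x. x \<in> cell c l k \<Longrightarrow> v x = r x" using v k by (auto simp: V_def)
    show ?thesis using q r by (intro bexI[OF _ Qp_comb[OF q(1) r(1), of a b]]) simp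
  qed
  moreover have "continuous_on (active_dom c l) (\<lambda>x. a * u x + b * v x)"
    by (intro continuous_intros V_continuous u v)
  ultimately show ?thesis using V_outside[OF u] V_outside[OF v] by (simp add: V_def)
qed

lemma V_sum:
  assumes "\<And>i. i \<in> I \<Longrightarrow> f i \<in> V c l"
  shows "(\<lambda>x. \<Sum>i\<in>I. a i * f i x) \<in> V c l"
proof (cases "finite I")
  case True
  then show ?thesis using assms
  proof (induction I)
    case (insert i I)
    then have "(\<lambda>x. a i * f i x + 1 * (\<Sum>i\<in>I. a i * f i x)) \<in> V c l" by (intro V_comb) auto
    then show ?case using insert.hyps by simp
  qed (simp add: V_zero)
qed (simp add: V_zero)

lemma Qp_eq_on_cell:
  assumes "q \<in> Qp (deg c)" "r \<in> Qp (deg c)" "\<And>x. x \<in> cell c l k \<Longrightarrow> q x = r x"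
  shows "q = r"
  using open_cell_nonempty[of k] open_cell_subset[of k] assms(3)
  by (intro Qp_eq_on_box[OF assms(1,2), of "vertex c l k" "vertex c l (k + 1)"]) (auto simp: open_cell_def)

lemma cell_poly_eqI:
  assumes "q \<in> Qp (deg c)" "\<And>x. x \<in> cell c l k \<Longrightarrow> v x = q x"
  shows "cell_poly c l k v = q"
  unfolding cell_poly_def
proof (rule the_equality)
  show "r = q" if r: "r \<in> Qp (deg c) \<and> (\<forall>x\<in>cell c l k. v x = r x)" for r
    using r assms by (intro Qp_eq_on_cell[of r q k]) auto
qed (use assms in simp)

lemma
  assumes v: "v \<in> V c l" and k: "k \<in> active c l"
  shows cell_poly_Qp: "cell_poly c l k v \<in> Qp (deg c)"
    and cell_poly_eq: "x \<in> cell c l k \<Longrightarrow> cell_poly c l k v x = v x"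
proof -
  obtain q where q: "q \<in> Qp (deg c)" "\<And>x. x \<in> cell c l k \<Longrightarrow> v x = q x" using v k by (auto simp: V_def)
  then have e: "cell_poly c l k v = q" by (rule cell_poly_eqI)
  show "cell_poly c l k v \<in> Qp (deg c)" "x \<in> cell c l k \<Longrightarrow> cell_poly c l k v x = v x"
    unfolding e using q by auto
qed

lemma cell_poly_comb:
  assumes u: "u \<in> V c l" and v: "v \<in> V c l" and k: "k \<in> active c l"
  shows "cell_poly c l k (\<lambda>x. a * u x + b * v x) = (\<lambda>x. a * cell_poly c l k u x + b * cell_poly c l k v x)"
  using cell_poly_eq[OF u k] cell_poly_eq[OF v k]
  by (intro cell_poly_eqI Qp_comb cell_poly_Qp u v k) simp

lemma V_eqI:
  assumes u: "u \<in> V c l" and v: "v \<in> V c l"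
    and eq: "\<And>k. k \<in> active c l \<Longrightarrow> cell_poly c l k u = cell_poly c l k v"
  shows "u = v"
proof
  fix x show "u x = v x"
  proof (cases "x \<in> active_dom c l")
    case True
    then obtain k where k: "k \<in> active c l" "x \<in> cell c l k" by (auto simp: active_dom_def)
    show ?thesis using cell_poly_eq[OF u k] cell_poly_eq[OF v k] eq[OF k(1)] by simp
  qed (simp add: V_outside u v)
qed

text \<open>The affine map of the reference interval [-1, 1] onto the \<open>m\<close>-th grid
  interval in direction \<open>i\<close>.\<close>

definition node_pos :: "'d \<Rightarrow> int \<Rightarrow> real \<Rightarrow> real" where
  "node_pos i m t = origin c $ i + h * of_int m + h * (t + 1) / 2"

lemma node_pos_inj: "node_pos i m s = node_pos i m t \<longleftrightarrow> s = t"
  using h_pos by (simp add: node_pos_def)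

lemma nodes_alt: "nodes c l = {(\<chi> i. node_pos i (k $ i) (t i)) |k t. k \<in> active c l \<and> (\<forall>i. t i \<in> GL)}"
proof -
  have "vertex c l k + (\<chi> i. h * (t i + 1) / 2) = (\<chi> i. node_pos i (k $ i) (t i))" for k and t :: "'d \<Rightarrow> real"
    by (simp add: vec_eq_iff vertex_nth node_pos_def)
  then show ?thesis unfolding nodes_def by simp
qed

lemma GL_card: "finite GL" "card GL = deg c + 1" and GL_bounds: "GL \<subseteq> {-1..1}" and GL_ends: "-1 \<in> GL" "1 \<in> GL"
  using gauss_lobatto_card[OF deg_ge] gauss_lobatto_bounds[OF deg_ge] by (auto simp: gauss_lobatto_def)

lemma finite_nodes: "finite (nodes c l)"
proof (rule finite_subset)
  show "nodes c l \<subseteq> (\<lambda>(k, t). \<chi> i. node_pos i (k $ i) (t i)) ` (active c l \<times> PiE UNIV (\<lambda>_. GL))"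
    unfolding nodes_alt by force
  show "finite ((\<lambda>(k, t). \<chi> i. node_pos i (k $ i) (t i)) ` (active c l \<times> PiE UNIV (\<lambda>_ :: 'd. GL)))"
    by (intro finite_imageI finite_cartesian_product finite_active finite_PiE GL_card) simp
qed

lemma node_in_cell:
  assumes "\<And>i. t i \<in> GL"
  shows "(\<chi> i. node_pos i (k $ i) (t i)) \<in> cell c l k"
proof -
  have t: "0 \<le> t i + 1" "t i + 1 \<le> 2" for i using assms[of i] GL_bounds by force+
  have "0 \<le> h * (t i + 1) / 2" for i using t(1)[of i] h_pos by simp
  moreover have "h * (t i + 1) / 2 \<le> h" for i using mult_left_mono[OF t(2)[of i], of h] h_pos by simp
  ultimately show ?thesis by (simp add: mem_cell node_pos_def distrib_left)
qed

lemma cell_poly_unisolvent: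
  assumes u: "u \<in> V c l" and v: "v \<in> V c l" and k: "k \<in> active c l"
    and eq: "\<And>y. y \<in> nodes c l \<Longrightarrow> y \<in> cell c l k \<Longrightarrow> u y = v y"
  shows "cell_poly c l k u = cell_poly c l k v"
proof (rule Qp_unisolvent_eq[OF cell_poly_Qp[OF u k] cell_poly_Qp[OF v k], of "\<lambda>i. node_pos i (k $ i) ` GL"])
  have "card (node_pos i (k $ i) ` GL) = deg c + 1" for i
    using GL_card by (simp add: card_image inj_on_def node_pos_inj)
  then show "infinite (node_pos i (k $ i) ` GL) \<or> deg c < card (node_pos i (k $ i) ` GL)" for i by simp
  fix x assume "\<And>i. x $ i \<in> node_pos i (k $ i) ` GL"
  then have "\<forall>i. \<exists>t. t \<in> GL \<and> x $ i = node_pos i (k $ i) t" by blast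
  then obtain t where t: "\<And>i. t i \<in> GL" "\<And>i. x $ i = node_pos i (k $ i) (t i)" by metis
  have x: "x = (\<chi> i. node_pos i (k $ i) (t i))" using t(2) by (simp add: vec_eq_iff)
  have "x \<in> nodes c l" unfolding nodes_alt x using k t(1) by blast
  moreover have "x \<in> cell c l k" unfolding x by (rule node_in_cell) (rule t(1))
  ultimately show "cell_poly c l k u x = cell_poly c l k v x"
    using eq cell_poly_eq[OF u k] cell_poly_eq[OF v k] by simp
qed

lemma V_unisolvent:
  assumes u: "u \<in> V c l" and v: "v \<in> V c l" and eq: "\<And>y. y \<in> nodes c l \<Longrightarrow> u y = v y"
  shows "u = v"
  by (rule V_eqI[OF u v]) (rule cell_poly_unisolvent[OF u v], use eq in auto)

text \<open>The one-dimensional shape function of position \<open>s\<close> on interval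
  \<open>m\<close>. The sum has at most one term, as \<open>node_pos\<close> is injective, and is 0
  if \<open>s\<close> is no node of the interval. The linear polynomial inverts
  \<open>node_pos\<close>.\<close>

definition line_poly :: "'d \<Rightarrow> int \<Rightarrow> real \<Rightarrow> real poly" where
  "line_poly i m s = (\<Sum>t | t \<in> GL \<and> node_pos i m t = s.
     pcompose (lagrange_basis GL t) [:- 2 * origin c $ i / h - 2 * of_int m - 1, 2 / h:])"

lemma poly_line_poly:
  assumes t: "t \<in> GL"
  shows "poly (line_poly i m s) (node_pos i m t) = (if node_pos i m t = s then 1 else 0)"
proof -
  have "poly [:- 2 * origin c $ i / h - 2 * of_int m - 1, 2 / h:] (node_pos i m t) = t"
    using h_pos by (simp add: node_pos_def field_simps)
  then have "poly (line_poly i m s) (node_pos i m t)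
      = (\<Sum>t' | t' \<in> GL \<and> node_pos i m t' = s. poly (lagrange_basis GL t') t)"
    by (simp add: line_poly_def poly_sum poly_pcompose)
  also have "\<dots> = (\<Sum>t' | t' \<in> GL \<and> node_pos i m t' = s. if t' = t then 1 else 0)"
    using t GL_card by (intro sum.cong refl) (simp add: poly_lagrange_basis)
  also have "\<dots> = (if node_pos i m t = s then 1 else 0)"
    using t GL_card by simp
  finally show ?thesis .
qed

lemma degree_line_poly: "degree (line_poly i m s) \<le> deg c"
  unfolding line_poly_def
proof (rule degree_sum_le)
  fix t assume t: "t \<in> {t. t \<in> GL \<and> node_pos i m t = s}"
  have "degree (pcompose (lagrange_basis GL t) [:- 2 * origin c $ i / h - 2 * of_int m - 1, 2 / h:])
      \<le> degree (lagrange_basis GL t) * degree [:- 2 * origin c $ i / h - 2 * of_int m - 1, 2 / h:]"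
    by (rule degree_pcompose_le)
  also have "\<dots> \<le> degree (lagrange_basis GL t) * 1" by (intro mult_left_mono) auto
  also have "\<dots> \<le> deg c" using degree_lagrange_basis[of GL t] t GL_card by simp
  finally show "degree (pcompose (lagrange_basis GL t) [:- 2 * origin c $ i / h - 2 * of_int m - 1, 2 / h:]) \<le> deg c" .
qed (simp add: GL_card)

text \<open>The nodes of adjacent intervals share the common end point, hence the piecewise
  polynomials fit together.\<close>

lemma line_poly_floor:
  assumes "of_int m \<le> (x - origin c $ i) / h" "(x - origin c $ i) / h \<le> of_int m + 1"
  shows "poly (line_poly i \<lfloor>(x - origin c $ i) / h\<rfloor> s) x = poly (line_poly i m s) x"
proof (cases "(x - origin c $ i) / h = of_int m + 1")
  case False
  then have "\<lfloor>(x - origin c $ i) / h\<rfloor> = m" using assms by (intro floor_unique) auto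
  then show ?thesis by simp
next
  case True
  then have f: "\<lfloor>(x - origin c $ i) / h\<rfloor> = m + 1" by simp
  have "x = origin c $ i + h * (of_int m + 1)" using True h_pos by (simp add: field_simps)
  then have x: "x = node_pos i (m + 1) (-1)" "x = node_pos i m 1" by (simp_all add: node_pos_def algebra_simps)
  show ?thesis unfolding f
    using poly_line_poly[OF GL_ends(1), of i "m + 1" s] poly_line_poly[OF GL_ends(2), of i m s] x by simp
qed

definition tensor_poly :: "real^'d \<Rightarrow> int^'d \<Rightarrow> real^'d \<Rightarrow> real" where
  "tensor_poly y k x = (\<Prod>i\<in>UNIV. poly (line_poly i (k $ i) (y $ i)) (x $ i))"

text \<open>At points of outer faces \<open>cell_index\<close> may name an inactive cell. This is
  harmless: the one-dimensional pieces exist on every interval and agree at shared end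
  points.\<close>

definition nodal_fun :: "real^'d \<Rightarrow> real^'d \<Rightarrow> real" where
  "nodal_fun y x = (if x \<in> active_dom c l then tensor_poly y (cell_index c l x) x else 0)"

lemma tensor_poly_Qp: "tensor_poly y k \<in> Qp (deg c)"
  unfolding tensor_poly_def[abs_def] by (intro Qp_tensor degree_line_poly)

lemma nodal_fun_cell:
  assumes k: "k \<in> active c l" and x: "x \<in> cell c l k"
  shows "nodal_fun y x = tensor_poly y k x"
proof -
  have "x \<in> active_dom c l" using k x cell_subset_active_dom by blast
  moreover have "tensor_poly y (cell_index c l x) x = tensor_poly y k x"
    unfolding tensor_poly_def cell_index_nth
    using x unfolding mem_cell_scaled by (intro prod.cong refl line_poly_floor) auto
  ultimately show ?thesis by (simp add: nodal_fun_def)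
qed

lemma nodal_fun_V: "nodal_fun y \<in> V c l"
proof -
  have "continuous_on (cell c l k) (nodal_fun y)" if k: "k \<in> active c l" for k
  proof (rule continuous_on_eq)
    show "continuous_on (cell c l k) (tensor_poly y k)"
      by (intro real_polynomial_function_continuous_on Qp_real_polynomial_function[OF tensor_poly_Qp])
  qed (simp add: nodal_fun_cell[OF k])
  then have "continuous_on (active_dom c l) (nodal_fun y)"
    unfolding active_dom_def by (intro continuous_on_closed_Union finite_active closed_cell)
  moreover have "\<exists>q\<in>Qp (deg c). \<forall>x\<in>cell c l k. nodal_fun y x = q x" if k: "k \<in> active c l" for k
    using nodal_fun_cell[OF k] by (intro bexI[OF _ tensor_poly_Qp]) auto
  moreover have "\<forall>x. x \<notin> active_dom c l \<longrightarrow> nodal_fun y x = 0" by (simp add: nodal_fun_def)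
  ultimately show ?thesis by (simp add: V_def)
qed

lemma nodal_fun_node:
  assumes "x \<in> nodes c l"
  shows "nodal_fun y x = (if x = y then 1 else 0)"
proof -
  obtain k t where k: "k \<in> active c l" and t: "\<And>i. t i \<in> GL" and x: "x = (\<chi> i. node_pos i (k $ i) (t i))"
    using assms unfolding nodes_alt by blast
  have "x \<in> cell c l k" unfolding x by (rule node_in_cell) (rule t)
  then have "nodal_fun y x = tensor_poly y k x" by (rule nodal_fun_cell[OF k])
  also have "\<dots> = (\<Prod>i\<in>UNIV. if x $ i = y $ i then 1 else 0)"
    unfolding tensor_poly_def using poly_line_poly[OF t] by (intro prod.cong refl) (simp add: x)
  also have "\<dots> = (if x = y then 1 else 0)"
  proof (cases "x = y")
    case False
    then obtain i where "x $ i \<noteq> y $ i" by (auto simp: vec_eq_iff)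
    then have "(\<Prod>i\<in>UNIV. if x $ i = y $ i then 1 else (0::real)) = 0" by (intro prod_zero) auto
    then show ?thesis using False by simp
  qed simp
  finally show ?thesis .
qed

lemma
  assumes y: "y \<in> nodes c l"
  shows nodal_basis_V: "nodal_basis c l y \<in> V c l"
    and nodal_basis_node: "x \<in> nodes c l \<Longrightarrow> nodal_basis c l y x = (if x = y then 1 else 0)"
proof -
  have "nodal_basis c l y = nodal_fun y"
    unfolding nodal_basis_def
  proof (rule the_equality)
    show "nodal_fun y \<in> V c l \<and> (\<forall>x\<in>nodes c l. nodal_fun y x = (if x = y then 1 else 0))"
      by (simp add: nodal_fun_V nodal_fun_node)
    show "v = nodal_fun y" if "v \<in> V c l \<and> (\<forall>x\<in>nodes c l. v x = (if x = y then 1 else 0))" for v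
      using that by (intro V_unisolvent nodal_fun_V) (auto simp: nodal_fun_node)
  qed
  then show "nodal_basis c l y \<in> V c l" "x \<in> nodes c l \<Longrightarrow> nodal_basis c l y x = (if x = y then 1 else 0)"
    by (simp_all add: nodal_fun_V nodal_fun_node)
qed

text \<open>Supplies the finite spanning family from which \<open>Riesz\<close> yields the
  restriction.\<close>

lemma V_lin_span: "V c l = lin_span (nodes c l) (nodal_basis c l)"
proof (intro equalityI subsetI)
  fix v assume v: "v \<in> V c l"
  have "v = (\<lambda>x. \<Sum>y\<in>nodes c l. v y * nodal_basis c l y x)"
  proof (rule V_unisolvent[OF v V_sum])
    fix x assume x: "x \<in> nodes c l"
    have "(\<Sum>y\<in>nodes c l. v y * nodal_basis c l y x) = (\<Sum>y\<in>nodes c l. if x = y then v y else 0)"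
      by (intro sum.cong refl) (simp add: nodal_basis_node x)
    then show "v x = (\<Sum>y\<in>nodes c l. v y * nodal_basis c l y x)" using x finite_nodes by simp
  qed (rule nodal_basis_V)
  then show "v \<in> lin_span (nodes c l) (nodal_basis c l)" using lin_spanI[of v "nodal_basis c l" "nodes c l"] by simp
next
  fix v assume "v \<in> lin_span (nodes c l) (nodal_basis c l)"
  then obtain a where "v = (\<lambda>x. \<Sum>y\<in>nodes c l. a y * nodal_basis c l y x)" by (auto simp: lin_span_def)
  then show "v \<in> V c l" by (simp add: V_sum nodal_basis_V)
qed

lemma cell_poly_zero: "cell_poly c l k (\<lambda>x. 0) = (\<lambda>x. 0)"
  by (intro cell_poly_eqI Qp_const) simp

end

section \<open>The energy forms\<close>

lemma continuous_on_nth: "continuous_on S f \<Longrightarrow> continuous_on S (\<lambda>x. f x $ i)"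
  by (simp add: continuous_on_def tendsto_vec_nth)

text \<open>A class closed under sums and products that contains the integrands of the forms; its
  members are integrable for any measure that knows the Borel sets and is finite on
  \<open>S\<close>. Volume and surface terms are thus treated alike.\<close>

definition bounded_borel_on :: "'a::euclidean_space set \<Rightarrow> ('a \<Rightarrow> real) \<Rightarrow> bool" where
  "bounded_borel_on S f \<longleftrightarrow> (\<lambda>x. indicator S x * f x) \<in> borel_measurable borel \<and> (\<exists>B. \<forall>x\<in>S. \<bar>f x\<bar> \<le> B)"

lemma bounded_borel_on_add:
  assumes "bounded_borel_on S f" "bounded_borel_on S g"
  shows "bounded_borel_on S (\<lambda>x. f x + g x)"
proof -
  obtain B C where B: "\<And>x. x \<in> S \<Longrightarrow> \<bar>f x\<bar> \<le> B" and C: "\<And>x. x \<in> S \<Longrightarrow> \<bar>g x\<bar> \<le> C"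
    using assms unfolding bounded_borel_on_def by blast
  have "(\<lambda>x. indicator S x * f x + indicator S x * g x) \<in> borel_measurable borel"
    using assms unfolding bounded_borel_on_def by (intro borel_measurable_add) blast+
  then have "(\<lambda>x. indicator S x * (f x + g x)) \<in> borel_measurable borel" by (simp only: distrib_left)
  moreover have "\<bar>f x + g x\<bar> \<le> B + C" if "x \<in> S" for x using B[OF that] C[OF that] by linarith
  ultimately show ?thesis unfolding bounded_borel_on_def by blast
qed

lemma bounded_borel_on_mult:
  assumes "bounded_borel_on S f" "bounded_borel_on S g"
  shows "bounded_borel_on S (\<lambda>x. f x * g x)"
proof -
  obtain B C where B: "\<And>x. x \<in> S \<Longrightarrow> \<bar>f x\<bar> \<le> B" and C: "\<And>x. x \<in> S \<Longrightarrow> \<bar>g x\<bar> \<le> C"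
    using assms unfolding bounded_borel_on_def by blast
  have "(\<lambda>x. (indicator S x * f x) * (indicator S x * g x)) \<in> borel_measurable borel"
    by (rule borel_measurable_times[OF conjunct1[OF assms(1)[unfolded bounded_borel_on_def]]
          conjunct1[OF assms(2)[unfolded bounded_borel_on_def]]])
  moreover have "(indicator S x * f x) * (indicator S x * g x) = indicator S x * (f x * g x)" for x
    by (simp split: split_indicator)
  ultimately have "(\<lambda>x. indicator S x * (f x * g x)) \<in> borel_measurable borel" by simp
  moreover have "\<bar>f x * g x\<bar> \<le> B * C" if "x \<in> S" for x
    unfolding abs_mult using B[OF that] C[OF that] by (intro mult_mono) auto
  ultimately show ?thesis unfolding bounded_borel_on_def by blast
qed

lemma bounded_borel_on_cong:
  assumes "bounded_borel_on S f" "\<And>x. x \<in> S \<Longrightarrow> f x = g x"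
  shows "bounded_borel_on S g"
proof -
  have "(\<lambda>x. indicator S x * f x) = (\<lambda>x. indicator S x * g x)"
    using assms(2) by (auto simp: fun_eq_iff split: split_indicator)
  then show ?thesis using assms unfolding bounded_borel_on_def by (metis (no_types, lifting))
qed

lemma bounded_borel_on_indicator:
  assumes "S \<in> sets borel" "A \<in> sets borel"
  shows "bounded_borel_on S (indicator A)"
proof -
  have "(\<lambda>x. indicator S x * indicator A x :: real) \<in> borel_measurable borel"
    using assms by (intro borel_measurable_times borel_measurable_indicator)
  moreover have "\<bar>indicator A x :: real\<bar> \<le> 1" for x :: 'a by (simp split: split_indicator)
  ultimately show ?thesis unfolding bounded_borel_on_def by blast
qed

lemma bounded_borel_on_const: "S \<in> sets borel \<Longrightarrow> bounded_borel_on S (\<lambda>x. a)"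
  unfolding bounded_borel_on_def
  by (intro conjI borel_measurable_times borel_measurable_indicator borel_measurable_const) auto

lemma bounded_borel_on_sum:
  assumes "S \<in> sets borel" "\<And>i. i \<in> I \<Longrightarrow> bounded_borel_on S (f i)"
  shows "bounded_borel_on S (\<lambda>x. \<Sum>i\<in>I. f i x)"
proof (cases "finite I")
  case True
  then show ?thesis using assms(2)
    by (induction I) (simp_all add: bounded_borel_on_const[OF assms(1)] bounded_borel_on_add)
qed (simp add: bounded_borel_on_const[OF assms(1)])

lemma bounded_borel_on_continuous:
  assumes "compact S" "continuous_on S f"
  shows "bounded_borel_on S f"
proof -
  have "(\<lambda>x. indicator S x *\<^sub>R f x) \<in> borel_measurable borel"
    using assms by (intro borel_measurable_continuous_on_indicator borel_closed compact_imp_closed)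
  moreover have "bounded (f ` S)" using assms by (intro compact_imp_bounded compact_continuous_image)
  then have "\<exists>B. \<forall>x\<in>S. \<bar>f x\<bar> \<le> B" by (auto simp: bounded_iff)
  ultimately show ?thesis by (simp add: bounded_borel_on_def)
qed

lemma bounded_borel_on_subset:
  assumes "bounded_borel_on S f" "T \<subseteq> S" "T \<in> sets borel"
  shows "bounded_borel_on T f"
proof -
  have "(\<lambda>x. indicator T x * (indicator S x * f x)) \<in> borel_measurable borel"
    by (rule borel_measurable_times[OF borel_measurable_indicator[OF assms(3)]
          conjunct1[OF assms(1)[unfolded bounded_borel_on_def]]])
  moreover have "indicator T x * (indicator S x * f x) = indicator T x * f x" for x
    using assms(2) by (auto split: split_indicator)
  ultimately have "(\<lambda>x. indicator T x * f x) \<in> borel_measurable borel" by simp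
  then show ?thesis using assms unfolding bounded_borel_on_def by blast
qed

lemma bounded_borel_on_integrable:
  fixes f :: "'a::euclidean_space \<Rightarrow> real"
  assumes f: "bounded_borel_on S f" and S: "S \<in> sets borel"
    and M: "sets borel \<subseteq> sets M" "space M = UNIV" and fin: "emeasure M S < top"
  shows "set_integrable M S f"
proof -
  obtain B where B: "\<And>x. x \<in> S \<Longrightarrow> \<bar>f x\<bar> \<le> B" using f unfolding bounded_borel_on_def by blast
  have "(\<lambda>x. indicator S x * f x) \<in> borel_measurable borel" using f by (simp add: bounded_borel_on_def)
  then have m: "(\<lambda>x. indicator S x * f x) \<in> borel_measurable M"
    using M by (auto simp: measurable_def)
  have "integrable M (\<lambda>x. indicator S x * f x)"
  proof (rule integrableI_bounded_set[OF _ m])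
    show "S \<in> sets M" "emeasure M S < \<infinity>" using S M fin by auto
    show "AE x in M. x \<in> S \<longrightarrow> norm (indicator S x * f x) \<le> B" using B by auto
  qed auto
  then show ?thesis by (simp add: set_integrable_def)
qed

lemma bounded_borel_on_integral_comb:
  fixes f g k :: "'a::euclidean_space \<Rightarrow> real"
  assumes f: "bounded_borel_on S f" and g: "bounded_borel_on S g" and S: "S \<in> sets borel"
    and M: "sets borel \<subseteq> sets M" "space M = UNIV" and fin: "emeasure M S < top"
    and k: "\<And>x. x \<in> S \<Longrightarrow> k x = a * f x + b * g x"
  shows "(LINT x:S|M. k x) = a * (LINT x:S|M. f x) + b * (LINT x:S|M. g x)"
proof -
  have "set_integrable M S f" "set_integrable M S g"
    using bounded_borel_on_integrable[OF _ S M fin] f g by blast+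
  then have i: "set_integrable M S (\<lambda>x. a * f x)" "set_integrable M S (\<lambda>x. b * g x)" by (simp_all)
  have "(LINT x:S|M. k x) = (LINT x:S|M. a * f x + b * g x)"
    using S M k by (intro set_lebesgue_integral_cong) auto
  also have "\<dots> = a * (LINT x:S|M. f x) + b * (LINT x:S|M. g x)"
    using i by (simp add: set_integral_add(2))
  finally show ?thesis .
qed

locale cutfem_level = cutfem_grid c l
  for c :: "('d::finite) cutfem" and l :: nat +
  fixes cA :: real
  assumes dim_ge: "CARD('d) \<ge> 2" and connected_dom: "connected (dom c)" and dom_nonempty: "dom c \<noteq> {}"
    and gam_pos: "gam c > 0" and C2_dom: "C2_boundary (dom c)"
    and crossing: "\<And>k. bdry c \<inter> cell c l k \<noteq> {} \<Longrightarrow> single_crossing c l k"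
    and cA_pos: "cA > 0"
    and stable: "\<And>v. v \<in> V c l \<Longrightarrow> cA * norm_N_sq c l v \<le> form_A c l v v"
begin

text \<open>An inactive cell meets the boundary at most in its own frontier, so removing the
  boundary leaves it connected.\<close>

lemma cut_active:
  assumes k: "k \<in> cut c l"
  shows "k \<in> active c l"
proof (rule ccontr)
  assume "k \<notin> active c l"
  then have "cell c l k \<inter> dom c = {}" by (simp add: active_def)
  then have "open_cell k \<inter> closure (dom c) = {}"
    using open_Int_closure_eq_empty[OF open_open_cell] open_cell_subset by blast
  then have c1: "open_cell k \<subseteq> cell c l k - bdry c"
    using open_cell_subset by (auto simp: bdry_def frontier_def)
  have c2: "cell c l k - bdry c \<subseteq> closure (open_cell k)" unfolding closure_open_cell by blast
  have c3: "connected (open_cell k)" unfolding open_cell_def by (intro convex_connected convex_box)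
  have "connected (cell c l k - bdry c)" by (rule connected_intermediate_closure[OF c3 c1 c2])
  moreover have "cell c l k - bdry c \<noteq> {}"
    using c1 open_cell_nonempty by blast
  ultimately have "components (cell c l k - bdry c) = {cell c l k - bdry c}"
    by (simp add: components_eq_sing_iff)
  moreover have "card (components (cell c l k - bdry c)) = 2"
    using crossing[of k] k by (simp add: cut_def Int_commute single_crossing_def)
  ultimately show False by simp
qed

lemma bdry_subset: "bdry c \<subseteq> closure (dom c)"
  by (simp add: bdry_def frontier_def)

text \<open>Boundary integrands read the half-open cell of the point. If it were inactive,
  \<open>cell_poly\<close> could be an unspecified description; at boundary points
  \<open>cut_active\<close> excludes this.\<close>

lemma closure_dom_active: "x \<in> closure (dom c) \<Longrightarrow> cell_index c l x \<in> active c l"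
proof -
  assume "x \<in> closure (dom c)"
  then have "x \<in> dom c \<or> x \<in> bdry c"
    using open_dom by (auto simp: bdry_def frontier_def interior_open)
  then show ?thesis using cell_index_active cell_index_cut cut_active by blast
qed

lemma compact_closure_dom: "compact (closure (dom c))"
  using bounded_dom by (simp add: compact_closure)

lemma compact_bdry: "compact (bdry c)"
  unfolding bdry_def using bounded_dom by (rule compact_frontier_bounded)

lemma borel_sets: "dom c \<in> sets borel" "bdry c \<in> sets borel" "closure (dom c) \<in> sets borel"
  using open_dom compact_imp_closed[OF compact_bdry] by auto

lemma cell_poly_poly: "v \<in> V c l \<Longrightarrow> k \<in> active c l \<Longrightarrow> real_polynomial_function (cell_poly c l k v)"
  by (rule Qp_real_polynomial_function[OF cell_poly_Qp])

lemma grad_comb: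
  assumes "u \<in> V c l" "v \<in> V c l" "x \<in> closure (dom c)"
  shows "grad c l (\<lambda>x. a * u x + b * v x) x = a *\<^sub>R grad c l u x + b *\<^sub>R grad c l v x"
  unfolding grad_def using closure_dom_active[OF assms(3)] assms(1,2)
  by (simp add: cell_poly_comb gradient_comb cell_poly_poly)

lemma cell_index_borel: "{x. cell_index c l x = k} \<in> sets borel"
proof -
  have "{x. cell_index c l x = k} = (\<Inter>i. {x. of_int (k $ i) \<le> (x $ i - origin c $ i) / h} \<inter>
      {x. (x $ i - origin c $ i) / h < of_int (k $ i) + 1})"
    by (auto simp: vec_eq_iff cell_index_nth floor_eq_iff)
  also have "\<dots> \<in> sets borel"
    by (intro sets.finite_INT sets.Int borel_closed borel_open closed_Collect_le open_Collect_less
        continuous_intros) (use h_pos in auto)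
  finally show ?thesis .
qed

text \<open>On the closure of the domain the cellwise gradient is a finite sum of continuous
  gradients times indicators of half-open cells.\<close>

lemma grad_bounded_borel:
  assumes v: "v \<in> V c l"
  shows "bounded_borel_on (closure (dom c)) (\<lambda>x. grad c l v x $ i)"
proof (rule bounded_borel_on_cong)
  show "bounded_borel_on (closure (dom c))
      (\<lambda>x. \<Sum>k\<in>active c l. indicator {x. cell_index c l x = k} x * gradient (cell_poly c l k v) x $ i)"
    by (intro bounded_borel_on_sum bounded_borel_on_mult bounded_borel_on_indicator
        bounded_borel_on_continuous compact_closure_dom continuous_on_nth continuous_on_gradient cell_poly_poly
        v borel_sets cell_index_borel)
  fix x assume x: "x \<in> closure (dom c)"
  have "(\<Sum>k\<in>active c l. indicator {x. cell_index c l x = k} x * gradient (cell_poly c l k v) x $ i)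
      = (\<Sum>k\<in>active c l. if cell_index c l x = k then gradient (cell_poly c l k v) x $ i else 0)"
    by (intro sum.cong refl) (simp split: split_indicator)
  also have "\<dots> = grad c l v x $ i"
    using closure_dom_active[OF x] finite_active by (simp add: grad_def)
  finally show "(\<Sum>k\<in>active c l. indicator {x. cell_index c l x = k} x * gradient (cell_poly c l k v) x $ i)
      = grad c l v x $ i" .
qed

lemma V_bounded_borel: "v \<in> V c l \<Longrightarrow> bounded_borel_on (closure (dom c)) v"
  by (intro bounded_borel_on_continuous compact_closure_dom continuous_on_subset[OF V_continuous closure_dom_subset])

lemma normal_deriv_bounded_borel:
  assumes v: "v \<in> V c l"
  shows "bounded_borel_on (bdry c) (normal_deriv c l v)"
proof (rule bounded_borel_on_cong)
  have n: "continuous_on (bdry c) (outer_normal (dom c))"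
    unfolding bdry_def by (rule continuous_outer_normal[OF open_dom C2_dom])
  show "bounded_borel_on (bdry c) (\<lambda>x. \<Sum>i\<in>UNIV. grad c l v x $ i * outer_normal (dom c) x $ i)"
    by (intro bounded_borel_on_sum bounded_borel_on_mult bounded_borel_on_continuous
        bounded_borel_on_subset[OF grad_bounded_borel[OF v] bdry_subset] compact_bdry continuous_on_nth n borel_sets)
qed (simp add: normal_deriv_def inner_vec_def)

lemma grad_inner_bounded_borel:
  assumes "u \<in> V c l" "v \<in> V c l"
  shows "bounded_borel_on (dom c) (\<lambda>x. grad c l u x \<bullet> grad c l v x)"
proof (rule bounded_borel_on_cong)
  show "bounded_borel_on (dom c) (\<lambda>x. \<Sum>i\<in>UNIV. grad c l u x $ i * grad c l v x $ i)"
    by (intro bounded_borel_on_sum bounded_borel_on_mult bounded_borel_on_subset[OF grad_bounded_borel closure_subset]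
        borel_sets assms)
qed (simp add: inner_vec_def)

abbreviation "surf \<equiv> (hausdorff (CARD('d) - 1) :: (real^'d) measure)"

lemma dim_minus_ge: "CARD('d) - 1 \<ge> 1"
  using dim_ge by simp

lemma lebesgue_dom: "sets borel \<subseteq> sets (lebesgue :: (real^'d) measure)" "space (lebesgue :: (real^'d) measure) = UNIV"
    "emeasure lebesgue (dom c) < top"
  using emeasure_bounded_finite[OF bounded_dom] open_dom by auto

lemma surf_meas: "sets borel \<subseteq> sets surf" "space surf = UNIV"
  by simp_all

lemma surf_bdry_finite: "emeasure surf (bdry c) < top"
  using hausdorff_frontier_finite[OF dim_ge open_dom bounded_dom C2_dom]
    emeasure_hausdorff[OF dim_minus_ge borel_sets(2)]
  by (simp only: bdry_def)

lemma surf_bdry_pos: "emeasure surf (bdry c) > 0"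
  using hausdorff_outer_frontier_pos[OF dim_ge open_dom bounded_dom dom_nonempty]
    emeasure_hausdorff[OF dim_minus_ge borel_sets(2)]
  by (simp only: bdry_def)

definition face :: "int^'d \<Rightarrow> 'd \<Rightarrow> (real^'d) set" where
  "face k i = cell c l k \<inter> cell c l (k + axis i 1)"

lemma compact_face: "compact (face k i)"
  unfolding face_def by (intro compact_Int_closed compact_cell closed_cell)

lemma face_borel: "face k i \<in> sets borel"
  using compact_imp_closed[OF compact_face] by (rule borel_closed)

lemma surf_face_finite: "emeasure surf (face k i) < top"
proof -
  obtain B where B: "\<And>x. x \<in> face k i \<Longrightarrow> norm x \<le> B"
    using compact_imp_bounded[OF compact_face] unfolding bounded_iff by blast
  obtain M :: nat where M: "B \<le> real M" using real_arch_simple by blast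
  have bnd: "\<bar>x $ j\<bar> \<le> real M" if "x \<in> face k i" for x j
    using component_le_norm_cart[of x j] B[OF that] M by linarith
  \<comment> \<open>A face lies in a hyperplane: one cell bounds coordinate \<open>i\<close> from
    above, the other from below by the same number. So it is a graph with Lipschitz constant
    1.\<close>
  have xi: "x $ i = origin c $ i + h * (of_int (k $ i) + 1)" if "x \<in> face k i" for x
  proof -
    have "x \<in> cell c l k" "x \<in> cell c l (k + axis i 1)" using that by (simp_all add: face_def)
    then have "x $ i \<le> origin c $ i + h * (of_int (k $ i) + 1)"
      "origin c $ i + h * of_int ((k + axis i 1) $ i) \<le> x $ i"
      unfolding mem_cell by blast+
    then show ?thesis by (simp add: axis_def)
  qed
  have lip: "dist x y \<le> 1 * (\<Sum>j\<in>UNIV - {i}. \<bar>x $ j - y $ j\<bar>)" if "x \<in> face k i" "y \<in> face k i" for x y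
  proof -
    have "dist x y \<le> (\<Sum>j\<in>UNIV. \<bar>(x - y) $ j\<bar>)" unfolding dist_norm by (rule norm_le_l1_cart)
    also have "\<dots> = \<bar>x $ i - y $ i\<bar> + (\<Sum>j\<in>UNIV - {i}. \<bar>x $ j - y $ j\<bar>)"
      by (subst sum.remove[of UNIV i]) auto
    finally show ?thesis using xi[OF that(1)] xi[OF that(2)] by simp
  qed
  have "hausdorff_outer (CARD('d) - 1) (face k i) < top"
    by (rule hausdorff_outer_Lipschitz_graph[OF dim_ge _ bnd lip]) simp
  then show ?thesis using emeasure_hausdorff[OF dim_minus_ge face_borel] by simp
qed

lemma jump_eq:
  assumes "v \<in> V c l" "(k, i) \<in> ghost_faces c l"
  shows "jump c l k i m v = (\<lambda>x. (dir_deriv (axis i 1) ^^ m) (cell_poly c l (k + axis i 1) v) x - (dir_deriv (axis i 1) ^^ m) (cell_poly c l k v) x)"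
proof -
  have k: "k \<in> active c l" "k + axis i 1 \<in> active c l" using assms(2) by (auto simp: ghost_faces_def)
  show ?thesis
    unfolding jump_def fun_eq_iff
    using deriv_funpow_dir_deriv[OF cell_poly_poly[OF assms(1) k(1)]] deriv_funpow_dir_deriv[OF cell_poly_poly[OF assms(1) k(2)]]
    by simp
qed

lemma jump_comb:
  assumes u: "u \<in> V c l" and v: "v \<in> V c l" and g: "(k, i) \<in> ghost_faces c l"
  shows "jump c l k i m (\<lambda>x. a * u x + b * v x) x = a * jump c l k i m u x + b * jump c l k i m v x"
proof -
  have k: "k \<in> active c l" "k + axis i 1 \<in> active c l" using g by (auto simp: ghost_faces_def)
  show ?thesis
    unfolding jump_eq[OF u g] jump_eq[OF v g] jump_eq[OF V_comb[OF u v] g]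
      cell_poly_comb[OF u v k(1)] cell_poly_comb[OF u v k(2)]
      dir_deriv_funpow_comb[OF cell_poly_poly[OF u k(1)] cell_poly_poly[OF v k(1)]]
      dir_deriv_funpow_comb[OF cell_poly_poly[OF u k(2)] cell_poly_poly[OF v k(2)]]
    by (simp add: algebra_simps)
qed

lemma jump_bounded_borel:
  assumes v: "v \<in> V c l" and g: "(k, i) \<in> ghost_faces c l"
  shows "bounded_borel_on (face k i) (jump c l k i m v)"
proof -
  have k: "k \<in> active c l" "k + axis i 1 \<in> active c l" using g by (auto simp: ghost_faces_def)
  show ?thesis unfolding jump_eq[OF v g]
    by (intro bounded_borel_on_continuous compact_face continuous_on_diff real_polynomial_function_continuous_on
        real_polynomial_function_dir_deriv_funpow cell_poly_poly v k)
qed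

lemma form_a_comb:
  assumes u: "u \<in> V c l" and v: "v \<in> V c l" and w: "w \<in> V c l"
  shows "form_a c l (\<lambda>x. a * u x + b * v x) w = a * form_a c l u w + b * form_a c l v w"
proof -
  let ?s = "\<lambda>x. a * u x + b * v x"
  have g: "grad c l ?s x = a *\<^sub>R grad c l u x + b *\<^sub>R grad c l v x" if "x \<in> dom c \<or> x \<in> bdry c" for x
    using that closure_subset[of "dom c"] bdry_subset by (intro grad_comb u v) blast
  note ND = normal_deriv_bounded_borel
  have VB: "bounded_borel_on (bdry c) v" if "v \<in> V c l" for v
    using that by (intro bounded_borel_on_subset[OF V_bounded_borel bdry_subset] borel_sets)
  have 1: "(LINT x:dom c|lebesgue. grad c l ?s x \<bullet> grad c l w x)
      = a * (LINT x:dom c|lebesgue. grad c l u x \<bullet> grad c l w x) + b * (LINT x:dom c|lebesgue. grad c l v x \<bullet> grad c l w x)"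
    by (rule bounded_borel_on_integral_comb[OF grad_inner_bounded_borel[OF u w] grad_inner_bounded_borel[OF v w]
          borel_sets(1) lebesgue_dom]) (simp add: g inner_add_left)
  have 2: "int_surf (bdry c) (\<lambda>x. normal_deriv c l ?s x * w x)
      = a * int_surf (bdry c) (\<lambda>x. normal_deriv c l u x * w x) + b * int_surf (bdry c) (\<lambda>x. normal_deriv c l v x * w x)"
    unfolding int_surf_def
    by (rule bounded_borel_on_integral_comb[OF bounded_borel_on_mult[OF ND[OF u] VB[OF w]]
          bounded_borel_on_mult[OF ND[OF v] VB[OF w]] borel_sets(2) surf_meas surf_bdry_finite])
       (simp add: normal_deriv_def g inner_add_left algebra_simps)
  have 3: "int_surf (bdry c) (\<lambda>x. ?s x * normal_deriv c l w x)
      = a * int_surf (bdry c) (\<lambda>x. u x * normal_deriv c l w x) + b * int_surf (bdry c) (\<lambda>x. v x * normal_deriv c l w x)"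
    unfolding int_surf_def
    by (rule bounded_borel_on_integral_comb[OF bounded_borel_on_mult[OF VB[OF u] ND[OF w]]
          bounded_borel_on_mult[OF VB[OF v] ND[OF w]] borel_sets(2) surf_meas surf_bdry_finite])
       (simp add: algebra_simps)
  have 4: "int_surf (bdry c) (\<lambda>x. ?s x * w x)
      = a * int_surf (bdry c) (\<lambda>x. u x * w x) + b * int_surf (bdry c) (\<lambda>x. v x * w x)"
    unfolding int_surf_def
    by (rule bounded_borel_on_integral_comb[OF bounded_borel_on_mult[OF VB[OF u] VB[OF w]]
          bounded_borel_on_mult[OF VB[OF v] VB[OF w]] borel_sets(2) surf_meas surf_bdry_finite])
       (simp add: algebra_simps)
  show ?thesis unfolding form_a_def 1 2 3 4 by (simp add: algebra_simps)
qed

lemma form_g_comb: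
  assumes u: "u \<in> V c l" and v: "v \<in> V c l" and w: "w \<in> V c l"
  shows "form_g c l (\<lambda>x. a * u x + b * v x) w = a * form_g c l u w + b * form_g c l v w"
proof -
  let ?c = "\<lambda>m. h ^ (2 * m - 1) / (fact m)\<^sup>2"
  let ?I = "\<lambda>k i m u. int_surf (face k i) (\<lambda>x. jump c l k i m u x * jump c l k i m w x)"
  have "?I k i m (\<lambda>x. a * u x + b * v x) = a * ?I k i m u + b * ?I k i m v" if g: "(k, i) \<in> ghost_faces c l" for k i m
    unfolding int_surf_def
    by (rule bounded_borel_on_integral_comb[OF bounded_borel_on_mult[OF jump_bounded_borel[OF u g] jump_bounded_borel[OF w g]]
          bounded_borel_on_mult[OF jump_bounded_borel[OF v g] jump_bounded_borel[OF w g]] face_borel surf_meas surf_face_finite])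
       (simp add: jump_comb[OF u v g] algebra_simps)
  then have "(\<Sum>(k, i)\<in>ghost_faces c l. \<Sum>m=1..deg c. ?c m * ?I k i m (\<lambda>x. a * u x + b * v x))
      = (\<Sum>(k, i)\<in>ghost_faces c l. \<Sum>m=1..deg c. ?c m * (a * ?I k i m u + b * ?I k i m v))"
    by (intro sum.cong refl) (auto intro!: sum.cong)
  also have "\<dots> = (\<Sum>(k, i)\<in>ghost_faces c l. a * (\<Sum>m=1..deg c. ?c m * ?I k i m u) + b * (\<Sum>m=1..deg c. ?c m * ?I k i m v))"
    by (simp add: sum_distrib_left sum.distrib distrib_left mult.left_commute)
  also have "\<dots> = a * (\<Sum>(k, i)\<in>ghost_faces c l. \<Sum>m=1..deg c. ?c m * ?I k i m u)
      + b * (\<Sum>(k, i)\<in>ghost_faces c l. \<Sum>m=1..deg c. ?c m * ?I k i m v)"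
    by (simp add: sum_distrib_left sum.distrib case_prod_beta)
  finally show ?thesis unfolding form_g_def face_def by (simp add: distrib_left mult.left_commute)
qed

lemma form_A_comb:
  assumes "u \<in> V c l" "v \<in> V c l" "w \<in> V c l"
  shows "form_A c l (\<lambda>x. a * u x + b * v x) w = a * form_A c l u w + b * form_A c l v w"
  unfolding form_A_def form_a_comb[OF assms] form_g_comb[OF assms] by (simp add: algebra_simps)

lemma form_A_sym: "form_A c l u v = form_A c l v u"
  unfolding form_A_def form_a_def form_g_def by (simp add: inner_commute mult.commute)

lemma form_g_nonneg: "form_g c l v v \<ge> 0"
proof -
  have "int_surf S (\<lambda>x. f x * f x) \<ge> 0" for S and f :: "real^'d \<Rightarrow> real"
    unfolding int_surf_def set_lebesgue_integral_def by (intro Bochner_Integration.integral_nonneg) simp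
  then show ?thesis unfolding form_g_def using gam_pos h_pos
    by (intro mult_nonneg_nonneg sum_nonneg) (auto intro!: sum_nonneg mult_nonneg_nonneg divide_nonneg_nonneg)
qed

end

section \<open>Positive definiteness of the energy form\<close>

context cutfem_level
begin

lemma norm_N_sq_terms:
  "(LINT x:dom c|lebesgue. (norm (grad c l v x))\<^sup>2) \<ge> 0"
  "int_surf (bdry c) (\<lambda>x. (normal_deriv c l v x)\<^sup>2) \<ge> 0"
  "int_surf (bdry c) (\<lambda>x. (v x)\<^sup>2) \<ge> 0"
  unfolding int_surf_def set_lebesgue_integral_def by (auto intro!: Bochner_Integration.integral_nonneg)

lemma norm_N_sq_zero:
  assumes "norm_N_sq c l v \<le> 0"
  shows "(LINT x:dom c|lebesgue. (norm (grad c l v x))\<^sup>2) = 0" "int_surf (bdry c) (\<lambda>x. (v x)\<^sup>2) = 0"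
proof -
  have a: "h * int_surf (bdry c) (\<lambda>x. (normal_deriv c l v x)\<^sup>2) \<ge> 0"
    using h_pos norm_N_sq_terms(2) by (intro mult_nonneg_nonneg) auto
  have b: "1 / h * int_surf (bdry c) (\<lambda>x. (v x)\<^sup>2) \<ge> 0"
    using h_pos norm_N_sq_terms(3) by (intro mult_nonneg_nonneg) auto
  show "(LINT x:dom c|lebesgue. (norm (grad c l v x))\<^sup>2) = 0"
    using assms a b norm_N_sq_terms(1)[of v] form_g_nonneg[of v] unfolding norm_N_sq_def by linarith
  have "1 / h * int_surf (bdry c) (\<lambda>x. (v x)\<^sup>2) = 0"
    using assms a b norm_N_sq_terms(1)[of v] form_g_nonneg[of v] unfolding norm_N_sq_def by linarith
  then show "int_surf (bdry c) (\<lambda>x. (v x)\<^sup>2) = 0" using h_pos by simp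
qed

text \<open>The integral forces the gradient to vanish almost everywhere; by continuity a nonzero
  value would persist on an open set, which is not negligible.\<close>

lemma gradient_zero_on_cell:
  assumes v: "v \<in> V c l" and int0: "(LINT x:dom c|lebesgue. (norm (grad c l v x))\<^sup>2) = 0"
    and k: "k \<in> active c l" and y: "y \<in> open_cell k \<inter> dom c"
  shows "gradient (cell_poly c l k v) y = 0"
proof (rule ccontr)
  assume ne: "gradient (cell_poly c l k v) y \<noteq> 0"
  define f where "f = (\<lambda>x. indicator (dom c) x *\<^sub>R (norm (grad c l v x))\<^sup>2)"
  have "set_integrable lebesgue (dom c) (\<lambda>x. grad c l v x \<bullet> grad c l v x)"
    by (rule bounded_borel_on_integrable[OF grad_inner_bounded_borel[OF v v] borel_sets(1) lebesgue_dom])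
  then have fi: "integrable lebesgue f"
    unfolding f_def set_integrable_def by (simp only: power2_norm_eq_inner)
  have f0: "integral\<^sup>L lebesgue f = 0" using int0 unfolding f_def set_lebesgue_integral_def .
  have "AE x in lebesgue. 0 \<le> f x" by (simp add: f_def)
  then have "AE x in lebesgue. f x = 0" using f0 integral_nonneg_eq_0_iff_AE[OF fi] by simp
  then obtain N where N: "{x \<in> space lebesgue. \<not> f x = 0} \<subseteq> N" "emeasure lebesgue N = 0" "N \<in> sets lebesgue"
    by (rule AE_E)
  have Nn: "negligible N" using N(2,3) by (simp add: negligible_iff_null_sets null_sets_def)
  define Z where "Z = (open_cell k \<inter> dom c) \<inter> {x. gradient (cell_poly c l k v) x \<noteq> 0}"
  have "continuous_on UNIV (gradient (cell_poly c l k v))"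
    by (intro continuous_on_gradient cell_poly_poly v k)
  then have "open {x. gradient (cell_poly c l k v) x \<noteq> 0}"
    by (intro open_Collect_neq continuous_on_const)
  then have "open Z" unfolding Z_def by (intro open_Int open_open_cell open_dom)
  moreover have "y \<in> Z" using y ne by (simp add: Z_def)
  ultimately have nn: "\<not> negligible Z" by (intro open_not_negligible) blast+
  have "Z \<subseteq> N"
  proof
    fix x assume x: "x \<in> Z"
    then have "cell_index c l x = k" unfolding Z_def by (intro cell_index_open_cell) blast
    then have "grad c l v x = gradient (cell_poly c l k v) x" by (simp add: grad_def)
    then have "f x \<noteq> 0" using x by (simp add: f_def Z_def)
    then have "x \<in> {x \<in> space lebesgue. \<not> f x = 0}" by simp
    then show "x \<in> N" using N(1) by blast
  qed
  then show False using negligible_subset[OF Nn] nn by simp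
qed

text \<open>Constant on a small box inside cell and domain, hence everywhere by unisolvence: the
  part in the domain determines the polynomial on the whole cell.\<close>

lemma cell_poly_constant:
  assumes v: "v \<in> V c l" and int0: "(LINT x:dom c|lebesgue. (norm (grad c l v x))\<^sup>2) = 0"
    and k: "k \<in> active c l"
  shows "\<exists>a. cell_poly c l k v = (\<lambda>x. a)"
proof -
  let ?q = "cell_poly c l k v"
  obtain y where y: "y \<in> open_cell k \<inter> dom c" using active_open_cell[OF k] by blast
  have "open (open_cell k \<inter> dom c)" by (intro open_Int open_open_cell open_dom)
  then obtain a b where ab: "y \<in> box a b" "cbox a b \<subseteq> open_cell k \<inter> dom c"
    using open_contains_cbox[of "open_cell k \<inter> dom c" y] y by metis
  have sub: "box a b \<subseteq> open_cell k \<inter> dom c" using ab(2) box_subset_cbox[of a b] by blast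
  have const: "?q x = ?q y" if x: "x \<in> box a b" for x
  proof (rule has_derivative_zero_unique[OF convex_box(2) _ x ab(1)])
    fix z assume z: "z \<in> box a b"
    have "?q differentiable at z"
      by (rule differentiable_at_real_polynomial_function[OF cell_poly_poly[OF v k]])
    then obtain D where D: "(?q has_derivative D) (at z)" unfolding differentiable_def by blast
    have "gradient ?q z = 0" using z sub by (intro gradient_zero_on_cell[OF v int0 k]) blast
    then have "D = (\<lambda>h. 0)" using gradient_inner[OF D] by (simp add: fun_eq_iff)
    then show "(?q has_derivative (\<lambda>h. 0)) (at z within box a b)"
      using D has_derivative_at_withinI[of ?q "\<lambda>h. 0" z "box a b"] by (simp only:)
  qed
  have "?q = (\<lambda>x. ?q y)"
  proof (rule Qp_eq_on_box[OF cell_poly_Qp[OF v k] Qp_const])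
    show "box a b \<noteq> {}" using ab(1) by blast
  qed (rule const)
  then show ?thesis by blast
qed

text \<open>Continuity and connectedness merge the cellwise constants into one on the domain, and
  the boundary term makes it 0. As every active cell meets the domain, its constant is 0 also on the
  part outside.\<close>

lemma form_A_pos:
  assumes v: "v \<in> V c l" and ne: "v \<noteq> (\<lambda>x. 0)"
  shows "form_A c l v v > 0"
proof (rule ccontr)
  assume "\<not> form_A c l v v > 0"
  then have "cA * norm_N_sq c l v \<le> 0" using stable[OF v] by linarith
  then have "norm_N_sq c l v \<le> 0" using cA_pos by (simp add: mult_le_0_iff)
  note zero = norm_N_sq_zero[OF this]
  have "\<forall>k\<in>active c l. \<exists>a. cell_poly c l k v = (\<lambda>x. a)" using cell_poly_constant[OF v zero(1)] by blast
  then obtain a where a: "\<And>k. k \<in> active c l \<Longrightarrow> cell_poly c l k v = (\<lambda>x. a k)" by metis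
  have va: "v x = a k" if "k \<in> active c l" "x \<in> cell c l k" for x k
    using cell_poly_eq[OF v that] a[OF that(1)] by simp
  have "v ` dom c \<subseteq> a ` active c l"
  proof
    fix t assume "t \<in> v ` dom c"
    then obtain x where x: "x \<in> dom c" "t = v x" by blast
    then show "t \<in> a ` active c l"
      using va[OF cell_index_active[OF x(1)] cell_index_mem] cell_index_active[OF x(1)] by blast
  qed
  then have "finite (v ` dom c)" using finite_active finite_subset by blast
  moreover have "continuous_on (dom c) v" by (rule continuous_on_subset[OF V_continuous[OF v] dom_subset_active_dom])
  ultimately have "v constant_on dom c" using connected_dom by (intro continuous_finite_range_constant)
  then obtain s where s: "\<And>x. x \<in> dom c \<Longrightarrow> v x = s" unfolding constant_on_def by blast
  have bd: "v x = s" if "x \<in> bdry c" for x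
    using continuous_constant_on_closure[OF continuous_on_subset[OF V_continuous[OF v] closure_dom_subset] s] that bdry_subset
    by blast
  have "int_surf (bdry c) (\<lambda>x. (v x)\<^sup>2) = int_surf (bdry c) (\<lambda>x. s\<^sup>2)"
    unfolding int_surf_def using borel_sets(2) bd by (intro set_lebesgue_integral_cong) auto
  also have "\<dots> = measure surf (bdry c) * s\<^sup>2"
    unfolding int_surf_def using borel_sets(2) surf_bdry_finite by (subst set_integral_const) auto
  finally have "measure surf (bdry c) * s\<^sup>2 = 0" using zero(2) by simp
  moreover have "measure surf (bdry c) > 0"
    using surf_bdry_pos surf_bdry_finite by (simp add: measure_def enn2real_positive_iff)
  ultimately have "s = 0" by simp
  have "v = (\<lambda>x. 0)"
  proof (rule V_eqI[OF v V_zero])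
    fix k assume k: "k \<in> active c l"
    then obtain x where x: "x \<in> cell c l k" "x \<in> dom c" by (auto simp: active_def)
    have "a k = 0" using va[OF k x(1)] s[OF x(2)] \<open>s = 0\<close> by simp
    then show "cell_poly c l k v = cell_poly c l k (\<lambda>x. 0)" using a[OF k] by (simp add: cell_poly_zero)
  qed
  then show False using ne by simp
qed

sublocale spd: spd_space "V c l" "form_A c l"
  by unfold_locales (auto intro: V_zero V_comb form_A_comb form_A_sym form_A_pos)

lemma nrm_eq: "spd.nrm = norm_A c l"
  by (simp add: spd.nrm_def norm_A_def fun_eq_iff)

lemma V_nontrivial: "\<exists>u\<in>V c l. u \<noteq> (\<lambda>x. 0)"
proof -
  obtain x where x: "x \<in> dom c" using dom_nonempty by blast
  define y where "y = (\<chi> i. node_pos i (cell_index c l x $ i) 1)"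
  have y: "y \<in> nodes c l" unfolding nodes_alt y_def using cell_index_active[OF x] GL_ends(2) by fastforce
  have "nodal_basis c l y y = 1" using nodal_basis_node[OF y y] by simp
  then have "nodal_basis c l y \<noteq> (\<lambda>x. 0)" by (metis zero_neq_one)
  then show ?thesis using nodal_basis_V[OF y] by blast
qed

section \<open>Local spaces and their interaction\<close>

lemma V_loc_lin_span: "V_loc c l z = lin_span (patch_nodes c l z) (nodal_basis c l)"
  by (simp add: V_loc_def lin_span_def)

lemma patch_nodes_subset: "patch_nodes c l z \<subseteq> nodes c l"
  by (auto simp: patch_nodes_def split: patch_type.splits)

lemma finite_patch_nodes: "finite (patch_nodes c l z)"
  using patch_nodes_subset finite_nodes by (rule finite_subset)

lemma patch_nodal_basis_V: "y \<in> patch_nodes c l z \<Longrightarrow> nodal_basis c l y \<in> V c l"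
  using patch_nodes_subset nodal_basis_V by blast

lemma V_loc_subset: "V_loc c l z \<subseteq> V c l"
  unfolding V_loc_lin_span by (intro spd.lin_span_subset patch_nodal_basis_V)

lemma V_loc_comb: "u \<in> V_loc c l z \<Longrightarrow> v \<in> V_loc c l z \<Longrightarrow> (\<lambda>x. a * u x + b * v x) \<in> V_loc c l z"
  unfolding V_loc_lin_span by (rule lin_span_comb)

lemma local_proj:
  assumes u: "u \<in> V c l"
  shows "local_proj c l z u \<in> V_loc c l z" "y \<in> V_loc c l z \<Longrightarrow> form_A c l (local_proj c l z u) y = form_A c l u y"
proof -
  have "\<exists>!w. w \<in> V_loc c l z \<and> (\<forall>y\<in>V_loc c l z. form_A c l w y = form_A c l u y)"
    unfolding V_loc_lin_span
  proof (rule spd.Riesz[OF finite_patch_nodes patch_nodal_basis_V])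
    show "form_A c l u (\<lambda>x. a * v x + b * w x) = a * form_A c l u v + b * form_A c l u w"
      if "v \<in> V c l" "w \<in> V c l" for v w a b
      using form_A_comb[OF that u] by (simp only: form_A_sym[of u])
  qed
  from theI'[OF this] show "local_proj c l z u \<in> V_loc c l z"
    "y \<in> V_loc c l z \<Longrightarrow> form_A c l (local_proj c l z u) y = form_A c l u y"
    unfolding local_proj_def by blast+
qed

lemma vertex_in_cell: "vertex c l z \<in> cell c l k \<longleftrightarrow> (\<forall>i. k $ i \<le> z $ i \<and> z $ i \<le> k $ i + 1)"
proof -
  have "(vertex c l z $ i - origin c $ i) / h = of_int (z $ i)" for i
    using h_pos by (simp add: vertex_nth)
  moreover have "(of_int (k $ i) \<le> (of_int (z $ i) :: real) \<and> of_int (z $ i) \<le> (of_int (k $ i) + 1 :: real))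
      \<longleftrightarrow> k $ i \<le> z $ i \<and> z $ i \<le> k $ i + 1" for i
    by linarith
  ultimately show ?thesis unfolding mem_cell_scaled by presburger
qed

lemma patch_hat_subset: "patch_hat c l z \<subseteq> cbox (vertex c l (z - 1)) (vertex c l (z + 1))"
proof
  fix x assume "x \<in> patch_hat c l z"
  then obtain k where k: "x \<in> cell c l k" "vertex c l z \<in> cell c l k" by (auto simp: patch_hat_def)
  have "vertex c l (z - 1) $ i \<le> x $ i \<and> x $ i \<le> vertex c l (z + 1) $ i" for i
  proof -
    have kz: "k $ i \<le> z $ i" "z $ i \<le> k $ i + 1" using k(2) unfolding vertex_in_cell by blast+
    have "h * of_int (z $ i - 1) \<le> h * of_int (k $ i)" "h * of_int (k $ i + 1) \<le> h * of_int (z $ i + 1)"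
      using kz h_pos by (intro mult_left_mono; simp)+
    moreover have "origin c $ i + h * of_int (k $ i) \<le> x $ i" "x $ i \<le> origin c $ i + h * (of_int (k $ i) + 1)"
      using k(1) unfolding mem_cell by blast+
    ultimately show ?thesis by (simp add: vertex_nth)
  qed
  then show "x \<in> cbox (vertex c l (z - 1)) (vertex c l (z + 1))" by (simp add: mem_box_cart)
qed

text \<open>Brings both patch types to one property. For \<open>Type_D\<close> a node strictly
  inside a box of two cells per direction lies only in cells touching its centre; for
  \<open>Type_FR\<close> the cell itself is part of the patch.\<close>

lemma patch_node_cell:
  assumes y: "y \<in> patch_nodes c l z" and k: "k \<in> active c l" "y \<in> cell c l k"
  shows "vertex c l z \<in> cell c l k"
proof (cases "ptype c")
  case Type_D
  then have "y \<in> interior (patch_hat c l z)" using y by (simp add: patch_nodes_def)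
  also have "\<dots> \<subseteq> interior (cbox (vertex c l (z - 1)) (vertex c l (z + 1)))"
    by (rule interior_mono[OF patch_hat_subset])
  finally have yb: "y \<in> box (vertex c l (z - 1)) (vertex c l (z + 1))" by (simp add: interior_cbox)
  have "k $ i \<le> z $ i \<and> z $ i \<le> k $ i + 1" for i
  proof -
    have "origin c $ i + h * of_int (z $ i - 1) < y $ i" "y $ i < origin c $ i + h * of_int (z $ i + 1)"
      using yb by (simp_all add: mem_box_cart vertex_nth)
    moreover have "origin c $ i + h * of_int (k $ i) \<le> y $ i" "y $ i \<le> origin c $ i + h * of_int (k $ i + 1)"
      using k(2) by (simp_all add: mem_cell)
    ultimately have "h * of_int (z $ i - 1) < h * of_int (k $ i + 1)" "h * of_int (k $ i) < h * of_int (z $ i + 1)"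
      by linarith+
    then have "of_int (z $ i - 1) < (of_int (k $ i + 1) :: real)" "(of_int (k $ i) :: real) < of_int (z $ i + 1)"
      using h_pos by (simp_all only: mult_less_cancel_left_pos)
    then show ?thesis by linarith
  qed
  then show ?thesis by (simp add: vertex_in_cell)
next
  case Type_FR
  then have "node_patch c l y \<subseteq> patch c l z" using y by (simp add: patch_nodes_def)
  moreover have "cell c l k \<subseteq> node_patch c l y" using k by (auto simp: node_patch_def)
  moreover have "patch c l z \<subseteq> patch_hat c l z" by (auto simp: patch_def patch_hat_def)
  ultimately have sub: "cell c l k \<subseteq> cbox (vertex c l (z - 1)) (vertex c l (z + 1))" using patch_hat_subset by blast
  have "vertex c l k \<in> cell c l k" "vertex c l (k + 1) \<in> cell c l k" by (simp_all add: vertex_in_cell)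
  then have v: "vertex c l k \<in> cbox (vertex c l (z - 1)) (vertex c l (z + 1))"
    "vertex c l (k + 1) \<in> cbox (vertex c l (z - 1)) (vertex c l (z + 1))" using sub by blast+
  have "k $ i \<le> z $ i \<and> z $ i \<le> k $ i + 1" for i
  proof -
    have "h * of_int (z $ i - 1) \<le> h * of_int (k $ i)" "h * of_int (k $ i + 1) \<le> h * of_int (z $ i + 1)"
      using v by (simp_all add: mem_box_cart vertex_nth)
    then have "of_int (z $ i - 1) \<le> (of_int (k $ i) :: real)" "(of_int (k $ i + 1) :: real) \<le> of_int (z $ i + 1)"
      using h_pos by (simp_all only: mult_le_cancel_left_pos)
    then show ?thesis by linarith
  qed
  then show ?thesis by (simp add: vertex_in_cell)
qed

text \<open>A cell away from the patch vertex contains no node of the patch, so the function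
  vanishes at all nodes of the cell and unisolvence applies.\<close>

lemma V_loc_cell_poly:
  assumes u: "u \<in> V_loc c l z" and k: "k \<in> active c l" and z: "vertex c l z \<notin> cell c l k"
  shows "cell_poly c l k u = (\<lambda>x. 0)"
proof -
  obtain a where a: "u = (\<lambda>x. \<Sum>y\<in>patch_nodes c l z. a y * nodal_basis c l y x)"
    using u by (auto simp: V_loc_def)
  have "cell_poly c l k u = cell_poly c l k (\<lambda>x. 0)"
  proof (rule cell_poly_unisolvent[OF subsetD[OF V_loc_subset u] V_zero k])
    fix x assume x: "x \<in> nodes c l" "x \<in> cell c l k"
    have "a y * nodal_basis c l y x = 0" if "y \<in> patch_nodes c l z" for y
    proof -
      have "y \<noteq> x" using patch_node_cell[OF that k] x(2) z by blast
      then show ?thesis using nodal_basis_node[OF subsetD[OF patch_nodes_subset that] x(1)] by simp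
    qed
    then show "u x = 0" unfolding a by (rule sum.neutral[OF ballI])
  qed
  then show ?thesis by (simp add: cell_poly_zero)
qed

lemma gradient_zero: "gradient (\<lambda>x :: real^'d. 0) x = 0"
  by (rule gradient_eqI) simp

lemma V_loc_grad:
  assumes "u \<in> V_loc c l z" "x \<in> closure (dom c)" "vertex c l z \<notin> cell c l (cell_index c l x)"
  shows "grad c l u x = 0" "u x = 0"
proof -
  have 0: "cell_poly c l (cell_index c l x) u = (\<lambda>x. 0)"
    using assms closure_dom_active by (intro V_loc_cell_poly) auto
  show "grad c l u x = 0" unfolding grad_def 0 by (rule gradient_zero)
  show "u x = 0"
    using cell_poly_eq[OF subsetD[OF V_loc_subset assms(1)] closure_dom_active[OF assms(2)] cell_index_mem] 0 by simp
qed

lemma dir_deriv_funpow_zero: "(dir_deriv e ^^ m) (\<lambda>x :: real^'d. 0) = (\<lambda>x. 0)"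
  using dir_deriv_funpow_comb[OF real_polynomial_function.intros(2) real_polynomial_function.intros(2),
      where e = e and m = m and a = 0 and b = 0] by simp

lemma V_loc_jump:
  assumes u: "u \<in> V_loc c l z" and g: "(k, i) \<in> ghost_faces c l"
    and z: "vertex c l z \<notin> cell c l k" "vertex c l z \<notin> cell c l (k + axis i 1)"
  shows "jump c l k i m u x = 0"
proof -
  have k: "k \<in> active c l" "k + axis i 1 \<in> active c l" using g by (auto simp: ghost_faces_def)
  show ?thesis unfolding jump_eq[OF subsetD[OF V_loc_subset u] g]
      V_loc_cell_poly[OF u k(1) z(1)] V_loc_cell_poly[OF u k(2) z(2)] dir_deriv_funpow_zero by simp
qed

text \<open>Volume and boundary terms couple patches that share a cell, but ghost faces also couple
  neighbouring cells. The vertex is the lower or upper end of its cell and the neighbour shifts the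
  index by at most 1, so distance 2 remains possible; the five offsets per direction give
  \<open>5 ^ d\<close>.\<close>

lemma V_loc_interaction:
  assumes u: "u \<in> V_loc c l z" and v: "v \<in> V_loc c l z'" and ne: "form_A c l u v \<noteq> 0"
  shows "\<bar>z' $ i - z $ i\<bar> \<le> 2"
proof (rule ccontr)
  assume far: "\<not> \<bar>z' $ i - z $ i\<bar> \<le> 2"
  have sep: "vertex c l z \<notin> cell c l k \<or> vertex c l z' \<notin> cell c l k'" if "\<bar>k $ i - k' $ i\<bar> \<le> 1" for k k'
  proof (rule ccontr)
    assume "\<not> (vertex c l z \<notin> cell c l k \<or> vertex c l z' \<notin> cell c l k')"
    then have "k $ i \<le> z $ i" "z $ i \<le> k $ i + 1" "k' $ i \<le> z' $ i" "z' $ i \<le> k' $ i + 1"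
      unfolding vertex_in_cell by blast+
    then show False using far that by linarith
  qed
  have loc: "(grad c l u x = 0 \<and> u x = 0) \<or> (grad c l v x = 0 \<and> v x = 0)" if "x \<in> closure (dom c)" for x
    using sep[of "cell_index c l x" "cell_index c l x"] V_loc_grad[OF u that] V_loc_grad[OF v that] by auto
  have d: "x \<in> closure (dom c)" if "x \<in> dom c" for x using that closure_subset by blast
  have b: "x \<in> closure (dom c)" if "x \<in> bdry c" for x using that bdry_subset by blast
  have int0: "(LINT x:S|M. f x) = 0" if "S \<in> sets M" "\<And>x. x \<in> S \<Longrightarrow> f x = 0" for S M and f :: "real^'d \<Rightarrow> real"
    using set_lebesgue_integral_cong[of S M f "\<lambda>x. 0"] that by (simp add: set_lebesgue_integral_def)
  have z1: "grad c l u x \<bullet> grad c l v x = 0" "normal_deriv c l u x * v x = 0"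
    "u x * normal_deriv c l v x = 0" "u x * v x = 0" if "x \<in> closure (dom c)" for x
    using loc[OF that] unfolding normal_deriv_def by (elim disjE conjE; simp)+
  have 1: "(LINT x:dom c|lebesgue. grad c l u x \<bullet> grad c l v x) = 0"
    by (rule int0[OF _ z1(1)[OF d]]) (use lebesgue_dom(1) borel_sets(1) in blast)
  have 2: "int_surf (bdry c) (\<lambda>x. normal_deriv c l u x * v x) = 0"
    unfolding int_surf_def by (rule int0[OF _ z1(2)[OF b]]) (use surf_meas(1) borel_sets(2) in blast)
  have 3: "int_surf (bdry c) (\<lambda>x. u x * normal_deriv c l v x) = 0"
    unfolding int_surf_def by (rule int0[OF _ z1(3)[OF b]]) (use surf_meas(1) borel_sets(2) in blast)
  have 4: "int_surf (bdry c) (\<lambda>x. u x * v x) = 0"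
    unfolding int_surf_def by (rule int0[OF _ z1(4)[OF b]]) (use surf_meas(1) borel_sets(2) in blast)
  have 5: "jump c l k j m u x * jump c l k j m v x = 0" if g: "(k, j) \<in> ghost_faces c l" for k j m x
  proof (cases "vertex c l z \<in> cell c l k \<or> vertex c l z \<in> cell c l (k + axis j 1)")
    case True
    have ax: "\<bar>axis j (1::int) $ i\<bar> \<le> 1" by (simp add: axis_def)
    then have "vertex c l z' \<notin> cell c l k \<and> vertex c l z' \<notin> cell c l (k + axis j 1)"
      using True sep[of k k] sep[of k "k + axis j 1"] sep[of "k + axis j 1" k] sep[of "k + axis j 1" "k + axis j 1"]
      by auto
    then show ?thesis using V_loc_jump[OF v g] by simp
  next
    case False
    then show ?thesis using V_loc_jump[OF u g] by simp
  qed
  have "form_g c l u v = gam c * (\<Sum>(k, j)\<in>ghost_faces c l. 0)"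
    unfolding form_g_def
    by (intro arg_cong[where f = "(*) (gam c)"] sum.cong refl)
       (auto simp: 5 int_surf_def set_lebesgue_integral_def)
  then have "form_A c l u v = 0" unfolding form_A_def form_a_def 1 2 3 4 by simp
  then show False using ne by simp
qed

lemma V_loc_interaction_card:
  assumes "finite S"
  shows "card {z'\<in>S. \<exists>u\<in>V_loc c l z. \<exists>v\<in>V_loc c l z'. form_A c l u v \<noteq> 0} \<le> 5 ^ CARD('d)"
proof -
  let ?B = "PiE UNIV (\<lambda>i. {z $ i - 2..z $ i + 2})"
  have fin: "finite ?B" by (intro finite_PiE) auto
  have "{z'\<in>S. \<exists>u\<in>V_loc c l z. \<exists>v\<in>V_loc c l z'. form_A c l u v \<noteq> 0} \<subseteq> (\<lambda>f. \<chi> i. f i) ` ?B"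
  proof
    fix z' assume "z' \<in> {z'\<in>S. \<exists>u\<in>V_loc c l z. \<exists>v\<in>V_loc c l z'. form_A c l u v \<noteq> 0}"
    then have "\<bar>z' $ i - z $ i\<bar> \<le> 2" for i using V_loc_interaction by blast
    then have "z' $ i \<in> {z $ i - 2..z $ i + 2}" for i using abs_le_D1 abs_le_D2 by (simp add: abs_le_iff) (smt (verit))
    then have "(\<lambda>i. z' $ i) \<in> ?B" by (intro PiE_I) auto
    moreover have "z' = (\<chi> i. z' $ i)" by simp
    ultimately show "z' \<in> (\<lambda>f. \<chi> i. f i) ` ?B" by blast
  qed
  then have "card {z'\<in>S. \<exists>u\<in>V_loc c l z. \<exists>v\<in>V_loc c l z'. form_A c l u v \<noteq> 0} \<le> card ((\<lambda>f. \<chi> i. f i) ` ?B)"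
    using fin by (intro card_mono) auto
  also have "\<dots> \<le> card ?B" by (rule card_image_le[OF fin])
  also have "\<dots> = (\<Prod>i\<in>(UNIV :: 'd set). 5)" by (subst card_PiE) auto
  finally show ?thesis by simp
qed

end

section \<open>The W-cycle\<close>

context spd_space
begin

definition opnorm :: "(('a \<Rightarrow> real) \<Rightarrow> 'a \<Rightarrow> real) \<Rightarrow> real" where
  "opnorm E = (SUP v\<in>{v \<in> W. nrm v \<le> 1}. nrm (E v))"

lemma opnorm_le:
  assumes "\<And>u. u \<in> W \<Longrightarrow> nrm (E u) \<le> t * nrm u" "t \<ge> 0"
  shows "opnorm E \<le> t"
  unfolding opnorm_def
proof (rule cSUP_least)
  show "{v \<in> W. nrm v \<le> 1} \<noteq> {}" using zero_in nrm_zero by force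
  fix v assume "v \<in> {v \<in> W. nrm v \<le> 1}"
  then have v: "v \<in> W" "nrm v \<le> 1" by auto
  have "nrm (E v) \<le> t * nrm v" using assms(1) v(1) .
  also have "\<dots> \<le> t * 1" using v(2) assms(2) by (rule mult_left_mono)
  finally show "nrm (E v) \<le> t" by simp
qed

text \<open>A real supremum is an upper bound only if some bound \<open>t\<close> is known
  beforehand; its size does not matter.\<close>

lemma opnorm_upper:
  assumes "\<And>u. u \<in> W \<Longrightarrow> nrm (E u) \<le> t * nrm u" "t \<ge> 0" "u \<in> W" "nrm u \<le> 1"
  shows "nrm (E u) \<le> opnorm E"
  unfolding opnorm_def
proof (rule cSUP_upper)
  show "u \<in> {v \<in> W. nrm v \<le> 1}" using assms by simp
  show "bdd_above ((\<lambda>v. nrm (E v)) ` {v \<in> W. nrm v \<le> 1})"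
  proof (rule bdd_aboveI2)
    fix v assume "v \<in> {v \<in> W. nrm v \<le> 1}"
    then have v: "v \<in> W" "nrm v \<le> 1" by auto
    have "nrm (E v) \<le> t * nrm v" using assms(1) v(1) .
    also have "\<dots> \<le> t * 1" using v(2) assms(2) by (rule mult_left_mono)
    finally show "nrm (E v) \<le> t" by simp
  qed
qed

lemma opnorm_nonneg:
  assumes "\<And>u. u \<in> W \<Longrightarrow> nrm (E u) \<le> t * nrm u" "t \<ge> 0" "\<And>u. u \<in> W \<Longrightarrow> E u \<in> W"
  shows "0 \<le> opnorm E"
proof -
  have "0 \<le> nrm (E (\<lambda>x. 0))" using assms(3) zero_in nrm_ge_0 by blast
  also have "\<dots> \<le> opnorm E" using assms(1,2) zero_in by (rule opnorm_upper) (simp_all add: nrm_zero)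
  finally show ?thesis .
qed

lemma opnorm_bound:
  assumes "\<And>u. u \<in> W \<Longrightarrow> nrm (E u) \<le> t * nrm u" "t \<ge> 0" and EW: "\<And>u. u \<in> W \<Longrightarrow> E u \<in> W"
    and hom: "\<And>u a. u \<in> W \<Longrightarrow> E (\<lambda>x. a * u x) = (\<lambda>x. a * E u x)" and u: "u \<in> W"
  shows "nrm (E u) \<le> opnorm E * nrm u"
proof (cases "u = (\<lambda>x. 0)")
  case True
  then show ?thesis using assms(1)[OF u] by (simp add: nrm_zero)
next
  case False
  then have p: "nrm u > 0" using nrm_pos u by blast
  let ?v = "\<lambda>x. inverse (nrm u) * u x"
  have v: "?v \<in> W" "nrm ?v = 1" using u p by (simp_all add: scale_in nrm_scale)
  have "nrm (E ?v) \<le> opnorm E" using assms(1,2) v(1) by (rule opnorm_upper) (simp_all add: v)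
  moreover have "nrm (E ?v) = inverse (nrm u) * nrm (E u)" using p by (simp add: hom[OF u] nrm_scale EW u)
  ultimately have "inverse (nrm u) * nrm (E u) \<le> opnorm E" by simp
  then have "nrm u * (inverse (nrm u) * nrm (E u)) \<le> nrm u * opnorm E" using p by (intro mult_left_mono) auto
  moreover have "nrm u * (inverse (nrm u) * nrm (E u)) = nrm (E u)" using p by simp
  ultimately show ?thesis by (simp add: mult.commute)
qed

end

context two_level
begin

lemma S_scale: "u \<in> W \<Longrightarrow> S (\<lambda>x. a * u x) = (\<lambda>x. a * S u x)"
  using S_comb[of u u a 0] by simp

lemma R_scale: "u \<in> W \<Longrightarrow> R (\<lambda>x. a * u x) = (\<lambda>x. a * R u x)"
  using R_comb[of u u a 0] by simp

lemma I_scale: "v \<in> Wc \<Longrightarrow> I (\<lambda>x. a * v x) = (\<lambda>x. a * I v x)"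
  using I_comb[of v v a 0] by simp

text \<open>\<open>F\<close> is the error operator of the coarse solver: 0 stands for the exact
  solve, the square of the coarser cycle for two cycles from a zero guess.\<close>

definition inexact :: "(('b \<Rightarrow> real) \<Rightarrow> 'b \<Rightarrow> real) \<Rightarrow> ('a \<Rightarrow> real) \<Rightarrow> 'a \<Rightarrow> real" where
  "inexact F u = S (\<lambda>x. u x - I (\<lambda>x. R u x - F (R u) x) x / C\<^sup>2)"

lemma inexact_alt: "inexact F u = S (\<lambda>x. u x - inverse (C\<^sup>2) * I (\<lambda>x. R u x - F (R u) x) x)"
  by (simp add: inexact_def divide_inverse mult.commute)

lemma inexact_in:
  assumes "\<And>r. r \<in> Wc \<Longrightarrow> F r \<in> Wc" "u \<in> W"
  shows "inexact F u \<in> W"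
  unfolding inexact_alt by (intro S_in fine.diff_in fine.scale_in I_in coarse.diff_in R_in assms)

lemma inexact_scale:
  assumes F: "\<And>r. r \<in> Wc \<Longrightarrow> F r \<in> Wc"
    and hom: "\<And>r a. r \<in> Wc \<Longrightarrow> F (\<lambda>x. a * r x) = (\<lambda>x. a * F r x)" and u: "u \<in> W"
  shows "inexact F (\<lambda>x. a * u x) = (\<lambda>x. a * inexact F u x)"
proof -
  have Ru: "R u \<in> Wc" by (rule R_in[OF u])
  let ?d = "\<lambda>x. R u x - F (R u) x"
  have d: "?d \<in> Wc" by (intro coarse.diff_in Ru F)
  let ?w = "\<lambda>x. u x - inverse (C\<^sup>2) * I ?d x"
  have w: "?w \<in> W" by (intro fine.diff_in fine.scale_in I_in d u)
  have "(\<lambda>x. a * R u x - a * F (R u) x) = (\<lambda>x. a * ?d x)" by (simp add: right_diff_distrib)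
  then have "I (\<lambda>x. R (\<lambda>x. a * u x) x - F (R (\<lambda>x. a * u x)) x) = (\<lambda>x. a * I ?d x)"
    by (simp only: R_scale[OF u] hom[OF Ru] I_scale[OF d])
  then have "(\<lambda>x. a * u x - inverse (C\<^sup>2) * I (\<lambda>x. R (\<lambda>x. a * u x) x - F (R (\<lambda>x. a * u x)) x) x) = (\<lambda>x. a * ?w x)"
    by (simp add: fun_eq_iff algebra_simps)
  then show ?thesis unfolding inexact_alt by (simp only: S_scale[OF w])
qed

lemma inexact_bound:
  assumes F: "\<And>r. r \<in> Wc \<Longrightarrow> F r \<in> Wc" "\<And>r. r \<in> Wc \<Longrightarrow> coarse.nrm (F r) \<le> t * coarse.nrm r"
    and "t \<ge> 0" and u: "u \<in> W"
  shows "fine.nrm (inexact F u) \<le> fine.nrm (E u) + t * fine.nrm u"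
  unfolding inexact_def
  by (rule inexact_coarse_solve[where F = F, OF u F(1)[OF R_in[OF u]] F(2)[OF R_in[OF u]] assms(3)])

lemma E_inexact: "E = inexact (\<lambda>r x. 0)"
  by (simp add: E_def inexact_def T0_def fun_eq_iff)

lemma E_scale: "u \<in> W \<Longrightarrow> E (\<lambda>x. a * u x) = (\<lambda>x. a * E u x)"
  unfolding E_inexact by (rule inexact_scale) (simp_all add: coarse.zero_in)

lemma E_nonexpansive:
  assumes "u \<in> W"
  shows "fine.nrm (E u) \<le> 1 * fine.nrm u"
proof -
  have "fine.nrm (E u) \<le> fine.nrm (\<lambda>x. u x - T0 u x)"
    unfolding E_def by (intro S_nonexpansive fine.diff_in T0_in assms)
  also have "\<dots> \<le> fine.nrm u"
  proof (rule power2_le_imp_le)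
    show "(fine.nrm (\<lambda>x. u x - T0 u x))\<^sup>2 \<le> (fine.nrm u)\<^sup>2"
      using T0_energy[OF assms] zero_le_power2[of "coarse.nrm (R u) / C"] by linarith
  qed (rule fine.nrm_ge_0[OF assms])
  finally show ?thesis by simp
qed

end

text \<open>In HOL \<open>sqrt\<close> is negative at negative arguments, so the sign is not
  automatic; it follows from the contraction estimate for a nonzero \<open>u\<close>.\<close>

lemma (in stable_two_level) contraction_factor_nonneg:
  "0 \<le> sqrt (1 - inverse ((2 * (real N)\<^sup>2 + 1) * (1 + C\<^sup>2) * D))" (is "0 \<le> ?e")
proof -
  obtain u where u: "u \<in> W" "u \<noteq> (\<lambda>x. 0)" using nontrivial by blast
  have "0 \<le> fine.nrm (E u)" by (intro fine.nrm_ge_0 E_in u)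
  also have "\<dots> \<le> ?e * fine.nrm u" by (rule E_contraction[OF u(1)])
  finally show ?thesis using fine.nrm_pos[OF u] by (simp add: zero_le_mult_iff)
qed

lemma (in spd_space) funpow2_props:
  assumes "\<And>u. u \<in> W \<Longrightarrow> G u \<in> W" "\<And>u a. u \<in> W \<Longrightarrow> G (\<lambda>x. a * u x) = (\<lambda>x. a * G u x)"
    and "\<And>u. u \<in> W \<Longrightarrow> nrm (G u) \<le> t * nrm u" "t \<ge> 0" "u \<in> W"
  shows "(G ^^ 2) u \<in> W" "(G ^^ 2) (\<lambda>x. a * u x) = (\<lambda>x. a * (G ^^ 2) u x)" "nrm ((G ^^ 2) u) \<le> t\<^sup>2 * nrm u"
proof -
  have G2: "(G ^^ 2) v = G (G v)" for v by (simp add: numeral_2_eq_2)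
  have Gu: "G u \<in> W" by (rule assms(1)[OF assms(5)])
  show "(G ^^ 2) u \<in> W" unfolding G2 using assms(1) Gu .
  show "(G ^^ 2) (\<lambda>x. a * u x) = (\<lambda>x. a * (G ^^ 2) u x)"
    unfolding G2 by (simp only: assms(2)[OF assms(5)] assms(2)[OF Gu])
  have "nrm (G (G u)) \<le> t * nrm (G u)" using assms(3) Gu .
  also have "\<dots> \<le> t * (t * nrm u)" using assms(3)[OF assms(5)] assms(4) by (rule mult_left_mono)
  finally show "nrm ((G ^^ 2) u) \<le> t\<^sup>2 * nrm u" unfolding G2 by (simp add: power2_eq_square mult.assoc)
qed

text \<open>\<open>div\<close> rounds down for negative indices as well, so halving yields the
  parent on the whole lattice.\<close>

lemma cell_subset_parent:
  fixes c :: "('d::finite) cutfem"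
  assumes c: "cutfem_grid c" and l: "l \<ge> 1"
  shows "cell c l k \<subseteq> cell c (l - 1) (\<chi> i. k $ i div 2)"
proof
  interpret F: cutfem_grid c l by (rule c)
  interpret C: cutfem_grid c "l - 1" by (rule c)
  have "(2::real) ^ l = 2 * 2 ^ (l - 1)" using l by (cases l) simp_all
  then have h: "mesh_size c (l - 1) = 2 * mesh_size c l" by (simp add: mesh_size_def)
  fix x assume x: "x \<in> cell c l k"
  show "x \<in> cell c (l - 1) (\<chi> i. k $ i div 2)"
    unfolding C.mem_cell
  proof
    fix i
    have xk: "origin c $ i + mesh_size c l * of_int (k $ i) \<le> x $ i" "x $ i \<le> origin c $ i + mesh_size c l * (of_int (k $ i) + 1)"
      using x unfolding F.mem_cell by blast+
    have "2 * (n div 2) \<le> n \<and> n + 1 \<le> 2 * (n div 2 + 1)" for n :: int by presburger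
    then have "2 * (k $ i div 2) \<le> k $ i" "k $ i + 1 \<le> 2 * (k $ i div 2 + 1)" by blast+
    then have "of_int (2 * (k $ i div 2)) \<le> (of_int (k $ i) :: real)" "(of_int (k $ i + 1) :: real) \<le> of_int (2 * (k $ i div 2 + 1))"
      by (simp_all only: of_int_le_iff)
    then have "mesh_size c l * of_int (2 * (k $ i div 2)) \<le> mesh_size c l * of_int (k $ i)"
      "mesh_size c l * of_int (k $ i + 1) \<le> mesh_size c l * of_int (2 * (k $ i div 2 + 1))"
      using F.h_pos by (simp_all only: mult_le_cancel_left_pos)
    then show "origin c $ i + mesh_size c (l - 1) * of_int ((\<chi> i. k $ i div 2) $ i) \<le> x $ i \<and>
        x $ i \<le> origin c $ i + mesh_size c (l - 1) * (of_int ((\<chi> i. k $ i div 2) $ i) + 1)"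
      using xk unfolding h by (simp add: algebra_simps)
  qed
qed

lemma prolong_V:
  fixes c :: "('d::finite) cutfem"
  assumes c: "cutfem_grid c" and l: "l \<ge> 1" and sub: "active_dom c l \<subseteq> active_dom c (l - 1)"
    and v: "v \<in> V c (l - 1)"
  shows "prolong c l v \<in> V c l"
proof -
  have "continuous_on (active_dom c (l - 1)) v" using v by (simp add: V_def)
  then have "continuous_on (active_dom c l) v" using sub by (rule continuous_on_subset)
  then have "continuous_on (active_dom c l) (prolong c l v)"
    by (rule continuous_on_eq) (simp add: prolong_def)
  moreover have "\<exists>q\<in>Qp (deg c). \<forall>x\<in>cell c l k. prolong c l v x = q x" if k: "k \<in> active c l" for k
  proof -
    let ?k = "\<chi> i. k $ i div 2"
    have ck: "cell c l k \<subseteq> cell c (l - 1) ?k" by (rule cell_subset_parent[OF c l])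
    then have "?k \<in> active c (l - 1)" using k by (auto simp: active_def)
    moreover have "\<forall>k\<in>active c (l - 1). \<exists>q\<in>Qp (deg c). \<forall>x\<in>cell c (l - 1) k. v x = q x"
      using v by (simp add: V_def)
    ultimately obtain q where q: "q \<in> Qp (deg c)" "\<forall>x\<in>cell c (l - 1) ?k. v x = q x" by blast
    have "cell c l k \<subseteq> active_dom c l" using k by (auto simp: active_dom_def)
    then have "\<forall>x\<in>cell c l k. prolong c l v x = q x" using q(2) ck unfolding prolong_def by (simp add: subset_iff)
    then show ?thesis using q(1) by blast
  qed
  ultimately show ?thesis by (simp add: V_def prolong_def)
qed

lemma restr:
  fixes c :: "('d::finite) cutfem"
  assumes C: "cutfem_level c (l - 1) cA" and F: "cutfem_level c l cA" and l: "l \<ge> 1"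
    and sub: "active_dom c l \<subseteq> active_dom c (l - 1)" and u: "u \<in> V c l"
  shows "restr c l u \<in> V c (l - 1)"
    "z \<in> V c (l - 1) \<Longrightarrow> form_A c (l - 1) (restr c l u) z = form_A c l u (prolong c l z)"
proof -
  interpret F: cutfem_level c l cA by (rule F)
  interpret C: cutfem_level c "l - 1" cA by (rule C)
  note pV = prolong_V[OF F.cutfem_grid_axioms l sub]
  have "\<exists>!w. w \<in> V c (l - 1) \<and> (\<forall>z\<in>V c (l - 1). form_A c (l - 1) w z = form_A c l u (prolong c l z))"
    unfolding C.V_lin_span
  proof (rule C.spd.Riesz[OF C.finite_nodes C.nodal_basis_V])
    fix v w a b assume vw: "v \<in> V c (l - 1)" "w \<in> V c (l - 1)"
    have "prolong c l (\<lambda>x. a * v x + b * w x) = (\<lambda>x. a * prolong c l v x + b * prolong c l w x)"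
      by (simp add: prolong_def fun_eq_iff)
    then show "form_A c l u (prolong c l (\<lambda>x. a * v x + b * w x))
        = a * form_A c l u (prolong c l v) + b * form_A c l u (prolong c l w)"
      using F.form_A_comb[OF pV[OF vw(1)] pV[OF vw(2)] u] by (simp only: F.form_A_sym[of u])
  qed
  from theI'[OF this] show "restr c l u \<in> V c (l - 1)"
    "z \<in> V c (l - 1) \<Longrightarrow> form_A c (l - 1) (restr c l u) z = form_A c l u (prolong c l z)"
    unfolding restr_def by blast+
qed

section \<open>The contraction factor and the recursion over levels\<close>

lemma eta_less_1: "Csd > 0 \<Longrightarrow> eta d Cpr Csd < 1"
proof -
  assume "Csd > 0"
  then have "(2 * (5 ^ d)\<^sup>2 + 1) * (1 + Cpr\<^sup>2) * Csd > 0"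
    by (intro mult_pos_pos add_nonneg_pos add_pos_nonneg) auto
  then have "inverse ((2 * (5 ^ d)\<^sup>2 + 1) * (1 + Cpr\<^sup>2) * Csd) > 0" by (rule positive_imp_inverse_positive)
  then show ?thesis unfolding eta_def by (simp del: inverse_mult_distrib)
qed

lemma rho_star_fixed_point:
  assumes "0 \<le> q" "q \<le> 1 / 4"
  shows "q + (rho_star q)\<^sup>2 = rho_star q" "0 \<le> rho_star q" "rho_star q \<le> 2 * q"
proof -
  define s where "s = sqrt (1 - 4 * q)"
  have s: "s\<^sup>2 = 1 - 4 * q" "0 \<le> s" "s \<le> 1" using assms by (simp_all add: s_def)
  have r: "rho_star q = (1 - s) / 2" by (simp add: rho_star_def s_def)
  show "q + (rho_star q)\<^sup>2 = rho_star q"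
    unfolding r using s(1) by (simp add: power2_eq_square field_simps)
  show "0 \<le> rho_star q" unfolding r using s by simp
  \<comment> \<open>Hence \<open>1 - s\<close> is at most \<open>1 - s^2 = 4 * q\<close>.\<close>
  have "s\<^sup>2 \<le> s" using mult_left_mono[OF s(3,2)] by (simp add: power2_eq_square)
  then show "rho_star q \<le> 2 * q" unfolding r using s(1) by simp
qed

theorem corollary2:
  fixes c :: "('d::finite) cutfem" and L :: nat
    and \<delta>0 cA CA C Cpr Csd :: real
  assumes "CARD('d) = 2 \<or> CARD('d) = 3"
    and "open (dom c)" "connected (dom c)" "bounded (dom c)" "dom c \<noteq> {}"
    and "edge0 c > 0" and "deg c \<ge> 1" and "0 < gam c" "gam c \<le> 1"
    and "L \<ge> 2"
    and "geometric_assumption c L \<delta>0"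
    and "cutfem_stability c L cA CA C"
    and "patch_enumeration c L"
    and "covering_assumption c L"
    and "Cpr > 0" and "prolongation_bound c L Cpr"
    and "Csd > 0" and "stable_decomposition c L Csd"
  shows "q_sup c L Cpr \<le> eta CARD('d) Cpr Csd \<and> eta CARD('d) Cpr Csd < 1 \<and>
    (\<forall>l\<in>{2..L}. rho c Cpr l \<le> q_sup c L Cpr + (rho c Cpr (l - 1))\<^sup>2) \<and>
    (q_sup c L Cpr \<le> 1 / 4 \<longrightarrow>
       (\<forall>l\<in>{1..L}. rho c Cpr l \<le> rho_star (q_sup c L Cpr)) \<and>
       rho_star (q_sup c L Cpr) \<le> 2 * q_sup c L Cpr \<and> 2 * q_sup c L Cpr < 1)"
proof -
  have lev: "cutfem_level c l cA" if "l \<le> L" for l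
  proof
    show "2 \<le> CARD('d)" using assms(1) by auto
    show "C2_boundary (dom c)" "bdry c \<inter> cell c l k \<noteq> {} \<Longrightarrow> single_crossing c l k" for k
      using assms(11) that unfolding geometric_assumption_def by blast+
    show "cA > 0" "v \<in> V c l \<Longrightarrow> cA * norm_N_sq c l v \<le> form_A c l v v" for v
      using assms(12) that unfolding cutfem_stability_def by blast+
  qed (use assms in simp_all)
  have sub: "active_dom c l \<subseteq> active_dom c (l - 1)" if "l \<in> {1..L}" for l
    using assms(11) that unfolding geometric_assumption_def by blast
  have tl: "stable_two_level (V c l) (form_A c l) (V c (l - 1)) (form_A c (l - 1)) (prolong c l) (restr c l)
      (local_proj c l) (V_loc c l) (patch_order c l) Cpr (5 ^ CARD('d)) Csd" if l: "l \<in> {1..L}" for l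
  proof -
    have l1: "l \<ge> 1" "l \<le> L" "l - 1 \<le> L" using l by auto
    interpret F: cutfem_level c l cA by (rule lev[OF l1(2)])
    interpret C: cutfem_level c "l - 1" cA by (rule lev[OF l1(3)])
    note nF = F.nrm_eq and nC = C.nrm_eq
    note rs = restr[OF lev[OF l1(3)] lev[OF l1(2)] l1(1) sub[OF l]]
    have po: "distinct (patch_order c l)" "set (patch_order c l) = admissible_vertices c l"
      using assms(13) l1(2) unfolding patch_enumeration_def by blast+
    show ?thesis
    proof
      show "prolong c l v \<in> V c l" if "v \<in> V c (l - 1)" for v
        by (rule prolong_V[OF F.cutfem_grid_axioms l1(1) sub[OF l] that])
      show "prolong c l (\<lambda>x. a * u x + b * v x) = (\<lambda>x. a * prolong c l u x + b * prolong c l v x)" for u v a b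
        by (simp add: prolong_def fun_eq_iff)
      show "spd_space.nrm (form_A c l) (prolong c l v) \<le> Cpr * spd_space.nrm (form_A c (l - 1)) v" if "v \<in> V c (l - 1)" for v
        unfolding nF nC using assms(16) l that unfolding prolongation_bound_def by blast
      show "restr c l u \<in> V c (l - 1)" if "u \<in> V c l" for u by (rule rs(1)[OF that])
      show "form_A c (l - 1) (restr c l u) z = form_A c l u (prolong c l z)" if "u \<in> V c l" "z \<in> V c (l - 1)" for u z
        by (rule rs(2)[OF that])
      show "V_loc c l z \<subseteq> V c l" for z by (rule F.V_loc_subset)
      show "(\<lambda>x. a * u x + b * v x) \<in> V_loc c l z" if "u \<in> V_loc c l z" "v \<in> V_loc c l z" for z u v a b
        by (rule F.V_loc_comb[OF that])
      show "local_proj c l z u \<in> V_loc c l z" if "u \<in> V c l" for z u by (rule F.local_proj(1)[OF that])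
      show "form_A c l (local_proj c l z u) y = form_A c l u y" if "u \<in> V c l" "y \<in> V_loc c l z" for z u y
        by (rule F.local_proj(2)[OF that])
      show "card {z' \<in> set (patch_order c l). \<exists>u\<in>V_loc c l z. \<exists>v\<in>V_loc c l z'. form_A c l u v \<noteq> 0} \<le> 5 ^ CARD('d)" for z
        by (rule F.V_loc_interaction_card) simp
      show "4 \<le> (5::nat) ^ CARD('d)"
        using power_increasing[of 1 "CARD('d)" "5::nat"] F.dim_ge by simp
      show "\<exists>v0\<in>V c (l - 1). \<exists>w. (\<forall>z\<in>set (patch_order c l). w z \<in> V_loc c l z) \<and>
          u = (\<lambda>x. prolong c l v0 x + (\<Sum>z\<in>set (patch_order c l). w z x)) \<and>
          (spd_space.nrm (form_A c l) (prolong c l v0))\<^sup>2 + (\<Sum>z\<in>set (patch_order c l). (spd_space.nrm (form_A c l) (w z))\<^sup>2)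
            \<le> Csd * (spd_space.nrm (form_A c l) u)\<^sup>2 \<and>
          (spd_space.nrm (form_A c (l - 1)) v0)\<^sup>2 \<le> Csd * (spd_space.nrm (form_A c l) u)\<^sup>2" if "u \<in> V c l" for u
        unfolding nF nC po(2) using assms(18) l that unfolding stable_decomposition_def by blast
      show "\<exists>u\<in>V c l. u \<noteq> (\<lambda>x. 0)" by (rule F.V_nontrivial)
    qed (use assms(15,17) po(1) in simp_all)
  qed
  \<comment> \<open>What the induction over levels carries. Besides the norm bound, the next level
    needs the range condition and homogeneity for its own cycle operator, and the sign for
    squaring.\<close>
  define good where "good = (\<lambda>l. (\<forall>u\<in>V c l. E_W c Cpr l u \<in> V c l) \<and>
    (\<forall>u\<in>V c l. \<forall>a. E_W c Cpr l (\<lambda>x. a * u x) = (\<lambda>x. a * E_W c Cpr l u x)) \<and>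
    0 \<le> rho c Cpr l \<and> (\<forall>u\<in>V c l. norm_A c l (E_W c Cpr l u) \<le> rho c Cpr l * norm_A c l u))"
  have q_props: "q_lev c Cpr l \<le> eta CARD('d) Cpr Csd \<and> 0 \<le> q_lev c Cpr l" if l: "l \<in> {1..L}" for l
  proof -
    have lL: "l \<le> L" using l by simp
    interpret F: cutfem_level c l cA by (rule lev[OF lL])
    interpret T: stable_two_level "V c l" "form_A c l" "V c (l - 1)" "form_A c (l - 1)" "prolong c l" "restr c l"
      "local_proj c l" "V_loc c l" "patch_order c l" Cpr "5 ^ CARD('d)" Csd by (rule tl[OF l])
    have E: "E_TG c Cpr l = T.E"
      by (simp add: fun_eq_iff E_TG_def T.E_def T.S_def T.T0_def smoother_def)
    have q: "q_lev c Cpr l = F.spd.opnorm T.E"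
      unfolding q_lev_def opnorm_A_def E F.spd.opnorm_def F.nrm_eq by (rule refl)
    have e: "eta CARD('d) Cpr Csd = sqrt (1 - inverse ((2 * (real (5 ^ CARD('d)))\<^sup>2 + 1) * (1 + Cpr\<^sup>2) * Csd))"
      by (simp add: eta_def)
    have "F.spd.opnorm T.E \<le> eta CARD('d) Cpr Csd"
      unfolding e by (rule F.spd.opnorm_le[OF T.E_contraction T.contraction_factor_nonneg])
    moreover have "0 \<le> F.spd.opnorm T.E"
      by (rule F.spd.opnorm_nonneg[OF T.E_nonexpansive _ T.E_in]) simp_all
    ultimately show ?thesis unfolding q by simp
  qed
  have step: "good (Suc (Suc m)) \<and> rho c Cpr (Suc (Suc m)) \<le> q_lev c Cpr (Suc (Suc m)) + (rho c Cpr (Suc m))\<^sup>2"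
    if g: "good (Suc m)" and mL: "Suc (Suc m) \<le> L" for m
  proof -
    define l where "l = Suc (Suc m)"
    have l: "l \<in> {1..L}" "l \<le> L" "l - 1 \<le> L" "l - 1 = Suc m" using mL by (simp_all add: l_def)
    interpret F: cutfem_level c l cA by (rule lev[OF l(2)])
    interpret C: cutfem_level c "l - 1" cA by (rule lev[OF l(3)])
    interpret T: stable_two_level "V c l" "form_A c l" "V c (l - 1)" "form_A c (l - 1)" "prolong c l" "restr c l"
      "local_proj c l" "V_loc c l" "patch_order c l" Cpr "5 ^ CARD('d)" Csd by (rule tl[OF l(1)])
    let ?G = "E_W c Cpr (l - 1)" and ?t = "rho c Cpr (l - 1)"
    have G: "\<And>u. u \<in> V c (l - 1) \<Longrightarrow> ?G u \<in> V c (l - 1)"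
      "\<And>u a. u \<in> V c (l - 1) \<Longrightarrow> ?G (\<lambda>x. a * u x) = (\<lambda>x. a * ?G u x)"
      "\<And>u. u \<in> V c (l - 1) \<Longrightarrow> C.spd.nrm (?G u) \<le> ?t * C.spd.nrm u" "0 \<le> ?t"
      using g unfolding good_def l(4)[symmetric] C.nrm_eq by blast+
    note G2 = C.spd.funpow2_props[OF G]
    have EW: "E_W c Cpr l = T.inexact (?G ^^ 2)"
    proof
      fix u
      have "E_W c Cpr l u = smoother c l (\<lambda>x. u x - prolong c l (\<lambda>x. restr c l u x - (?G ^^ 2) (restr c l u) x) x / Cpr\<^sup>2)"
        unfolding l(4) unfolding l_def by (simp only: E_W.simps Let_def)
      then show "E_W c Cpr l u = T.inexact (?G ^^ 2) u" unfolding T.inexact_def T.S_def smoother_def .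
    qed
    have inW: "T.inexact (?G ^^ 2) u \<in> V c l" if "u \<in> V c l" for u
      by (rule T.inexact_in[OF G2(1) that])
    have hom: "T.inexact (?G ^^ 2) (\<lambda>x. a * u x) = (\<lambda>x. a * T.inexact (?G ^^ 2) u x)" if "u \<in> V c l" for u a
      by (rule T.inexact_scale[OF G2(1) G2(2) that])
    have q: "q_lev c Cpr l = F.spd.opnorm T.E"
    proof -
      have E: "E_TG c Cpr l = T.E"
        by (simp add: fun_eq_iff E_TG_def T.E_def T.S_def T.T0_def smoother_def)
      show ?thesis unfolding q_lev_def opnorm_A_def E F.spd.opnorm_def F.nrm_eq by (rule refl)
    qed
    have r: "rho c Cpr l = F.spd.opnorm (T.inexact (?G ^^ 2))"
      unfolding rho_def opnorm_A_def EW F.spd.opnorm_def F.nrm_eq by (rule refl)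
    have t0: "0 \<le> q_lev c Cpr l + ?t\<^sup>2" using q_props[OF l(1)] by simp
    have bound: "F.spd.nrm (T.inexact (?G ^^ 2) u) \<le> (q_lev c Cpr l + ?t\<^sup>2) * F.spd.nrm u" if u: "u \<in> V c l" for u
    proof -
      have "F.spd.nrm (T.inexact (?G ^^ 2) u) \<le> F.spd.nrm (T.E u) + ?t\<^sup>2 * F.spd.nrm u"
        by (rule T.inexact_bound[OF G2(1) G2(3) zero_le_power2 u])
      also have "F.spd.nrm (T.E u) \<le> q_lev c Cpr l * F.spd.nrm u"
        unfolding q by (rule F.spd.opnorm_bound[OF T.E_nonexpansive _ T.E_in T.E_scale u]) simp_all
      finally show ?thesis by (simp add: distrib_right)
    qed
    have "good l"
      unfolding good_def EW r F.nrm_eq[symmetric]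
      using inW hom F.spd.opnorm_nonneg[OF bound t0 inW] F.spd.opnorm_bound[OF bound t0 inW hom] by blast
    moreover have "rho c Cpr l \<le> q_lev c Cpr l + ?t\<^sup>2"
      unfolding r by (rule F.spd.opnorm_le[OF bound t0])
    ultimately show ?thesis unfolding l(4) unfolding l_def by simp
  qed
  have rho1: "rho c Cpr (Suc 0) = 0" and good1: "good (Suc 0)"
  proof -
    have "Suc 0 \<le> L" using assms(10) by simp
    then interpret F: cutfem_level c "Suc 0" cA by (rule lev)
    have r: "rho c Cpr (Suc 0) = F.spd.opnorm (\<lambda>u x. 0)"
      unfolding rho_def opnorm_A_def F.spd.opnorm_def F.nrm_eq by simp
    have "F.spd.opnorm (\<lambda>u x. 0) \<le> 0" "0 \<le> F.spd.opnorm (\<lambda>u x. 0)"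
      by (rule F.spd.opnorm_le, simp_all add: F.spd.nrm_zero)
         (rule F.spd.opnorm_nonneg[of _ 0], simp_all add: F.spd.nrm_zero F.V_zero)
    then show "rho c Cpr (Suc 0) = 0" using r by simp
    then show "good (Suc 0)"
      using F.spd.nrm_zero unfolding F.nrm_eq by (simp add: good_def F.V_zero)
  qed
  have good: "good (Suc m)" if "Suc m \<le> L" for m
    using that by (induction m) (use good1 step in simp_all)
  let ?q = "q_sup c L Cpr"
  \<comment> \<open>The set of levels is finite, so the supremum bounds each member.\<close>
  have ql: "q_lev c Cpr l \<le> ?q" if "l \<in> {2..L}" for l
    unfolding q_sup_def using that by (intro cSUP_upper) auto
  have "?q \<le> eta CARD('d) Cpr Csd"
    unfolding q_sup_def using assms(10) q_props by (intro cSUP_least) auto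
  moreover have "eta CARD('d) Cpr Csd < 1" by (rule eta_less_1[OF assms(17)])
  moreover have rec: "rho c Cpr l \<le> ?q + (rho c Cpr (l - 1))\<^sup>2" if l: "l \<in> {2..L}" for l
  proof -
    obtain m where m: "l = Suc (Suc m)" using l by (metis Suc_le_D atLeastAtMost_iff numeral_2_eq_2 Suc_le_mono)
    have "good (Suc m)" using l m by (intro good) simp
    then have "rho c Cpr l \<le> q_lev c Cpr l + (rho c Cpr (l - 1))\<^sup>2" using step[of m] l m by simp
    then show ?thesis using ql[OF l] by linarith
  qed
  moreover have "(\<forall>l\<in>{1..L}. rho c Cpr l \<le> rho_star ?q) \<and> rho_star ?q \<le> 2 * ?q \<and> 2 * ?q < 1" if q4: "?q \<le> 1 / 4"
  proof -
    \<comment> \<open>\<open>L \<ge> 2\<close> makes the set of levels nonempty, so one nonnegative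
      \<open>q_lev\<close> bounds the supremum from below.\<close>
    have q0: "0 \<le> ?q" using ql[of 2] q_props[of 2] assms(10) by force
    note rs = rho_star_fixed_point[OF q0 q4]
    have "rho c Cpr (Suc m) \<le> rho_star ?q" if "Suc m \<le> L" for m
      using that
    proof (induction m)
      case 0
      then show ?case using rho1 rs(2) by simp
    next
      case (Suc m)
      \<comment> \<open>Squaring is monotone only on nonnegative numbers, hence the sign condition
        in \<open>good\<close>.\<close>
      have "0 \<le> rho c Cpr (Suc m)" using good[of m] Suc.prems by (simp add: good_def)
      moreover have "rho c Cpr (Suc m) \<le> rho_star ?q" using Suc by simp
      ultimately have "(rho c Cpr (Suc m))\<^sup>2 \<le> (rho_star ?q)\<^sup>2" by (rule power_mono[rotated])
      moreover have "rho c Cpr (Suc (Suc m)) \<le> ?q + (rho c Cpr (Suc m))\<^sup>2"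
        using rec[of "Suc (Suc m)"] Suc.prems by simp
      ultimately show ?case using rs(1) by linarith
    qed
    then have "rho c Cpr l \<le> rho_star ?q" if "l \<in> {1..L}" for l
      using that by (cases l) auto
    then show ?thesis using rs(3) q4 by simp
  qed
  ultimately show ?thesis by blast
qed

end
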